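(* Let $\Gamma$ be a discrete countable group, let $(X,\mu)$ be a standard Borel $\Gamma$-space, put $\mathcal{G}=\Gamma\ltimes X$, and let $E$ be a separable coefficient Banach module with trivial $\mathcal{G}$-action. Then the comparison map $\mathrm{comp}^\bullet_{\mathcal{G}}:\mathrm{H}^\bullet_{mb}(\mathcal{G},E)\to\mathrm{H}^\bullet_m(\mathcal{G},E)$ is conjugated, via the exponential isomorphisms $$\mathrm{H}^\bullet_{mb}(\mathcal{G},E)\cong\mathrm{H}^\bullet_b(\Gamma,L^\infty(X,E)),\qquad \mathrm{H}^\bullet_m(\mathcal{G},E)\cong\mathrm{H}^\bullet(\Gamma,L^0(X,E)),$$ to the composition of the usual comparison map $\mathrm{H}^\bullet_b(\Gamma,L^\infty(X,E))\to\mathrm{H}^\bullet(\Gamma,L^\infty(X,E))$ with the map $\mathrm{H}^\bullet(\Gamma,L^\infty(X,E))\to\mathrm{H}^\bullet(\Gamma,L^0(X,E))$ induced by the inclusion of coefficients $L^\infty(X,E)\hookrightarrow L^0(X,E)$; that is, the resulting square commutes.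
   Context: **Setting.** $(X,\mu)$ is a standard Borel space with a Borel $\Gamma$-action preserving the class of $\mu$. $\mathcal{G}=\Gamma\ltimes X$ is the groupoid with underlying set $\Gamma\times X$, unit space $X$, $s(\gamma,x)=x$, $t(\gamma,x)=\gamma x$, $(\gamma',\gamma x)(\gamma,x)=(\gamma'\gamma,x)$, $(\gamma,x)^{-1}=(\gamma^{-1},\gamma x)$, with measure class of (counting)$\times\mu$. $E$ is a separable Banach space which is the dual of a separable Banach space, with trivial action ($g\cdot v=v$). **Cohomologies of $\mathcal{G}$.** $\mathcal{G}^{(n)}$ is the set of $n$-tuples of elements of $\mathcal{G}$ with common target; $\Gamma^n\times X\to\mathcal{G}^{(n)}$, $(\gamma_1,\dots,\gamma_n,x)\mapsto((\gamma_1,\gamma_1^{-1}x),\dots,(\gamma_n,\gamma_n^{-1}x))$ is a Borel bijection through which $\mathcal{G}^{(n)}$ gets the class of (counting)$\times\mu$. $L^\infty(\mathcal{G}^{(n)},E)$ (resp. $L^0(\mathcal{G}^{(n)},E)$) is the space of essentially bounded measurable (resp. of all Borel) functions modulo null sets; $\lambda$ is $\mathcal{G}$-invariant if $\lambda(g^{-1}g_1,\dots,g^{-1}g_n)=\lambda(g_1,\dots,g_n)$ for a.e. $(g,g_1,\dots,g_n)\in\mathcal{G}^{(n+1)}$. $\mathrm{H}^\bullet_{mb}(\mathcal{G},E)$ is the cohomology of $(L^\infty(\mathcal{G}^{(\bullet+1)},E)^{\mathcal{G}},\delta)$ with $\delta$ the homogeneous coboundary. $\mathrm{H}^\bullet_m(\mathcal{G},E)$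 is Westman's measurable cohomology, originally the cohomology of Borel functions (modulo null sets) on spaces of composable tuples $(g_1,\dots,g_\bullet)$, $s(g_i)=t(g_{i+1})$, with the inhomogeneous coboundary; it is identified with the cohomology of $(L^0(\mathcal{G}^{(\bullet+1)},E)^{\mathcal{G}},\delta)$ through $\lambda\mapsto\big((g_0,\dots,g_\bullet)\mapsto\lambda(g_0^{-1}g_1,\dots,g_{\bullet-1}^{-1}g_\bullet)\big)$ (in degree $0$, $g\mapsto\lambda(t(g))$ as printed in the paper). The comparison map $\mathrm{comp}^\bullet_{\mathcal{G}}$ is induced by the inclusion $L^\infty(\mathcal{G}^{(\bullet+1)},E)^{\mathcal{G}}\hookrightarrow L^0(\mathcal{G}^{(\bullet+1)},E)^{\mathcal{G}}$. **Group side.** $L^\infty(X,E)$ and $L^0(X,E)$ carry the action $(\gamma\cdot\lambda)(x)=\lambda(\gamma^{-1}x)$. For a $\Gamma$-module $V$, $\mathrm{H}^\bullet(\Gamma,V)$ is computed by $\Gamma$-invariant functions $\Gamma^{\bullet+1}\to V$, and (for $V$ normed) $\mathrm{H}^\bullet_b(\Gamma,V)$ by the bounded ones; the usual comparison map is induced by inclusion. The exponential isomorphisms (for $\mathrm{H}_m$ this is Westman's exponential law) are induced by $\lambda\mapsto\big((\gamma_1,\dots,\gamma_{n})\mapsto(x\mapsto\lambda((\gamma_1,\gamma_1^{-1}x),\dots,(\gamma_{n},\gamma_{n}^{-1}x)))\big)$. *)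

theory Defs
  imports
    "HOL-Probability.Essential_Supremum"
    "HOL-Algebra.Module"
    "HOL-Algebra.AbelCoset"
    "HOL-Algebra.Group_Action"
begin

section \<open>Real vector spaces on carriers, quotients, cohomology\<close>

definition real_field :: "real ring" where
  "real_field = \<lparr>carrier = UNIV, mult = (*), one = 1, zero = 0, add = (+)\<rparr>"

definition linear_hom ::
    "(real, 'a) module \<Rightarrow> (real, 'b) module \<Rightarrow> ('a \<Rightarrow> 'b) \<Rightarrow> bool" where
  "linear_hom A B f \<longleftrightarrow>
     Module.module real_field A \<and> Module.module real_field B \<and>
     f \<in> carrier A \<rightarrow> carrier B \<and>
     (\<forall>x\<in>carrier A. \<forall>y\<in>carrier A. f (x \<oplus>\<^bsub>A\<^esub> y) = f x \<oplus>\<^bsub>B\<^esub> f y) \<and>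
     (\<forall>r. \<forall>x\<in>carrier A. f (r \<odot>\<^bsub>A\<^esub> x) = r \<odot>\<^bsub>B\<^esub> f x)"

definition linear_iso ::
    "(real, 'a) module \<Rightarrow> (real, 'b) module \<Rightarrow> ('a \<Rightarrow> 'b) \<Rightarrow> bool" where
  "linear_iso A B f \<longleftrightarrow> linear_hom A B f \<and> bij_betw f (carrier A) (carrier B)"

text \<open>
  The map on cosets \<open>[c] \<mapsto> [\<phi> c]\<close>, with target cosets taken modulo \<open>N\<close> in \<open>B\<close>. The union runs over
  all representatives; when the class of \<open>\<phi> c\<close> does not depend on the representative it is
  a union of equal cosets, i.e. that coset itself.
\<close>
definition induced :: "(real, 'b) module \<Rightarrow> 'b set \<Rightarrow> ('a \<Rightarrow> 'b) \<Rightarrow> 'a set \<Rightarrow> 'b set" where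
  "induced B N \<phi> C = (\<Union>c\<in>C. N +>\<^bsub>B\<^esub> \<phi> c)"

text \<open>
  The multiplicative fields of a module record play no role, hence \<open>undefined\<close> below.
\<close>
definition quot_module :: "(real, 'a) module \<Rightarrow> 'a set \<Rightarrow> (real, 'a set) module" where
  "quot_module A N =
     \<lparr>carrier = a_rcosets\<^bsub>A\<^esub> N, mult = undefined, one = undefined,
      zero = N, add = (\<lambda>C D. C <+>\<^bsub>A\<^esub> D),
      smult = (\<lambda>r. induced A N (\<lambda>c. r \<odot>\<^bsub>A\<^esub> c))\<rparr>"

definition cocycles ::
    "(nat \<Rightarrow> (real, 'c) module) \<Rightarrow> (nat \<Rightarrow> 'c \<Rightarrow> 'c) \<Rightarrow> nat \<Rightarrow> (real, 'c) module" where
  "cocycles C d n = (C n)\<lparr>carrier := {c \<in> carrier (C n). d n c = \<zero>\<^bsub>C (Suc n)\<^esub>}\<rparr>"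

definition coboundaries ::
    "(nat \<Rightarrow> (real, 'c) module) \<Rightarrow> (nat \<Rightarrow> 'c \<Rightarrow> 'c) \<Rightarrow> nat \<Rightarrow> 'c set" where
  "coboundaries C d n =
     (case n of 0 \<Rightarrow> {\<zero>\<^bsub>C 0\<^esub>} | Suc m \<Rightarrow> d m ` carrier (C m))"

definition cohomology ::
    "(nat \<Rightarrow> (real, 'c) module) \<Rightarrow> (nat \<Rightarrow> 'c \<Rightarrow> 'c) \<Rightarrow> nat \<Rightarrow> (real, 'c set) module" where
  "cohomology C d n = quot_module (cocycles C d n) (coboundaries C d n)"

text \<open>The map induced in degree \<open>n\<close> by a cochain map \<open>\<phi>\<close> into the complex \<open>(C, d)\<close>.\<close>
definition cohomology_map ::
    "(nat \<Rightarrow> (real, 'c) module) \<Rightarrow> (nat \<Rightarrow> 'c \<Rightarrow> 'c) \<Rightarrow> (nat \<Rightarrow> 'b \<Rightarrow> 'c) \<Rightarrow>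
      nat \<Rightarrow> 'b set \<Rightarrow> 'c set" where
  "cohomology_map C d \<phi> n = induced (cocycles C d n) (coboundaries C d n) (\<phi> n)"


section \<open>The spaces \<open>L\<^sup>0\<close> and \<open>L\<^sup>\<infinity>\<close>\<close>

definition meas_fun ::
    "'a measure \<Rightarrow> (real, 'a \<Rightarrow> 'e::{banach, second_countable_topology}) module" where
  "meas_fun N =
     \<lparr>carrier = borel_measurable N, mult = undefined, one = undefined,
      zero = (\<lambda>_. 0), add = (\<lambda>f g x. f x + g x), smult = (\<lambda>r f x. r *\<^sub>R f x)\<rparr>"

definition null_fun ::
    "'a measure \<Rightarrow> ('a \<Rightarrow> 'e::{banach, second_countable_topology}) set" where
  "null_fun N = {f \<in> borel_measurable N. AE x in N. f x = 0}"

definition L0 ::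
    "'a measure \<Rightarrow> (real, ('a \<Rightarrow> 'e::{banach, second_countable_topology}) set) module" where
  "L0 N = quot_module (meas_fun N) (null_fun N)"

definition L0_map ::
    "'b measure \<Rightarrow> (('a \<Rightarrow> 'e) \<Rightarrow> 'b \<Rightarrow> 'e::{banach, second_countable_topology}) \<Rightarrow>
      ('a \<Rightarrow> 'e) set \<Rightarrow> ('b \<Rightarrow> 'e) set" where
  "L0_map N \<phi> = induced (meas_fun N) (null_fun N) \<phi>"

text \<open>
  The elements of \<open>Linf N\<close> are among those of \<open>L0 N\<close>, so the inclusion is the identity map.
\<close>
definition Linf ::
    "'a measure \<Rightarrow> (real, ('a \<Rightarrow> 'e::{banach, second_countable_topology}) set) module" where
  "Linf N = (L0 N)\<lparr>carrier :=
     {C \<in> carrier (L0 N). \<forall>f\<in>C. esssup N (\<lambda>x. ereal (norm (f x))) < \<infinity>}\<rparr>"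

text \<open>
  If \<open>N\<close> is the zero measure the essential supremum is \<open>-\<infinity>\<close>, which \<open>real_of_ereal\<close> sends to \<open>0\<close>.
\<close>
definition Linf_norm ::
    "'a measure \<Rightarrow> ('a \<Rightarrow> 'e::{banach, second_countable_topology}) set \<Rightarrow> real" where
  "Linf_norm N C = real_of_ereal (esssup N (\<lambda>x. ereal (norm ((SOME f. f \<in> C) x))))"


section \<open>Standard Borel \<open>\<Gamma>\<close>-spaces\<close>

definition standard_borel :: "'x measure \<Rightarrow> bool" where
  "standard_borel M \<longleftrightarrow>
     (\<exists>T. completely_metrizable_space T \<and> separable_space T \<and> topspace T = space M \<and>
          sets M = sigma_sets (topspace T) {U. openin T U})"

locale standard_borel_action =
  group_action \<Gamma> "space M" a + sigma_finite_measure M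
  for \<Gamma> :: "('g, 'z) monoid_scheme" and M :: "'x measure" and a :: "'g \<Rightarrow> 'x \<Rightarrow> 'x" +
  assumes standard_borel: "standard_borel M"
    and borel_action: "(\<lambda>(\<gamma>, x). a \<gamma> x) \<in> count_space (carrier \<Gamma>) \<Otimes>\<^sub>M M \<rightarrow>\<^sub>M M"
    and measure_class: "\<And>\<gamma>. \<gamma> \<in> carrier \<Gamma> \<Longrightarrow> null_sets (distr M M (a \<gamma>)) = null_sets M"


section \<open>Cohomology of a countable group\<close>

text \<open>The face map on tuples indexed by \<open>{..<Suc n}\<close>, omitting entry \<open>i\<close>.\<close>
definition omit :: "nat \<Rightarrow> nat \<Rightarrow> (nat \<Rightarrow> 'a) \<Rightarrow> nat \<Rightarrow> 'a" where
  "omit n i t = (\<lambda>j\<in>{..<n}. if j < i then t j else t (Suc j))"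

context
  fixes \<Gamma> :: "('g, 'z) monoid_scheme" (structure)
begin

definition gtuples :: "nat \<Rightarrow> (nat \<Rightarrow> 'g) set" where
  "gtuples n = (\<Pi>\<^sub>E i\<in>{..<n}. carrier \<Gamma>)"

text \<open>
  \<open>V\<close> is a vector space with \<open>\<Gamma>\<close>-action \<open>\<pi>\<close>. Cochains of degree \<open>n\<close> are the functions
  \<open>f : \<Gamma>\<^sup>n\<^sup>+\<^sup>1 \<rightarrow> V\<close> fixed by the action \<open>(\<gamma> \<cdot> f)(t) = \<gamma> \<cdot> f(\<gamma>\<^sup>-\<^sup>1 t)\<close>.
\<close>
definition grp_cochains ::
    "(real, 'v) module \<Rightarrow> ('g \<Rightarrow> 'v \<Rightarrow> 'v) \<Rightarrow> nat \<Rightarrow> (real, (nat \<Rightarrow> 'g) \<Rightarrow> 'v) module" where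
  "grp_cochains V \<pi> n =
     \<lparr>carrier = {f \<in> gtuples (Suc n) \<rightarrow>\<^sub>E carrier V.
        \<forall>\<gamma>\<in>carrier \<Gamma>. \<forall>t\<in>gtuples (Suc n). \<pi> \<gamma> (f (\<lambda>i\<in>{..<Suc n}. inv \<gamma> \<otimes> t i)) = f t},
      mult = undefined, one = undefined,
      zero = (\<lambda>t\<in>gtuples (Suc n). \<zero>\<^bsub>V\<^esub>),
      add = (\<lambda>f g. \<lambda>t\<in>gtuples (Suc n). f t \<oplus>\<^bsub>V\<^esub> g t),
      smult = (\<lambda>r f. \<lambda>t\<in>gtuples (Suc n). r \<odot>\<^bsub>V\<^esub> f t)\<rparr>"

definition grp_bounded_cochains ::
    "(real, 'v) module \<Rightarrow> ('v \<Rightarrow> real) \<Rightarrow> ('g \<Rightarrow> 'v \<Rightarrow> 'v) \<Rightarrow> nat \<Rightarrow>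
      (real, (nat \<Rightarrow> 'g) \<Rightarrow> 'v) module" where
  "grp_bounded_cochains V nrm \<pi> n = (grp_cochains V \<pi> n)\<lparr>carrier :=
     {f \<in> carrier (grp_cochains V \<pi> n). \<exists>B. \<forall>t\<in>gtuples (Suc n). nrm (f t) \<le> B}\<rparr>"

definition grp_delta ::
    "(real, 'v) module \<Rightarrow> nat \<Rightarrow> ((nat \<Rightarrow> 'g) \<Rightarrow> 'v) \<Rightarrow> (nat \<Rightarrow> 'g) \<Rightarrow> 'v" where
  "grp_delta V n f = (\<lambda>t\<in>gtuples (Suc (Suc n)).
     \<Oplus>\<^bsub>V\<^esub>i\<in>{..Suc n}. (- 1) ^ i \<odot>\<^bsub>V\<^esub> f (omit (Suc n) i t))"

definition H_grp ::
    "(real, 'v) module \<Rightarrow> ('g \<Rightarrow> 'v \<Rightarrow> 'v) \<Rightarrow> nat \<Rightarrow> (real, ((nat \<Rightarrow> 'g) \<Rightarrow> 'v) set) module" where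
  "H_grp V \<pi> = cohomology (grp_cochains V \<pi>) (grp_delta V)"

definition Hb_grp ::
    "(real, 'v) module \<Rightarrow> ('v \<Rightarrow> real) \<Rightarrow> ('g \<Rightarrow> 'v \<Rightarrow> 'v) \<Rightarrow> nat \<Rightarrow>
      (real, ((nat \<Rightarrow> 'g) \<Rightarrow> 'v) set) module" where
  "Hb_grp V nrm \<pi> = cohomology (grp_bounded_cochains V nrm \<pi>) (grp_delta V)"

definition comp_grp ::
    "(real, 'v) module \<Rightarrow> ('g \<Rightarrow> 'v \<Rightarrow> 'v) \<Rightarrow> nat \<Rightarrow>
      ((nat \<Rightarrow> 'g) \<Rightarrow> 'v) set \<Rightarrow> ((nat \<Rightarrow> 'g) \<Rightarrow> 'v) set" where
  "comp_grp V \<pi> = cohomology_map (grp_cochains V \<pi>) (grp_delta V) (\<lambda>n f. f)"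

text \<open>The change of coefficients along an equivariant linear map \<open>j\<close> into \<open>(W, \<rho>)\<close>.\<close>
definition coeff_map ::
    "(real, 'w) module \<Rightarrow> ('g \<Rightarrow> 'w \<Rightarrow> 'w) \<Rightarrow> ('v \<Rightarrow> 'w) \<Rightarrow> nat \<Rightarrow>
      ((nat \<Rightarrow> 'g) \<Rightarrow> 'v) set \<Rightarrow> ((nat \<Rightarrow> 'g) \<Rightarrow> 'w) set" where
  "coeff_map W \<rho> j = cohomology_map (grp_cochains W \<rho>) (grp_delta W)
     (\<lambda>n f. \<lambda>t\<in>gtuples (Suc n). j (f t))"

end


section \<open>The action groupoid \<open>\<Gamma> \<ltimes> X\<close>\<close>

definition gsrc :: "'g \<times> 'x \<Rightarrow> 'x" where
  "gsrc g = snd g"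

definition gtgt :: "('g \<Rightarrow> 'x \<Rightarrow> 'x) \<Rightarrow> 'g \<times> 'x \<Rightarrow> 'x" where
  "gtgt a g = a (fst g) (snd g)"

context
  fixes \<Gamma> :: "('g, 'z) monoid_scheme" (structure)
    and M :: "'x measure"
    and a :: "'g \<Rightarrow> 'x \<Rightarrow> 'x"
begin

text \<open>The product \<open>gmul g h\<close> is meaningful for \<open>gsrc g = gtgt a h\<close>.\<close>
definition gmul :: "'g \<times> 'x \<Rightarrow> 'g \<times> 'x \<Rightarrow> 'g \<times> 'x" where
  "gmul g h = (fst g \<otimes> fst h, snd h)"

definition ginv :: "'g \<times> 'x \<Rightarrow> 'g \<times> 'x" where
  "ginv g = (inv (fst g), a (fst g) (snd g))"

definition arrows :: "('g \<times> 'x) measure" where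
  "arrows = count_space (carrier \<Gamma>) \<Otimes>\<^sub>M M"

subsection \<open>Tuples with common target\<close>

definition fibred :: "nat \<Rightarrow> (nat \<Rightarrow> 'g \<times> 'x) set" where
  "fibred n = {p \<in> (\<Pi>\<^sub>E i\<in>{..<n}. space arrows). \<forall>i<n. \<forall>j<n. gtgt a (p i) = gtgt a (p j)}"

definition fibred_param :: "nat \<Rightarrow> (nat \<Rightarrow> 'g) \<times> 'x \<Rightarrow> nat \<Rightarrow> 'g \<times> 'x" where
  "fibred_param n = (\<lambda>(t, x). \<lambda>i\<in>{..<n}. (t i, a (inv (t i)) x))"

text \<open>
  \<open>\<G>\<^sup>(\<^sup>n\<^sup>)\<close> as a Borel subspace of \<open>\<G>\<^sup>n\<close>, with the image of (counting) \<open>\<times> \<mu>\<close>; for \<open>n \<ge> 1\<close> the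
  parametrisation is a Borel bijection from \<open>\<Gamma>\<^sup>n \<times> X\<close>. Only \<open>n \<ge> 1\<close> is used.
\<close>
definition fibredM :: "nat \<Rightarrow> (nat \<Rightarrow> 'g \<times> 'x) measure" where
  "fibredM n = distr (count_space (gtuples \<Gamma> n) \<Otimes>\<^sub>M M)
     (restrict_space (\<Pi>\<^sub>M i\<in>{..<n}. arrows) (fibred n)) (fibred_param n)"

text \<open>
  \<open>\<lambda>(g\<^sup>-\<^sup>1g\<^sub>1, \<dots>, g\<^sup>-\<^sup>1g\<^sub>n) = \<lambda>(g\<^sub>1, \<dots>, g\<^sub>n)\<close> for a.e. \<open>(g, g\<^sub>1, \<dots>, g\<^sub>n)\<close>; here \<open>g\<close> is entry \<open>0\<close> of \<open>p\<close>.
\<close>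
definition invariant :: "nat \<Rightarrow> ((nat \<Rightarrow> 'g \<times> 'x) \<Rightarrow> 'e) \<Rightarrow> bool" where
  "invariant n f \<longleftrightarrow> (AE p in fibredM (Suc n).
     f (\<lambda>i\<in>{..<n}. gmul (ginv (p 0)) (p (Suc i))) = f (\<lambda>i\<in>{..<n}. p (Suc i)))"

definition hom_cochains ::
    "nat \<Rightarrow> (real, ((nat \<Rightarrow> 'g \<times> 'x) \<Rightarrow> 'e::{banach, second_countable_topology}) set) module" where
  "hom_cochains n = (L0 (fibredM (Suc n)))\<lparr>carrier :=
     {C \<in> carrier (L0 (fibredM (Suc n))). \<forall>f\<in>C. invariant (Suc n) f}\<rparr>"

definition hom_bounded_cochains ::
    "nat \<Rightarrow> (real, ((nat \<Rightarrow> 'g \<times> 'x) \<Rightarrow> 'e::{banach, second_countable_topology}) set) module" where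
  "hom_bounded_cochains n = (Linf (fibredM (Suc n)))\<lparr>carrier :=
     {C \<in> carrier (Linf (fibredM (Suc n))). \<forall>f\<in>C. invariant (Suc n) f}\<rparr>"

definition hom_delta ::
    "nat \<Rightarrow> ((nat \<Rightarrow> 'g \<times> 'x) \<Rightarrow> 'e::{banach, second_countable_topology}) set \<Rightarrow>
      ((nat \<Rightarrow> 'g \<times> 'x) \<Rightarrow> 'e) set" where
  "hom_delta n = L0_map (fibredM (Suc (Suc n)))
     (\<lambda>f p. \<Sum>i\<le>Suc n. (- 1) ^ i *\<^sub>R f (omit (Suc n) i p))"

definition H_mb :: "'e::{banach, second_countable_topology} itself \<Rightarrow> nat \<Rightarrow>
      (real, ((nat \<Rightarrow> 'g \<times> 'x) \<Rightarrow> 'e) set set) module" where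
  "H_mb E = cohomology hom_bounded_cochains hom_delta"

definition H_hom :: "'e::{banach, second_countable_topology} itself \<Rightarrow> nat \<Rightarrow>
      (real, ((nat \<Rightarrow> 'g \<times> 'x) \<Rightarrow> 'e) set set) module" where
  "H_hom E = cohomology hom_cochains hom_delta"

subsection \<open>Composable strings and Westman's complex\<close>

text \<open>
  A composable string \<open>(g\<^sub>1, \<dots>, g\<^sub>n)\<close> (stored at indices \<open>0, \<dots>, n - 1\<close>) is recorded together with
  the source \<open>x\<close> of its last arrow. For \<open>n \<ge> 1\<close> this adds no information; for \<open>n = 0\<close> it yields
  the unit space, as required.
\<close>
definition strings :: "nat \<Rightarrow> ((nat \<Rightarrow> 'g \<times> 'x) \<times> 'x) set" where
  "strings n = {(p, x). p \<in> (\<Pi>\<^sub>E i\<in>{..<n}. space arrows) \<and> x \<in> space M \<and>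
     (\<forall>i. Suc i < n \<longrightarrow> gsrc (p i) = gtgt a (p (Suc i))) \<and>
     (0 < n \<longrightarrow> gsrc (p (n - 1)) = x)}"

text \<open>
  The source of the arrow at index \<open>i\<close> is \<open>\<gamma>\<^sub>i\<^sub>+\<^sub>1 \<cdots> \<gamma>\<^sub>n\<^sub>-\<^sub>1 x\<close>.
\<close>
definition strings_param :: "nat \<Rightarrow> (nat \<Rightarrow> 'g) \<times> 'x \<Rightarrow> (nat \<Rightarrow> 'g \<times> 'x) \<times> 'x" where
  "strings_param n = (\<lambda>(t, x).
     (\<lambda>i\<in>{..<n}. (t i, foldr (\<lambda>j. a (t j)) [Suc i..<n] x), x))"

definition stringsM :: "nat \<Rightarrow> ((nat \<Rightarrow> 'g \<times> 'x) \<times> 'x) measure" where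
  "stringsM n = distr (count_space (gtuples \<Gamma> n) \<Otimes>\<^sub>M M)
     (restrict_space ((\<Pi>\<^sub>M i\<in>{..<n}. arrows) \<Otimes>\<^sub>M M) (strings n)) (strings_param n)"

text \<open>
  The faces of a string of \<open>n + 1\<close> arrows: omit the first arrow, compose two consecutive arrows,
  or omit the last arrow (the new source being the target of the omitted arrow).
\<close>
definition string_face ::
    "nat \<Rightarrow> nat \<Rightarrow> (nat \<Rightarrow> 'g \<times> 'x) \<times> 'x \<Rightarrow> (nat \<Rightarrow> 'g \<times> 'x) \<times> 'x" where
  "string_face n i = (\<lambda>(p, x).
     if i = 0 then (\<lambda>j\<in>{..<n}. p (Suc j), x)
     else if i \<le> n then
       (\<lambda>j\<in>{..<n}. if Suc j < i then p j
                   else if Suc j = i then gmul (p j) (p (Suc j))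
                   else p (Suc j), x)
     else (\<lambda>j\<in>{..<n}. p j, gtgt a (p n)))"

definition westman_cochains ::
    "nat \<Rightarrow> (real, ((nat \<Rightarrow> 'g \<times> 'x) \<times> 'x \<Rightarrow> 'e::{banach, second_countable_topology}) set) module" where
  "westman_cochains n = L0 (stringsM n)"

definition westman_delta ::
    "nat \<Rightarrow> ((nat \<Rightarrow> 'g \<times> 'x) \<times> 'x \<Rightarrow> 'e::{banach, second_countable_topology}) set \<Rightarrow>
      ((nat \<Rightarrow> 'g \<times> 'x) \<times> 'x \<Rightarrow> 'e) set" where
  "westman_delta n = L0_map (stringsM (Suc n))
     (\<lambda>f q. \<Sum>i\<le>Suc n. (- 1) ^ i *\<^sub>R f (string_face n i q))"

definition H_m :: "'e::{banach, second_countable_topology} itself \<Rightarrow> nat \<Rightarrow>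
      (real, ((nat \<Rightarrow> 'g \<times> 'x) \<times> 'x \<Rightarrow> 'e) set set) module" where
  "H_m E = cohomology westman_cochains westman_delta"

text \<open>
  The identification of Westman's cohomology with the homogeneous one, induced by
  \<open>\<lambda> \<mapsto> ((g\<^sub>0, \<dots>, g\<^sub>n) \<mapsto> \<lambda>(g\<^sub>0\<^sup>-\<^sup>1g\<^sub>1, \<dots>, g\<^sub>n\<^sub>-\<^sub>1\<^sup>-\<^sup>1g\<^sub>n))\<close>. The source of the last arrow of this string is that
  of \<open>g\<^sub>n\<close>. In degree \<open>0\<close> the formula therefore reads \<open>g \<mapsto> \<lambda>(s(g))\<close>; the function \<open>g \<mapsto> \<lambda>(t(g))\<close> is in
  general not invariant under \<open>g\<^sub>1 \<mapsto> g\<^sup>-\<^sup>1g\<^sub>1\<close>.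
\<close>
definition westman_to_hom ::
    "nat \<Rightarrow> ((nat \<Rightarrow> 'g \<times> 'x) \<times> 'x \<Rightarrow> 'e::{banach, second_countable_topology}) set set \<Rightarrow>
      ((nat \<Rightarrow> 'g \<times> 'x) \<Rightarrow> 'e) set set" where
  "westman_to_hom = cohomology_map hom_cochains hom_delta
     (\<lambda>n. L0_map (fibredM (Suc n))
        (\<lambda>f p. f (\<lambda>i\<in>{..<n}. gmul (ginv (p i)) (p (Suc i)), gsrc (p n))))"

text \<open>
  The map induced by the inclusion of bounded cochains, read in Westman's cohomology through
  the above identification.
\<close>
definition comp_gpd :: "'e::{banach, second_countable_topology} itself \<Rightarrow> nat \<Rightarrow>
      ((nat \<Rightarrow> 'g \<times> 'x) \<Rightarrow> 'e) set set \<Rightarrow>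
      ((nat \<Rightarrow> 'g \<times> 'x) \<times> 'x \<Rightarrow> 'e) set set" where
  "comp_gpd E n c =
     inv_into (carrier (H_m E n)) (westman_to_hom n)
       (cohomology_map hom_cochains hom_delta (\<lambda>n f. f) n c)"

subsection \<open>The exponential maps\<close>

text \<open>The action \<open>(\<gamma> \<cdot> \<lambda>)(x) = \<lambda>(\<gamma>\<^sup>-\<^sup>1x)\<close> on \<open>L\<^sup>0(X, E)\<close> and on \<open>L\<^sup>\<infinity>(X, E)\<close>.\<close>
definition translate :: "'g \<Rightarrow> ('x \<Rightarrow> 'e::{banach, second_countable_topology}) set \<Rightarrow>
      ('x \<Rightarrow> 'e) set" where
  "translate \<gamma> = L0_map M (\<lambda>f x. f (a (inv \<gamma>) x))"

text \<open>
  \<open>H\<^sub>b(\<Gamma>, L\<^sup>\<infinity>(X, E))\<close>, \<open>H(\<Gamma>, L\<^sup>\<infinity>(X, E))\<close> and \<open>H(\<Gamma>, L\<^sup>0(X, E))\<close>; the argument \<open>E\<close> only fixes the type of values.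
\<close>
definition Hb_Linf :: "'e::{banach, second_countable_topology} itself \<Rightarrow> nat \<Rightarrow>
      (real, ((nat \<Rightarrow> 'g) \<Rightarrow> ('x \<Rightarrow> 'e) set) set) module" where
  "Hb_Linf E = Hb_grp \<Gamma> (Linf M) (Linf_norm M) translate"

definition H_Linf :: "'e::{banach, second_countable_topology} itself \<Rightarrow> nat \<Rightarrow>
      (real, ((nat \<Rightarrow> 'g) \<Rightarrow> ('x \<Rightarrow> 'e) set) set) module" where
  "H_Linf E = H_grp \<Gamma> (Linf M) translate"

definition H_L0 :: "'e::{banach, second_countable_topology} itself \<Rightarrow> nat \<Rightarrow>
      (real, ((nat \<Rightarrow> 'g) \<Rightarrow> ('x \<Rightarrow> 'e) set) set) module" where
  "H_L0 E = H_grp \<Gamma> (L0 M) translate"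

definition comp_Linf ::
    "nat \<Rightarrow> ((nat \<Rightarrow> 'g) \<Rightarrow> ('x \<Rightarrow> 'e::{banach, second_countable_topology}) set) set \<Rightarrow>
      ((nat \<Rightarrow> 'g) \<Rightarrow> ('x \<Rightarrow> 'e) set) set" where
  "comp_Linf = comp_grp \<Gamma> (Linf M) translate"

definition Linf_to_L0 ::
    "nat \<Rightarrow> ((nat \<Rightarrow> 'g) \<Rightarrow> ('x \<Rightarrow> 'e::{banach, second_countable_topology}) set) set \<Rightarrow>
      ((nat \<Rightarrow> 'g) \<Rightarrow> ('x \<Rightarrow> 'e) set) set" where
  "Linf_to_L0 = coeff_map \<Gamma> (L0 M) translate (\<lambda>v. v)"

definition exp_cochain ::
    "nat \<Rightarrow> ((nat \<Rightarrow> 'g \<times> 'x) \<Rightarrow> 'e::{banach, second_countable_topology}) set \<Rightarrow>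
      (nat \<Rightarrow> 'g) \<Rightarrow> ('x \<Rightarrow> 'e) set" where
  "exp_cochain n C = (\<lambda>t\<in>gtuples \<Gamma> (Suc n).
     L0_map M (\<lambda>f x. f (fibred_param (Suc n) (t, x))) C)"

definition exp_mb ::
    "nat \<Rightarrow> ((nat \<Rightarrow> 'g \<times> 'x) \<Rightarrow> 'e::{banach, second_countable_topology}) set set \<Rightarrow>
      ((nat \<Rightarrow> 'g) \<Rightarrow> ('x \<Rightarrow> 'e) set) set" where
  "exp_mb = cohomology_map (grp_bounded_cochains \<Gamma> (Linf M) (Linf_norm M) translate)
     (grp_delta \<Gamma> (Linf M)) exp_cochain"

definition exp_m ::
    "nat \<Rightarrow> ((nat \<Rightarrow> 'g \<times> 'x) \<times> 'x \<Rightarrow> 'e::{banach, second_countable_topology}) set set \<Rightarrow>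
      ((nat \<Rightarrow> 'g) \<Rightarrow> ('x \<Rightarrow> 'e) set) set" where
  "exp_m n c = cohomology_map (grp_cochains \<Gamma> (L0 M) translate) (grp_delta \<Gamma> (L0 M))
     exp_cochain n (westman_to_hom n c)"

end

end

theory Submission
  imports Defs
begin

text \<open>
  The spaces of tuples with common target and of composable strings are Borel isomorphic to
  \<open>\<Gamma>\<^sup>n\<^sup>+\<^sup>1 \<times> X\<close> and \<open>\<Gamma>\<^sup>n \<times> X\<close>, and \<open>\<Gamma>\<close> is countable, so a class of functions on either of them is
  a countable family of classes of functions on \<open>X\<close>. Since
  \<open>(\<gamma>, \<gamma>\<^sup>-\<^sup>1x)\<^sup>-\<^sup>1(\<gamma>\<^sub>i, \<gamma>\<^sub>i\<^sup>-\<^sup>1x) = (\<gamma>\<^sup>-\<^sup>1\<gamma>\<^sub>i, \<gamma>\<^sub>i\<^sup>-\<^sup>1x)\<close>, invariance under the groupoid becomes equivariance under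
  \<open>\<Gamma>\<close> in these coordinates. Hence the exponential map is an isomorphism already on cochains, and it
  preserves boundedness. Westman's identification is one as well: an invariant function on tuples is
  determined by its values on those whose last group element is \<open>1\<close>. All maps of the square are
  thus induced by these isomorphisms and by inclusions of cochains.
\<close>

section \<open>Real vector spaces on carriers\<close>

text \<open>A cochain here is a coset, that is a set of functions, and a cohomology class is a set
  of cosets; the maps on both levels are the unions \<open>induced\<close>, which carry meaning only
  once independence of the representative is known. This shapes the proof: each map of functions is
  a finite combination of pullbacks and must be shown to send null functions to null functions.
  Countability of \<Gamma> turns "almost every point of \<open>\<Gamma>\<^sup>n \<times> X\<close>"
  into "every tuple and almost every x", and quasi-invariance of \<mu> handles those pullbacks that
  move x. Isomorphisms of cohomology are obtained from cochain maps that are bijective in every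
  degree, so no homotopies occur. The comparison map contains the inverse of Westman's
  identification, while the exponential map on \<open>H_m\<close> begins with that identification;
  the two cancel in the square, and an identity of cochains remains.\<close>

abbreviation real_module :: "(real, 'a) module \<Rightarrow> bool" where
  "real_module A \<equiv> Module.module real_field A"

abbreviation real_submodule :: "'a set \<Rightarrow> (real, 'a) module \<Rightarrow> bool" where
  "real_submodule S A \<equiv> submodule S real_field A"

lemma real_field_simps [simp]:
  "carrier real_field = UNIV" "\<one>\<^bsub>real_field\<^esub> = 1" "\<zero>\<^bsub>real_field\<^esub> = 0"
  "x \<otimes>\<^bsub>real_field\<^esub> y = x * y" "x \<oplus>\<^bsub>real_field\<^esub> y = x + y"
  by (auto simp: real_field_def)

lemma cring_real_field: "cring real_field"
proof (intro cringI abelian_groupI comm_monoidI)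
  show "\<exists>y\<in>carrier real_field. y \<oplus>\<^bsub>real_field\<^esub> x = \<zero>\<^bsub>real_field\<^esub>" for x
    by (auto intro: exI[of _ "- x"])
qed (auto simp: algebra_simps)

lemma a_inv_real_field [simp]: "\<ominus>\<^bsub>real_field\<^esub> x = - x"
proof -
  interpret cring real_field
    by (rule cring_real_field)
  show ?thesis
    by (rule minus_equality) auto
qed

text \<open>Additive inverses come from the law \<open>0 \<odot> x = \<zero>\<close>, which makes
  \<open>(- 1) \<odot> x\<close> the inverse of \<open>x\<close>; so the laws to check mention only
  sums and multiples.\<close>

lemma real_moduleI:
  fixes A (structure)
  assumes "\<zero> \<in> carrier A"
    and "\<And>x y. x \<in> carrier A \<Longrightarrow> y \<in> carrier A \<Longrightarrow> x \<oplus> y \<in> carrier A"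
    and "\<And>r x. x \<in> carrier A \<Longrightarrow> r \<odot> x \<in> carrier A"
    and "\<And>x y z. x \<in> carrier A \<Longrightarrow> y \<in> carrier A \<Longrightarrow> z \<in> carrier A \<Longrightarrow>
      x \<oplus> y \<oplus> z = x \<oplus> (y \<oplus> z)"
    and "\<And>x y. x \<in> carrier A \<Longrightarrow> y \<in> carrier A \<Longrightarrow> x \<oplus> y = y \<oplus> x"
    and "\<And>x. x \<in> carrier A \<Longrightarrow> \<zero> \<oplus> x = x"
    and "\<And>x. x \<in> carrier A \<Longrightarrow> 0 \<odot> x = \<zero>"
    and "\<And>r s x. x \<in> carrier A \<Longrightarrow> (r + s) \<odot> x = r \<odot> x \<oplus> s \<odot> x"
    and "\<And>r x y. x \<in> carrier A \<Longrightarrow> y \<in> carrier A \<Longrightarrow> r \<odot> (x \<oplus> y) = r \<odot> x \<oplus> r \<odot> y"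
    and "\<And>r s x. x \<in> carrier A \<Longrightarrow> (r * s) \<odot> x = r \<odot> (s \<odot> x)"
    and "\<And>x. x \<in> carrier A \<Longrightarrow> 1 \<odot> x = x"
  shows "real_module A"
proof (intro moduleI cring_real_field abelian_groupI)
  fix x assume x: "x \<in> carrier A"
  have "(- 1) \<odot> x \<oplus> x = (- 1 + 1) \<odot> x"
    using assms(8)[OF x, of "- 1" 1] assms(11)[OF x] by simp
  then show "\<exists>y\<in>carrier A. y \<oplus> x = \<zero>"
    using assms(3,7) x by (intro bexI[of _ "(- 1) \<odot> x"]) auto
qed (use assms in auto)

text \<open>Closure under negation follows from closure under multiples, as the inverse of
  \<open>x\<close> is \<open>(- 1) \<odot> x\<close>.\<close>

lemma real_submoduleI:
  fixes A (structure)
  assumes A: "real_module A"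
    and "S \<subseteq> carrier A" "\<zero> \<in> S"
    and "\<And>x y. x \<in> S \<Longrightarrow> y \<in> S \<Longrightarrow> x \<oplus> y \<in> S"
    and smult: "\<And>r x. x \<in> S \<Longrightarrow> r \<odot> x \<in> S"
  shows "real_submodule S A"
proof -
  interpret Module.module real_field A
    by (rule A)
  show ?thesis
  proof (rule submoduleI)
    fix x assume x: "x \<in> S"
    have "\<ominus> x = (- 1) \<odot> x"
      using smult_l_minus[of 1 x] x assms(2) smult_one[of x] by auto
    then show "\<ominus> x \<in> S"
      using smult x by simp
  qed (use assms in auto)
qed

lemma real_submodule_abelian_subgroup:
  assumes "real_module A" "real_submodule N A"
  shows "abelian_subgroup N A"
proof -
  interpret Module.module real_field A
    by (rule assms)
  show ?thesis
    using assms(2) by (intro abelian_subgroupI3 additive_subgroupI M.abelian_group_axioms)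
      (auto simp: submodule_def)
qed

lemma real_module_restrict:
  assumes "real_module A" "real_submodule S A"
  shows "real_module (A\<lparr>carrier := S\<rparr>)"
  using submodule.submodule_is_module[OF assms(2,1)] .

lemma linear_homD:
  assumes "linear_hom A B f"
  shows "real_module A" "real_module B"
    and "x \<in> carrier A \<Longrightarrow> f x \<in> carrier B"
    and "x \<in> carrier A \<Longrightarrow> y \<in> carrier A \<Longrightarrow> f (x \<oplus>\<^bsub>A\<^esub> y) = f x \<oplus>\<^bsub>B\<^esub> f y"
    and "x \<in> carrier A \<Longrightarrow> f (r \<odot>\<^bsub>A\<^esub> x) = r \<odot>\<^bsub>B\<^esub> f x"
    and "f \<zero>\<^bsub>A\<^esub> = \<zero>\<^bsub>B\<^esub>"
proof -
  show A: "real_module A" and B: "real_module B"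
    and f: "\<And>x. x \<in> carrier A \<Longrightarrow> f x \<in> carrier B"
    and "x \<in> carrier A \<Longrightarrow> y \<in> carrier A \<Longrightarrow> f (x \<oplus>\<^bsub>A\<^esub> y) = f x \<oplus>\<^bsub>B\<^esub> f y"
    and s: "\<And>x r. x \<in> carrier A \<Longrightarrow> f (r \<odot>\<^bsub>A\<^esub> x) = r \<odot>\<^bsub>B\<^esub> f x"
    using assms by (auto simp: linear_hom_def)
  interpret A: Module.module real_field A
    by (rule A)
  interpret B: Module.module real_field B
    by (rule B)
  have "f \<zero>\<^bsub>A\<^esub> = f (0 \<odot>\<^bsub>A\<^esub> \<zero>\<^bsub>A\<^esub>)"
    using A.smult_r_null[of 0] by simp
  also have "\<dots> = 0 \<odot>\<^bsub>B\<^esub> f \<zero>\<^bsub>A\<^esub>"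
    by (intro s) auto
  also have "\<dots> = \<zero>\<^bsub>B\<^esub>"
    using B.smult_l_null[of "f \<zero>\<^bsub>A\<^esub>"] f by simp
  finally show "f \<zero>\<^bsub>A\<^esub> = \<zero>\<^bsub>B\<^esub>" .
qed

lemma linear_homI:
  assumes "real_module A" "real_module B"
    and "\<And>x. x \<in> carrier A \<Longrightarrow> f x \<in> carrier B"
    and "\<And>x y. x \<in> carrier A \<Longrightarrow> y \<in> carrier A \<Longrightarrow> f (x \<oplus>\<^bsub>A\<^esub> y) = f x \<oplus>\<^bsub>B\<^esub> f y"
    and "\<And>r x. x \<in> carrier A \<Longrightarrow> f (r \<odot>\<^bsub>A\<^esub> x) = r \<odot>\<^bsub>B\<^esub> f x"
  shows "linear_hom A B f"
  using assms by (auto simp: linear_hom_def)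

lemma linear_hom_comp:
  assumes "linear_hom A B f" "linear_hom B C g"
  shows "linear_hom A C (\<lambda>x. g (f x))"
  using linear_homD[OF assms(1)] linear_homD[OF assms(2)] by (intro linear_homI) auto

lemma linear_iso_comp:
  assumes "linear_iso A B f" "linear_iso B C g"
  shows "linear_iso A C (\<lambda>x. g (f x))"
proof -
  have "bij_betw (g \<circ> f) (carrier A) (carrier C)"
    using assms by (intro bij_betw_trans[of f _ "carrier B"]) (auto simp: linear_iso_def)
  then show ?thesis
    using assms by (auto simp: linear_iso_def o_def intro: linear_hom_comp)
qed

lemma linear_iso_inv:
  assumes "linear_iso A B f"
  shows "linear_hom B A (inv_into (carrier A) f)"
proof -
  have lin: "linear_hom A B f" and inj: "inj_on f (carrier A)" and im: "f ` carrier A = carrier B"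
    using assms by (auto simp: linear_iso_def bij_betw_def)
  note f = linear_homD[OF lin]
  interpret A: Module.module real_field A
    by (rule f(1))
  have g: "inv_into (carrier A) f y \<in> carrier A" "f (inv_into (carrier A) f y) = y"
    if "y \<in> carrier B" for y
    using that im by (auto intro: inv_into_into f_inv_into_f)
  show ?thesis
  proof (intro linear_homI f(1,2) g)
    fix x y assume x: "x \<in> carrier B" and y: "y \<in> carrier B"
    show "inv_into (carrier A) f (x \<oplus>\<^bsub>B\<^esub> y) =
        inv_into (carrier A) f x \<oplus>\<^bsub>A\<^esub> inv_into (carrier A) f y"
      using x y g by (intro inv_into_f_eq[OF inj]) (auto simp: f(4))
  next
    fix r x assume x: "x \<in> carrier B"
    show "inv_into (carrier A) f (r \<odot>\<^bsub>B\<^esub> x) = r \<odot>\<^bsub>A\<^esub> inv_into (carrier A) f x"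
      using x g by (intro inv_into_f_eq[OF inj]) (auto simp: f(5))
  qed
qed

lemma linear_hom_inclusion:
  assumes "real_module A" "real_submodule S A"
  shows "linear_hom (A\<lparr>carrier := S\<rparr>) A (\<lambda>x. x)"
  using assms real_module_restrict[OF assms] module.submoduleE(1)[OF assms]
  by (intro linear_homI) auto


section \<open>Quotients\<close>

lemma carrier_quot_module: "carrier (quot_module A N) = (\<lambda>x. N +>\<^bsub>A\<^esub> x) ` carrier A"
  by (auto simp: quot_module_def A_RCOSETS_def')

lemma zero_quot_module [simp]: "\<zero>\<^bsub>quot_module A N\<^esub> = N"
  by (simp add: quot_module_def)

text \<open>The difference is written \<open>x \<oplus> (- 1) \<odot> y\<close> so that a linear map
  can be pushed through it by its two defining laws.\<close>

lemma coset_eq_iff: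
  assumes "real_module A" "real_submodule N A" "x \<in> carrier A" "y \<in> carrier A"
  shows "N +>\<^bsub>A\<^esub> x = N +>\<^bsub>A\<^esub> y \<longleftrightarrow> x \<oplus>\<^bsub>A\<^esub> (- 1) \<odot>\<^bsub>A\<^esub> y \<in> N"
proof -
  interpret Module.module real_field A
    by (rule assms)
  interpret abelian_subgroup N A
    by (rule real_submodule_abelian_subgroup) (fact assms)+
  have "\<ominus>\<^bsub>A\<^esub> y = (- 1) \<odot>\<^bsub>A\<^esub> y"
    using smult_l_minus[of 1 y] smult_one[of y] assms by simp
  then have "x \<in> N +>\<^bsub>A\<^esub> y \<longleftrightarrow> x \<oplus>\<^bsub>A\<^esub> (- 1) \<odot>\<^bsub>A\<^esub> y \<in> N"
    using a_rcos_module[of y x] assms by (simp add: is_abelian_group)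
  moreover have "x \<in> N +>\<^bsub>A\<^esub> y \<longleftrightarrow> N +>\<^bsub>A\<^esub> x = N +>\<^bsub>A\<^esub> y"
    using a_repr_independence'[of x y] a_rcos_self[of x] assms by auto
  ultimately show ?thesis
    by simp
qed

lemma coset_zero:
  assumes "real_module A" "real_submodule N A"
  shows "N +>\<^bsub>A\<^esub> \<zero>\<^bsub>A\<^esub> = N"
proof -
  interpret Module.module real_field A
    by (rule assms)
  show ?thesis
    using module.submoduleE(1)[OF assms] by (rule a_coset_add_zero)
qed

text \<open>Another representative is \<open>h \<oplus> c\<close> with \<open>h\<close> in
  \<open>N\<close>, and its image differs from that of \<open>c\<close> by an element of
  \<open>N'\<close>. All cosets in the union therefore coincide, and the union is not empty because
  \<open>c\<close> lies in its own coset. Well-definedness on classes of functions and on cohomology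
  classes both go back to this.\<close>

lemma induced_coset:
  assumes \<phi>: "linear_hom A B \<phi>" and N: "real_submodule N A" and N': "real_submodule N' B"
    and sub: "\<phi> ` N \<subseteq> N'" and c: "c \<in> carrier A"
  shows "induced B N' \<phi> (N +>\<^bsub>A\<^esub> c) = N' +>\<^bsub>B\<^esub> \<phi> c"
proof -
  note \<phi>' = linear_homD[OF \<phi>]
  interpret A: Module.module real_field A
    by (rule \<phi>')
  interpret B: Module.module real_field B
    by (rule \<phi>')
  interpret NA: abelian_subgroup N A
    by (rule real_submodule_abelian_subgroup) (fact \<phi>' N)+
  interpret NB: abelian_subgroup N' B
    by (rule real_submodule_abelian_subgroup) (fact \<phi>' N')+
  have "N' +>\<^bsub>B\<^esub> \<phi> d = N' +>\<^bsub>B\<^esub> \<phi> c" if d: "d \<in> N +>\<^bsub>A\<^esub> c" for d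
  proof -
    obtain h where h: "h \<in> N" "d = h \<oplus>\<^bsub>A\<^esub> c"
      using d by (auto simp: a_r_coset_def r_coset_def)
    then have "\<phi> d \<in> N' +>\<^bsub>B\<^esub> \<phi> c"
      using sub c \<phi>'(4)[of h c] NA.a_Hcarr[of h]
      by (auto simp: a_r_coset_def r_coset_def)
    then show ?thesis
      using \<phi>'(3)[OF c] NB.a_repr_independence' by auto
  qed
  moreover have "c \<in> N +>\<^bsub>A\<^esub> c"
    by (rule NA.a_rcos_self[OF c])
  ultimately show ?thesis
    unfolding induced_def by blast
qed

text \<open>Scalar multiplication in \<open>quot_module\<close> is an \<open>induced\<close> map, so
  \<open>induced_coset\<close> computes it once scaling is known to be linear; this is commutativity
  of the reals.\<close>

lemma linear_hom_smult:
  assumes "real_module A"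
  shows "linear_hom A A (\<lambda>x. r \<odot>\<^bsub>A\<^esub> x)"
proof -
  interpret Module.module real_field A
    by (rule assms)
  show ?thesis
  proof (intro linear_homI assms)
    fix s x assume x: "x \<in> carrier A"
    have "r \<odot>\<^bsub>A\<^esub> (s \<odot>\<^bsub>A\<^esub> x) = (r * s) \<odot>\<^bsub>A\<^esub> x"
      using smult_assoc1[of r s x] x by simp
    also have "\<dots> = s \<odot>\<^bsub>A\<^esub> (r \<odot>\<^bsub>A\<^esub> x)"
      using smult_assoc1[of s r x] x by (simp add: mult.commute)
    finally show "r \<odot>\<^bsub>A\<^esub> (s \<odot>\<^bsub>A\<^esub> x) = s \<odot>\<^bsub>A\<^esub> (r \<odot>\<^bsub>A\<^esub> x)" .
  qed (simp_all add: smult_r_distr)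
qed

lemma quot_module_ops:
  assumes A: "real_module A" and N: "real_submodule N A"
    and x: "x \<in> carrier A"
  shows "y \<in> carrier A \<Longrightarrow>
      (N +>\<^bsub>A\<^esub> x) \<oplus>\<^bsub>quot_module A N\<^esub> (N +>\<^bsub>A\<^esub> y) = N +>\<^bsub>A\<^esub> (x \<oplus>\<^bsub>A\<^esub> y)"
    and "r \<odot>\<^bsub>quot_module A N\<^esub> (N +>\<^bsub>A\<^esub> x) = N +>\<^bsub>A\<^esub> (r \<odot>\<^bsub>A\<^esub> x)"
proof -
  interpret abelian_subgroup N A
    by (rule real_submodule_abelian_subgroup) (fact assms)+
  show "y \<in> carrier A \<Longrightarrow>
      (N +>\<^bsub>A\<^esub> x) \<oplus>\<^bsub>quot_module A N\<^esub> (N +>\<^bsub>A\<^esub> y) = N +>\<^bsub>A\<^esub> (x \<oplus>\<^bsub>A\<^esub> y)"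
    using a_rcos_sum[of x y] x by (simp add: quot_module_def)
  show "r \<odot>\<^bsub>quot_module A N\<^esub> (N +>\<^bsub>A\<^esub> x) = N +>\<^bsub>A\<^esub> (r \<odot>\<^bsub>A\<^esub> x)"
    using induced_coset[OF linear_hom_smult[OF A] N N _ x, of r] module.submoduleE(4)[OF A N]
    by (auto simp: quot_module_def)
qed

lemma real_module_quot:
  assumes A: "real_module A" and N: "real_submodule N A"
  shows "real_module (quot_module A N)"
proof -
  interpret Module.module real_field A
    by (rule A)
  note ops = quot_module_ops[OF A N]
  have sl: "(r + s) \<odot>\<^bsub>A\<^esub> x = r \<odot>\<^bsub>A\<^esub> x \<oplus>\<^bsub>A\<^esub> s \<odot>\<^bsub>A\<^esub> x" if "x \<in> carrier A" for r s x
    using smult_l_distr[of r s x] that by simp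
  have sa: "(r * s) \<odot>\<^bsub>A\<^esub> x = r \<odot>\<^bsub>A\<^esub> (s \<odot>\<^bsub>A\<^esub> x)" if "x \<in> carrier A" for r s x
    using smult_assoc1[of r s x] that by simp
  have s0: "0 \<odot>\<^bsub>A\<^esub> x = \<zero>\<^bsub>A\<^esub>" if "x \<in> carrier A" for x
    using smult_l_null[of x] that by simp
  have s1: "1 \<odot>\<^bsub>A\<^esub> x = x" if "x \<in> carrier A" for x
    using smult_one[of x] that by simp
  have sc: "r \<odot>\<^bsub>A\<^esub> x \<in> carrier A" if "x \<in> carrier A" for r x
    using smult_closed[of r x] that by simp
  have N0: "N = N +>\<^bsub>A\<^esub> \<zero>\<^bsub>A\<^esub>"
    using coset_zero[OF A N] by simp
  show ?thesis
  proof (rule real_moduleI)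
    show "\<zero>\<^bsub>quot_module A N\<^esub> \<in> carrier (quot_module A N)"
      using N0 by (auto simp: carrier_quot_module)
    show "\<zero>\<^bsub>quot_module A N\<^esub> \<oplus>\<^bsub>quot_module A N\<^esub> x = x" if "x \<in> carrier (quot_module A N)" for x
      using that ops(1)[of "\<zero>\<^bsub>A\<^esub>"] N0 by (auto simp: carrier_quot_module)
    show "0 \<odot>\<^bsub>quot_module A N\<^esub> x = \<zero>\<^bsub>quot_module A N\<^esub>" if "x \<in> carrier (quot_module A N)" for x
      using that by (auto simp: carrier_quot_module ops s0 simp flip: N0)
  next
    fix C assume "C \<in> carrier (quot_module A N)"
    then obtain x where x: "x \<in> carrier A" and C: "C = N +>\<^bsub>A\<^esub> x"
      by (auto simp: carrier_quot_module)
    show "r \<odot>\<^bsub>quot_module A N\<^esub> C \<in> carrier (quot_module A N)" for r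
      using sc[OF x] x by (simp add: C carrier_quot_module ops)
    show "1 \<odot>\<^bsub>quot_module A N\<^esub> C = C"
      using x by (simp add: C ops s1)
    show "(r * s) \<odot>\<^bsub>quot_module A N\<^esub> C =
        r \<odot>\<^bsub>quot_module A N\<^esub> (s \<odot>\<^bsub>quot_module A N\<^esub> C)" for r s
      using sc[OF x] x by (simp add: C ops sa)
    show "(r + s) \<odot>\<^bsub>quot_module A N\<^esub> C =
        r \<odot>\<^bsub>quot_module A N\<^esub> C \<oplus>\<^bsub>quot_module A N\<^esub> s \<odot>\<^bsub>quot_module A N\<^esub> C" for r s
      using sc[OF x] x by (simp add: C ops sl)
    fix D assume "D \<in> carrier (quot_module A N)"
    then obtain y where y: "y \<in> carrier A" and D: "D = N +>\<^bsub>A\<^esub> y"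
      by (auto simp: carrier_quot_module)
    show "C \<oplus>\<^bsub>quot_module A N\<^esub> D \<in> carrier (quot_module A N)"
      using x y by (simp add: C D carrier_quot_module ops)
    show "C \<oplus>\<^bsub>quot_module A N\<^esub> D = D \<oplus>\<^bsub>quot_module A N\<^esub> C"
      using x y by (simp add: C D ops a_comm)
    show "r \<odot>\<^bsub>quot_module A N\<^esub> (C \<oplus>\<^bsub>quot_module A N\<^esub> D) =
        r \<odot>\<^bsub>quot_module A N\<^esub> C \<oplus>\<^bsub>quot_module A N\<^esub> r \<odot>\<^bsub>quot_module A N\<^esub> D" for r
      using sc[OF x] sc[OF y] x y by (simp add: C D ops smult_r_distr)
    fix E assume "E \<in> carrier (quot_module A N)"
    then obtain z where z: "z \<in> carrier A" and E: "E = N +>\<^bsub>A\<^esub> z"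
      by (auto simp: carrier_quot_module)
    show "C \<oplus>\<^bsub>quot_module A N\<^esub> D \<oplus>\<^bsub>quot_module A N\<^esub> E =
        C \<oplus>\<^bsub>quot_module A N\<^esub> (D \<oplus>\<^bsub>quot_module A N\<^esub> E)"
      using x y z by (simp add: C D E ops a_assoc)
  qed
qed

lemma linear_hom_induced:
  assumes \<phi>: "linear_hom A B \<phi>" and N: "real_submodule N A" and N': "real_submodule N' B"
    and sub: "\<phi> ` N \<subseteq> N'"
  shows "linear_hom (quot_module A N) (quot_module B N') (induced B N' \<phi>)"
proof -
  note \<phi>' = linear_homD[OF \<phi>]
  interpret A: Module.module real_field A
    by (rule \<phi>')
  have sc: "r \<odot>\<^bsub>A\<^esub> x \<in> carrier A" if "x \<in> carrier A" for r x
    using A.smult_closed[of r x] that by simp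
  note ind = induced_coset[OF assms]
  show ?thesis
  proof (intro linear_homI real_module_quot \<phi>' N N')
    fix C assume "C \<in> carrier (quot_module A N)"
    then show "induced B N' \<phi> C \<in> carrier (quot_module B N')"
      by (auto simp: carrier_quot_module ind \<phi>'(3))
  next
    fix C D assume "C \<in> carrier (quot_module A N)" "D \<in> carrier (quot_module A N)"
    then show "induced B N' \<phi> (C \<oplus>\<^bsub>quot_module A N\<^esub> D) =
        induced B N' \<phi> C \<oplus>\<^bsub>quot_module B N'\<^esub> induced B N' \<phi> D"
      by (auto simp: carrier_quot_module ind \<phi>'
          quot_module_ops[OF \<phi>'(1) N] quot_module_ops[OF \<phi>'(2) N'])
  next
    fix r C assume "C \<in> carrier (quot_module A N)"
    then show "induced B N' \<phi> (r \<odot>\<^bsub>quot_module A N\<^esub> C) = r \<odot>\<^bsub>quot_module B N'\<^esub> induced B N' \<phi> C"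
      by (auto simp: carrier_quot_module ind \<phi>' sc
          quot_module_ops[OF \<phi>'(1) N] quot_module_ops[OF \<phi>'(2) N'])
  qed
qed


section \<open>Cochain complexes\<close>

definition cochain_complex ::
    "(nat \<Rightarrow> (real, 'c) module) \<Rightarrow> (nat \<Rightarrow> 'c \<Rightarrow> 'c) \<Rightarrow> bool" where
  "cochain_complex C d \<longleftrightarrow>
     (\<forall>n. linear_hom (C n) (C (Suc n)) (d n)) \<and>
     (\<forall>n. \<forall>c\<in>carrier (C n). d (Suc n) (d n c) = \<zero>\<^bsub>C (Suc (Suc n))\<^esub>)"

definition cochain_map ::
    "(nat \<Rightarrow> (real, 'b) module) \<Rightarrow> (nat \<Rightarrow> 'b \<Rightarrow> 'b) \<Rightarrow>
      (nat \<Rightarrow> (real, 'c) module) \<Rightarrow> (nat \<Rightarrow> 'c \<Rightarrow> 'c) \<Rightarrow> (nat \<Rightarrow> 'b \<Rightarrow> 'c) \<Rightarrow> bool" where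
  "cochain_map B d C d' \<phi> \<longleftrightarrow>
     (\<forall>n. linear_hom (B n) (C n) (\<phi> n)) \<and>
     (\<forall>n. \<forall>b\<in>carrier (B n). \<phi> (Suc n) (d n b) = d' n (\<phi> n b))"

lemma carrier_cocycles:
  "carrier (cocycles C d n) = {c \<in> carrier (C n). d n c = \<zero>\<^bsub>C (Suc n)\<^esub>}"
  by (simp add: cocycles_def)

lemma cocycles_ops [simp]:
  "\<zero>\<^bsub>cocycles C d n\<^esub> = \<zero>\<^bsub>C n\<^esub>" "x \<oplus>\<^bsub>cocycles C d n\<^esub> y = x \<oplus>\<^bsub>C n\<^esub> y"
  "r \<odot>\<^bsub>cocycles C d n\<^esub> x = r \<odot>\<^bsub>C n\<^esub> x"
  by (simp_all add: cocycles_def)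

lemma real_module_cocycles:
  assumes "cochain_complex C d"
  shows "real_module (cocycles C d n)"
proof -
  have "linear_hom (C n) (C (Suc n)) (d n)"
    using assms by (simp add: cochain_complex_def)
  note d = linear_homD[OF this]
  interpret A: Module.module real_field "C n"
    by (rule d)
  interpret B: Module.module real_field "C (Suc n)"
    by (rule d)
  have "r \<odot>\<^bsub>C (Suc n)\<^esub> \<zero>\<^bsub>C (Suc n)\<^esub> = \<zero>\<^bsub>C (Suc n)\<^esub>" for r
    using B.smult_r_null[of r] by simp
  moreover have "r \<odot>\<^bsub>C n\<^esub> x \<in> carrier (C n)" if "x \<in> carrier (C n)" for r x
    using A.smult_closed[of r x] that by simp
  ultimately show ?thesis
    unfolding cocycles_def using d
    by (intro real_module_restrict real_submoduleI) auto
qed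

text \<open>Degree 0 stands apart, since only zero counts as a coboundary there. In higher degrees
  coboundaries are the image of a linear map, and \<open>d \<circ> d = 0\<close> places this image
  among the cocycles.\<close>

lemma real_submodule_coboundaries:
  assumes C: "cochain_complex C d"
  shows "real_submodule (coboundaries C d n) (cocycles C d n)"
proof (cases n)
  case 0
  interpret Module.module real_field "cocycles C d 0"
    by (rule real_module_cocycles) fact
  have "r \<odot>\<^bsub>C 0\<^esub> \<zero>\<^bsub>C 0\<^esub> = \<zero>\<^bsub>C 0\<^esub>" for r
    using smult_r_null[of r] by simp
  then show ?thesis
    unfolding 0 using zero_closed l_zero[of "\<zero>\<^bsub>C 0\<^esub>"]
    by (intro real_submoduleI real_module_cocycles[OF C]) (auto simp: coboundaries_def)
next
  case (Suc m)
  have "linear_hom (C m) (C (Suc m)) (d m)"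
    using C by (simp add: cochain_complex_def)
  note d = linear_homD[OF this]
  interpret Module.module real_field "C m"
    by (rule d)
  have dd: "\<forall>c\<in>carrier (C m). d (Suc m) (d m c) = \<zero>\<^bsub>C (Suc (Suc m))\<^esub>"
    using C by (simp add: cochain_complex_def)
  show ?thesis
    unfolding Suc
  proof (intro real_submoduleI real_module_cocycles[OF C])
    show "coboundaries C d (Suc m) \<subseteq> carrier (cocycles C d (Suc m))"
      using d dd by (auto simp: coboundaries_def carrier_cocycles)
    show "\<zero>\<^bsub>cocycles C d (Suc m)\<^esub> \<in> coboundaries C d (Suc m)"
      using d(6) by (auto simp: coboundaries_def intro!: image_eqI[of _ "d m" "\<zero>\<^bsub>C m\<^esub>"])
    fix x y r assume "x \<in> coboundaries C d (Suc m)"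
    then obtain x' where x: "x' \<in> carrier (C m)" "x = d m x'"
      by (auto simp: coboundaries_def)
    show "r \<odot>\<^bsub>cocycles C d (Suc m)\<^esub> x \<in> coboundaries C d (Suc m)"
      using x d(5)[OF x(1), of r] smult_closed[of r x']
      by (auto simp: coboundaries_def intro!: image_eqI[of _ "d m" "r \<odot>\<^bsub>C m\<^esub> x'"])
    assume "y \<in> coboundaries C d (Suc m)"
    then obtain y' where y: "y' \<in> carrier (C m)" "y = d m y'"
      by (auto simp: coboundaries_def)
    show "x \<oplus>\<^bsub>cocycles C d (Suc m)\<^esub> y \<in> coboundaries C d (Suc m)"
      using x y d(4)[OF x(1) y(1)]
      by (auto simp: coboundaries_def intro!: image_eqI[of _ "d m" "x' \<oplus>\<^bsub>C m\<^esub> y'"])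
  qed
qed

text \<open>The two conclusions are the hypotheses under which \<open>induced_coset\<close> applies
  to \<open>cohomology_map\<close>.\<close>

lemma linear_hom_cocycles:
  assumes B: "cochain_complex B d" and C: "cochain_complex C d'" and \<phi>: "cochain_map B d C d' \<phi>"
  shows "linear_hom (cocycles B d n) (cocycles C d' n) (\<phi> n)"
    and "\<phi> n ` coboundaries B d n \<subseteq> coboundaries C d' n"
proof -
  have lin: "\<And>n. linear_hom (B n) (C n) (\<phi> n)"
    and comm: "\<And>n b. b \<in> carrier (B n) \<Longrightarrow> \<phi> (Suc n) (d n b) = d' n (\<phi> n b)"
    using \<phi> by (auto simp: cochain_map_def)
  note \<phi>' = linear_homD[OF lin]
  have "d' n (\<phi> n c) = \<zero>\<^bsub>C (Suc n)\<^esub>" if "c \<in> carrier (B n)" "d n c = \<zero>\<^bsub>B (Suc n)\<^esub>" for c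
    using comm[OF that(1)] that(2) \<phi>'(6) by simp
  then show "linear_hom (cocycles B d n) (cocycles C d' n) (\<phi> n)"
    using \<phi>' by (intro linear_homI real_module_cocycles[OF B] real_module_cocycles[OF C])
      (auto simp: carrier_cocycles)
  show "\<phi> n ` coboundaries B d n \<subseteq> coboundaries C d' n"
    using comm \<phi>' by (auto simp: coboundaries_def split: nat.split)
qed

lemma cohomology_map_coset:
  assumes "cochain_complex B d" "cochain_complex C d'" "cochain_map B d C d' \<phi>"
    and "z \<in> carrier (cocycles B d n)"
  shows "cohomology_map C d' \<phi> n (coboundaries B d n +>\<^bsub>cocycles B d n\<^esub> z) =
    coboundaries C d' n +>\<^bsub>cocycles C d' n\<^esub> \<phi> n z"
  unfolding cohomology_map_def
  using assms by (intro induced_coset linear_hom_cocycles real_submodule_coboundaries)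

lemma linear_hom_cohomology_map:
  assumes "cochain_complex B d" "cochain_complex C d'" "cochain_map B d C d' \<phi>"
  shows "linear_hom (cohomology B d n) (cohomology C d' n) (cohomology_map C d' \<phi> n)"
  unfolding cohomology_map_def cohomology_def
  using assms by (intro linear_hom_induced linear_hom_cocycles real_submodule_coboundaries)

text \<open>Bijectivity is used in three neighbouring degrees: for injectivity on classes a
  primitive is lifted in degree \<open>n - 1\<close> and compared in degree \<open>n\<close>, and
  for surjectivity the preimage of a cocycle is seen to be closed in degree
  \<open>n + 1\<close>.\<close>

lemma linear_iso_cohomology_map:
  assumes B: "cochain_complex B d" and C: "cochain_complex C d'" and \<phi>: "cochain_map B d C d' \<phi>"
    and bij: "\<And>n. bij_betw (\<phi> n) (carrier (B n)) (carrier (C n))"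
  shows "linear_iso (cohomology B d n) (cohomology C d' n) (cohomology_map C d' \<phi> n)"
proof -
  let ?f = "cohomology_map C d' \<phi> n"
  have hom: "linear_hom (cohomology B d n) (cohomology C d' n) ?f"
    by (rule linear_hom_cohomology_map[OF B C \<phi>])
  have lin: "\<And>n. linear_hom (B n) (C n) (\<phi> n)"
    and comm: "\<And>n b. b \<in> carrier (B n) \<Longrightarrow> \<phi> (Suc n) (d n b) = d' n (\<phi> n b)"
    using \<phi> by (auto simp: cochain_map_def)
  have dB: "\<And>n. linear_hom (B n) (B (Suc n)) (d n)" and dC: "\<And>n. linear_hom (C n) (C (Suc n)) (d' n)"
    using B C by (auto simp: cochain_complex_def)
  note \<phi>' = linear_homD[OF lin]
  note f = cohomology_map_coset[OF B C \<phi>]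
  note BB = real_module_cocycles[OF B, of n] real_submodule_coboundaries[OF B, of n]
  note CC = real_module_cocycles[OF C, of n] real_submodule_coboundaries[OF C, of n]
  note lz = linear_homD[OF linear_hom_cocycles(1)[OF B C \<phi>]]
  interpret ZB: Module.module real_field "cocycles B d n"
    by (rule BB)
  have inj: "inj_on (\<phi> n) (carrier (B n))" for n
    using bij by (auto simp: bij_betw_def)
  have surj: "\<exists>b\<in>carrier (B n). c = \<phi> n b" if "c \<in> carrier (C n)" for c n
    using bij[of n] that by (auto simp: bij_betw_def)
  \<comment> \<open>\<open>\<phi> n\<close> reflects coboundaries: a primitive of the image is
    pulled back by surjectivity one degree lower, and injectivity identifies \<open>b\<close> with
    the coboundary of the element found.\<close>
  have refl: "b \<in> coboundaries B d n"
    if b: "b \<in> carrier (B n)" and \<phi>b: "\<phi> n b \<in> coboundaries C d' n" for b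
  proof (cases n)
    case 0
    then have "\<phi> 0 b = \<phi> 0 \<zero>\<^bsub>B 0\<^esub>"
      using \<phi>b \<phi>'(6)[of 0] by (simp add: coboundaries_def)
    moreover have "\<zero>\<^bsub>B 0\<^esub> \<in> carrier (B 0)"
      using \<phi>'(1)[of 0] by (simp add: module_def abelian_group_def abelian_monoid.zero_closed)
    ultimately show ?thesis
      using inj_onD[OF inj[of 0]] b 0 by (auto simp: coboundaries_def)
  next
    case (Suc m)
    then obtain c where c: "c \<in> carrier (C m)" "\<phi> n b = d' m c"
      using \<phi>b by (auto simp: coboundaries_def)
    obtain b' where b': "b' \<in> carrier (B m)" "c = \<phi> m b'"
      using surj[OF c(1)] by auto
    have "\<phi> (Suc m) b = \<phi> (Suc m) (d m b')"
      using c b' comm[OF b'(1)] Suc by simp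
    then have "b = d m b'"
      using inj_onD[OF inj[of "Suc m"]] b Suc linear_homD(3)[OF dB b'(1)] by auto
    then show ?thesis
      using b' Suc by (auto simp: coboundaries_def)
  qed
  have "inj_on ?f (carrier (cohomology B d n))"
  proof (rule inj_onI)
    fix X Y assume "X \<in> carrier (cohomology B d n)" "Y \<in> carrier (cohomology B d n)" "?f X = ?f Y"
    then obtain x y where x: "x \<in> carrier (cocycles B d n)" "X = coboundaries B d n +>\<^bsub>cocycles B d n\<^esub> x"
      and y: "y \<in> carrier (cocycles B d n)" "Y = coboundaries B d n +>\<^bsub>cocycles B d n\<^esub> y"
      and eq: "?f X = ?f Y"
      by (auto simp: cohomology_def carrier_quot_module)
    have sy: "(- 1) \<odot>\<^bsub>cocycles B d n\<^esub> y \<in> carrier (cocycles B d n)"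
      using ZB.smult_closed[of "- 1" y] y by simp
    have "\<phi> n x \<oplus>\<^bsub>cocycles C d' n\<^esub> (- 1) \<odot>\<^bsub>cocycles C d' n\<^esub> \<phi> n y \<in> coboundaries C d' n"
      using eq x y f by (simp add: coset_eq_iff[OF CC] lz)
    then have "\<phi> n (x \<oplus>\<^bsub>cocycles B d n\<^esub> (- 1) \<odot>\<^bsub>cocycles B d n\<^esub> y) \<in> coboundaries C d' n"
      using x y lz sy by simp
    moreover have "x \<oplus>\<^bsub>cocycles B d n\<^esub> (- 1) \<odot>\<^bsub>cocycles B d n\<^esub> y \<in> carrier (B n)"
      using ZB.a_closed[OF x(1) sy] by (simp add: carrier_cocycles)
    ultimately have "x \<oplus>\<^bsub>cocycles B d n\<^esub> (- 1) \<odot>\<^bsub>cocycles B d n\<^esub> y \<in> coboundaries B d n"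
      using refl by blast
    then show "X = Y"
      using x y by (simp add: coset_eq_iff[OF BB])
  qed
  moreover have "carrier (cohomology C d' n) \<subseteq> ?f ` carrier (cohomology B d n)"
  proof
    fix Y assume "Y \<in> carrier (cohomology C d' n)"
    then obtain c where c: "c \<in> carrier (cocycles C d' n)" "Y = coboundaries C d' n +>\<^bsub>cocycles C d' n\<^esub> c"
      by (auto simp: cohomology_def carrier_quot_module)
    then obtain b where b: "b \<in> carrier (B n)" "c = \<phi> n b"
      using surj[of c n] by (auto simp: carrier_cocycles)
    \<comment> \<open>The preimage \<open>b\<close> of a cocycle is a cocycle: \<open>d n b\<close>
      and zero have the same image, and \<open>\<phi> (Suc n)\<close> is injective.\<close>
    have "\<phi> (Suc n) (d n b) = \<phi> (Suc n) \<zero>\<^bsub>B (Suc n)\<^esub>"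
      using comm[OF b(1)] b c \<phi>'(6)[of "Suc n"] by (simp add: carrier_cocycles)
    moreover have "\<zero>\<^bsub>B (Suc n)\<^esub> \<in> carrier (B (Suc n))"
      using \<phi>'(1)[of "Suc n"] by (simp add: module_def abelian_group_def abelian_monoid.zero_closed)
    ultimately have "b \<in> carrier (cocycles B d n)"
      using inj_onD[OF inj[of "Suc n"]] b linear_homD(3)[OF dB b(1)] by (auto simp: carrier_cocycles)
    then show "Y \<in> ?f ` carrier (cohomology B d n)"
      using f[of b] c b by (auto simp: cohomology_def carrier_quot_module)
  qed
  moreover have "?f ` carrier (cohomology B d n) \<subseteq> carrier (cohomology C d' n)"
    using linear_homD(3)[OF hom] by auto
  ultimately show ?thesis
    using hom by (auto simp: linear_iso_def bij_betw_def)
qed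

text \<open>
  Only the complex \<open>C(\<Gamma>, L\<^sup>0)\<close> is checked by hand; \<open>\<delta>\<^sup>2 = 0\<close> and the linearity of \<open>\<delta>\<close> are pulled back from
  it to the other complexes.
\<close>

lemma cochain_complex_embed:
  assumes C: "cochain_complex C d'"
    and lin: "\<And>n. linear_hom (B n) (C n) (\<phi> n)"
    and inj: "\<And>n. inj_on (\<phi> n) (carrier (B n))"
    and d: "\<And>n b. b \<in> carrier (B n) \<Longrightarrow> d n b \<in> carrier (B (Suc n))"
    and comm: "\<And>n b. b \<in> carrier (B n) \<Longrightarrow> \<phi> (Suc n) (d n b) = d' n (\<phi> n b)"
  shows "cochain_complex B d" "cochain_map B d C d' \<phi>"
proof -
  note \<phi> = linear_homD[OF lin]
  have dC: "linear_hom (C n) (C (Suc n)) (d' n)" for n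
    using C by (simp add: cochain_complex_def)
  note d' = linear_homD[OF dC]
  have closed: "\<zero>\<^bsub>B n\<^esub> \<in> carrier (B n)"
    "\<And>x y. x \<in> carrier (B n) \<Longrightarrow> y \<in> carrier (B n) \<Longrightarrow> x \<oplus>\<^bsub>B n\<^esub> y \<in> carrier (B n)"
    "\<And>r x. x \<in> carrier (B n) \<Longrightarrow> r \<odot>\<^bsub>B n\<^esub> x \<in> carrier (B n)" for n
  proof -
    interpret Module.module real_field "B n"
      by (rule \<phi>)
    show "\<zero>\<^bsub>B n\<^esub> \<in> carrier (B n)"
      "\<And>x y. x \<in> carrier (B n) \<Longrightarrow> y \<in> carrier (B n) \<Longrightarrow> x \<oplus>\<^bsub>B n\<^esub> y \<in> carrier (B n)"
      "\<And>r x. x \<in> carrier (B n) \<Longrightarrow> r \<odot>\<^bsub>B n\<^esub> x \<in> carrier (B n)"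
      by auto
  qed
  show "cochain_map B d C d' \<phi>"
    using lin comm by (auto simp: cochain_map_def)
  show "cochain_complex B d"
    unfolding cochain_complex_def
  proof (intro conjI allI ballI linear_homI \<phi> d)
    fix n x y assume x: "x \<in> carrier (B n)" and y: "y \<in> carrier (B n)"
    show "d n (x \<oplus>\<^bsub>B n\<^esub> y) = d n x \<oplus>\<^bsub>B (Suc n)\<^esub> d n y"
      by (rule inj_onD[OF inj[of "Suc n"]]) (use x y in \<open>simp_all add: d closed comm \<phi> d'\<close>)
  next
    fix n x r assume x: "x \<in> carrier (B n)"
    show "d n (r \<odot>\<^bsub>B n\<^esub> x) = r \<odot>\<^bsub>B (Suc n)\<^esub> d n x"
      by (rule inj_onD[OF inj[of "Suc n"]]) (use x in \<open>simp_all add: d closed comm \<phi> d'\<close>)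
  next
    fix n x assume x: "x \<in> carrier (B n)"
    have "d' (Suc n) (d' n (\<phi> n x)) = \<zero>\<^bsub>C (Suc (Suc n))\<^esub>"
      using C \<phi>(3)[OF x] by (simp add: cochain_complex_def)
    then show "d (Suc n) (d n x) = \<zero>\<^bsub>B (Suc (Suc n))\<^esub>"
      using x d[OF d[OF x]]
      by (intro inj_onD[OF inj[of "Suc (Suc n)"]]) (simp_all add: d closed comm \<phi>(6))
  qed
qed


section \<open>Classes of measurable functions\<close>

lemma meas_fun_simps [simp]:
  "carrier (meas_fun N) = borel_measurable N"
  "\<zero>\<^bsub>meas_fun N\<^esub> = (\<lambda>_. 0)" "f \<oplus>\<^bsub>meas_fun N\<^esub> g = (\<lambda>x. f x + g x)"
  "r \<odot>\<^bsub>meas_fun N\<^esub> f = (\<lambda>x. r *\<^sub>R f x)"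
  by (simp_all add: meas_fun_def)

lemma real_module_meas_fun: "real_module (meas_fun N)"
  by (rule real_moduleI) (auto simp: algebra_simps)

lemma real_submodule_null_fun: "real_submodule (null_fun N) (meas_fun N)"
proof (rule real_submoduleI[OF real_module_meas_fun])
  fix f g :: "'a \<Rightarrow> 'b" assume f: "f \<in> null_fun N" and g: "g \<in> null_fun N"
  have "AE x in N. f x + g x = 0"
    using f g unfolding null_fun_def by (auto elim: AE_mp)
  then show "f \<oplus>\<^bsub>meas_fun N\<^esub> g \<in> null_fun N"
    using f g by (auto simp: null_fun_def)
next
  fix r and f :: "'a \<Rightarrow> 'b" assume f: "f \<in> null_fun N"
  have "AE x in N. r *\<^sub>R f x = 0"
    using f unfolding null_fun_def by (auto elim: AE_mp)
  then show "r \<odot>\<^bsub>meas_fun N\<^esub> f \<in> null_fun N"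
    using f by (auto simp: null_fun_def)
qed (auto simp: null_fun_def)

definition ae_class :: "'a measure \<Rightarrow> ('a \<Rightarrow> 'e::{banach, second_countable_topology}) \<Rightarrow> ('a \<Rightarrow> 'e) set" where
  "ae_class N f = null_fun N +>\<^bsub>meas_fun N\<^esub> f"

lemma carrier_L0: "carrier (L0 N) = ae_class N ` borel_measurable N"
  by (simp add: L0_def carrier_quot_module ae_class_def[abs_def])

lemma ae_class_in_L0 [simp]: "f \<in> borel_measurable N \<Longrightarrow> ae_class N f \<in> carrier (L0 N)"
  by (simp add: carrier_L0)

lemma L0_ops:
  assumes "f \<in> borel_measurable N"
  shows "g \<in> borel_measurable N \<Longrightarrow> ae_class N f \<oplus>\<^bsub>L0 N\<^esub> ae_class N g = ae_class N (\<lambda>x. f x + g x)"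
    and "r \<odot>\<^bsub>L0 N\<^esub> ae_class N f = ae_class N (\<lambda>x. r *\<^sub>R f x)"
  using quot_module_ops[OF real_module_meas_fun real_submodule_null_fun, of f N] assms
  by (simp_all add: L0_def ae_class_def)

lemma zero_L0: "\<zero>\<^bsub>L0 N\<^esub> = ae_class N (\<lambda>_. 0)"
proof -
  have "\<zero>\<^bsub>L0 N\<^esub> = null_fun N"
    by (simp add: L0_def)
  also have "\<dots> = null_fun N +>\<^bsub>meas_fun N\<^esub> \<zero>\<^bsub>meas_fun N\<^esub>"
    by (rule coset_zero[OF real_module_meas_fun real_submodule_null_fun, symmetric])
  also have "\<dots> = ae_class N (\<lambda>_. 0)"
    by (simp add: ae_class_def)
  finally show ?thesis .
qed

lemma real_module_L0: "real_module (L0 N)"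
  unfolding L0_def by (intro real_module_quot real_module_meas_fun real_submodule_null_fun)

lemma ae_class_eq_iff:
  assumes "f \<in> borel_measurable N" "g \<in> borel_measurable N"
  shows "ae_class N f = ae_class N g \<longleftrightarrow> (AE x in N. f x = g x)"
  using coset_eq_iff[OF real_module_meas_fun real_submodule_null_fun, of f N g] assms
  by (simp add: ae_class_def null_fun_def)

lemma mem_ae_class_iff:
  assumes "f \<in> borel_measurable N"
  shows "g \<in> ae_class N f \<longleftrightarrow> g \<in> borel_measurable N \<and> (AE x in N. g x = f x)"
proof
  assume "g \<in> ae_class N f"
  then obtain h where "h \<in> null_fun N" "g = (\<lambda>x. h x + f x)"
    by (auto simp: ae_class_def a_r_coset_def r_coset_def)
  then show "g \<in> borel_measurable N \<and> (AE x in N. g x = f x)"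
    using assms by (auto simp: null_fun_def)
next
  assume g: "g \<in> borel_measurable N \<and> (AE x in N. g x = f x)"
  then have "(\<lambda>x. g x - f x) \<in> null_fun N"
    using assms by (auto simp: null_fun_def)
  then show "g \<in> ae_class N f"
    by (auto simp: ae_class_def a_r_coset_def r_coset_def intro!: bexI[of _ "\<lambda>x. g x - f x"])
qed

lemma ae_class_self: "f \<in> borel_measurable N \<Longrightarrow> f \<in> ae_class N f"
  by (simp add: mem_ae_class_iff)

section \<open>Pullback of classes of functions\<close>

definition ae_linear ::
    "'a measure \<Rightarrow> 'b measure \<Rightarrow>
      (('a \<Rightarrow> 'e::{banach, second_countable_topology}) \<Rightarrow> 'b \<Rightarrow> 'e) \<Rightarrow> bool" where
  "ae_linear N N' \<phi> \<longleftrightarrow>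
     linear_hom (meas_fun N) (meas_fun N') \<phi> \<and> \<phi> ` null_fun N \<subseteq> null_fun N'"

lemma linear_hom_L0_map:
  assumes "ae_linear N N' \<phi>"
  shows "linear_hom (L0 N) (L0 N') (L0_map N' \<phi>)"
  using assms unfolding ae_linear_def L0_def L0_map_def
  by (intro linear_hom_induced real_submodule_null_fun) auto

lemma L0_map_ae_class:
  assumes "ae_linear N N' \<phi>" "f \<in> borel_measurable N"
  shows "L0_map N' \<phi> (ae_class N f) = ae_class N' (\<phi> f)"
  using assms unfolding ae_linear_def L0_map_def ae_class_def
  by (intro induced_coset real_submodule_null_fun) auto

text \<open>The hypotheses speak of the composites of \<open>f\<close> with \<open>\<rho> i\<close>,
  because this is the form that can be checked in coordinates, slice by slice. The sum vanishes off
  the union of finitely many null sets. Coboundaries are of this shape.\<close>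

lemma ae_linear_pullback:
  fixes \<rho> :: "'i \<Rightarrow> 'b \<Rightarrow> 'a" and c :: "'i \<Rightarrow> real"
  assumes fin: "finite I"
    and meas: "\<And>i f. i \<in> I \<Longrightarrow> f \<in> borel_measurable N \<Longrightarrow> (\<lambda>x. f (\<rho> i x) :: 'e) \<in> borel_measurable N'"
    and null: "\<And>i f. i \<in> I \<Longrightarrow> (f :: 'a \<Rightarrow> 'e) \<in> borel_measurable N \<Longrightarrow> AE x in N. f x = 0 \<Longrightarrow>
      AE x in N'. f (\<rho> i x) = 0"
  shows "ae_linear N N' (\<lambda>(f :: 'a \<Rightarrow> 'e::{banach, second_countable_topology}) x. \<Sum>i\<in>I. c i *\<^sub>R f (\<rho> i x))"
  unfolding ae_linear_def
proof
  show "linear_hom (meas_fun N) (meas_fun N') (\<lambda>(f :: 'a \<Rightarrow> 'e) x. \<Sum>i\<in>I. c i *\<^sub>R f (\<rho> i x))"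
    using meas by (intro linear_homI real_module_meas_fun)
      (auto simp: scaleR_add_right sum.distrib scaleR_sum_right mult.commute)
  show "(\<lambda>(f :: 'a \<Rightarrow> 'e) x. \<Sum>i\<in>I. c i *\<^sub>R f (\<rho> i x)) ` null_fun N \<subseteq> null_fun N'"
  proof safe
    fix f :: "'a \<Rightarrow> 'e" assume f: "f \<in> null_fun N"
    then have "AE x in N'. \<forall>i\<in>I. f (\<rho> i x) = 0"
      using null fin by (intro AE_finite_allI) (auto simp: null_fun_def)
    then have "AE x in N'. (\<Sum>i\<in>I. c i *\<^sub>R f (\<rho> i x)) = 0"
      by (rule AE_mp) (auto intro!: AE_I2 sum.neutral)
    moreover have "(\<lambda>x. \<Sum>i\<in>I. c i *\<^sub>R f (\<rho> i x)) \<in> borel_measurable N'"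
      using f meas by (auto simp: null_fun_def)
    ultimately show "(\<lambda>x. \<Sum>i\<in>I. c i *\<^sub>R f (\<rho> i x)) \<in> null_fun N'"
      by (simp add: null_fun_def)
  qed
qed

lemma ae_linear_pullback1:
  assumes "\<And>f. f \<in> borel_measurable N \<Longrightarrow> (\<lambda>x. f (\<rho> x) :: 'e) \<in> borel_measurable N'"
    and "\<And>f. (f :: 'a \<Rightarrow> 'e) \<in> borel_measurable N \<Longrightarrow> AE x in N. f x = 0 \<Longrightarrow> AE x in N'. f (\<rho> x) = 0"
  shows "ae_linear N N' (\<lambda>(f :: 'a \<Rightarrow> 'e::{banach, second_countable_topology}) x. f (\<rho> x))"
proof -
  have "ae_linear N N' (\<lambda>(f :: 'a \<Rightarrow> 'e) x. \<Sum>i\<in>{()}. 1 *\<^sub>R f (\<rho> x))"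
    by (rule ae_linear_pullback) (use assms in auto)
  then show ?thesis
    by simp
qed

text \<open>\<open>finsum\<close> is formed relative to the carrier of its record, so sums in
  \<open>Linf\<close> and in \<open>L0\<close> have to be compared by induction over the index
  set.\<close>

lemma finsum_submodule:
  assumes A: "real_module A" and S: "real_submodule S A" and g: "g \<in> I \<rightarrow> S" and fin: "finite I"
  shows "finsum (A\<lparr>carrier := S\<rparr>) g I = finsum A g I"
  using fin g
proof (induction I)
  case empty
  interpret A: Module.module real_field A
    by (rule A)
  interpret S: Module.module real_field "A\<lparr>carrier := S\<rparr>"
    by (rule real_module_restrict[OF A S])
  show ?case
    by simp
next
  case (insert i I)
  interpret A: Module.module real_field A
    by (rule A)
  interpret S: Module.module real_field "A\<lparr>carrier := S\<rparr>"
    by (rule real_module_restrict[OF A S])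
  have "S \<subseteq> carrier A"
    using module.submoduleE(1)[OF A S] .
  then have "g \<in> I \<rightarrow> carrier A" "g i \<in> carrier A"
    using insert by auto
  then show ?case
    using insert by (auto simp: A.finsum_insert S.finsum_insert)
qed

text \<open>Evaluates on representatives the sum in \<open>grp_delta\<close>, which is taken in the
  quotient.\<close>

lemma finsum_L0:
  assumes "finite I" "\<And>i. i \<in> I \<Longrightarrow> F i \<in> borel_measurable N"
  shows "(\<Oplus>\<^bsub>L0 N\<^esub>i\<in>I. c i \<odot>\<^bsub>L0 N\<^esub> ae_class N (F i)) = ae_class N (\<lambda>x. \<Sum>i\<in>I. c i *\<^sub>R F i x)"
proof -
  interpret Module.module real_field "L0 N"
    by (rule real_module_L0)
  show ?thesis
    using assms
  proof (induction I)
    case empty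
    then show ?case
      by (simp add: zero_L0)
  next
    case (insert i I)
    then show ?case
      by (subst finsum_insert) (auto simp: L0_ops)
  qed
qed


section \<open>Essentially bounded functions\<close>

lemma esssup_finite_iff:
  fixes f :: "'a \<Rightarrow> 'e::{banach, second_countable_topology}"
  assumes "f \<in> borel_measurable N"
  shows "esssup N (\<lambda>x. ereal (norm (f x))) < \<infinity> \<longleftrightarrow> (\<exists>B. AE x in N. norm (f x) \<le> B)"
proof
  assume fin: "esssup N (\<lambda>x. ereal (norm (f x))) < \<infinity>"
  \<comment> \<open>The essential supremum may be \<open>-\<infinity>\<close>, namely over the zero
    measure; any real \<open>B\<close> will then do.\<close>
  obtain B where B: "esssup N (\<lambda>x. ereal (norm (f x))) \<le> ereal B"
    using fin by (cases "esssup N (\<lambda>x. ereal (norm (f x)))") (auto intro: that)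
  have "AE x in N. ereal (norm (f x)) \<le> esssup N (\<lambda>x. ereal (norm (f x)))"
    by (rule esssup_AE)
  then have "AE x in N. norm (f x) \<le> B"
    by (rule eventually_mono) (use B in \<open>metis order_trans ereal_less_eq(3)\<close>)
  then show "\<exists>B. AE x in N. norm (f x) \<le> B" ..
next
  assume "\<exists>B. AE x in N. norm (f x) \<le> B"
  then obtain B where "AE x in N. norm (f x) \<le> B" ..
  then have "esssup N (\<lambda>x. ereal (norm (f x))) \<le> ereal B"
    using assms by (intro esssup_I) auto
  then show "esssup N (\<lambda>x. ereal (norm (f x))) < \<infinity>"
    by (auto intro: le_less_trans)
qed

text \<open>All members of a class have the same essential supremum, so the condition in
  \<open>Linf\<close>, which ranges over the whole class, can be tested on one of them.\<close>

lemma ae_class_in_Linf_iff: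
  assumes "f \<in> borel_measurable N"
  shows "ae_class N f \<in> carrier (Linf N) \<longleftrightarrow> (\<exists>B. AE x in N. norm (f x) \<le> B)"
proof -
  have *: "esssup N (\<lambda>x. ereal (norm (g x))) = esssup N (\<lambda>x. ereal (norm (f x)))" if "g \<in> ae_class N f" for g
    using that assms by (intro esssup_AE_cong) (auto simp: mem_ae_class_iff)
  have "ae_class N f \<in> carrier (Linf N) \<longleftrightarrow>
      (\<forall>g\<in>ae_class N f. esssup N (\<lambda>x. ereal (norm (g x))) < \<infinity>)"
    using assms by (simp add: Linf_def)
  also have "\<dots> \<longleftrightarrow> esssup N (\<lambda>x. ereal (norm (f x))) < \<infinity>"
    using ae_class_self[OF assms] by (metis *)
  also have "\<dots> \<longleftrightarrow> (\<exists>B. AE x in N. norm (f x) \<le> B)"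
    by (rule esssup_finite_iff[OF assms])
  finally show ?thesis .
qed

lemma Linf_subset_L0: "carrier (Linf N) \<subseteq> carrier (L0 N)"
  by (auto simp: Linf_def)

lemma Linf_cases:
  assumes "C \<in> carrier (Linf N)"
  obtains f B where "f \<in> borel_measurable N" "C = ae_class N f" "AE x in N. norm (f x) \<le> B"
proof -
  obtain f where f: "f \<in> borel_measurable N" "C = ae_class N f"
    using assms by (auto simp: Linf_def carrier_L0)
  then show ?thesis
    using assms that by (auto simp: ae_class_in_Linf_iff)
qed

lemma real_submodule_Linf: "real_submodule (carrier (Linf N)) (L0 N)"
proof (rule real_submoduleI[OF real_module_L0 Linf_subset_L0])
  show "\<zero>\<^bsub>L0 N\<^esub> \<in> carrier (Linf N)"
    by (auto simp: zero_L0 ae_class_in_Linf_iff)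
next
  fix C D :: "('a \<Rightarrow> 'b) set" assume CD: "C \<in> carrier (Linf N)" "D \<in> carrier (Linf N)"
  obtain f A where f: "f \<in> borel_measurable N" "C = ae_class N f" "AE x in N. norm (f x) \<le> A"
    using CD(1) by (rule Linf_cases)
  obtain g B where g: "g \<in> borel_measurable N" "D = ae_class N g" "AE x in N. norm (g x) \<le> B"
    using CD(2) by (rule Linf_cases)
  from f(3) g(3) have "AE x in N. norm (f x + g x) \<le> A + B"
    by eventually_elim (rule norm_triangle_mono)
  then show "C \<oplus>\<^bsub>L0 N\<^esub> D \<in> carrier (Linf N)"
    using f g by (auto simp: L0_ops ae_class_in_Linf_iff)
next
  fix r and C :: "('a \<Rightarrow> 'b) set" assume C: "C \<in> carrier (Linf N)"
  then obtain f B where f: "f \<in> borel_measurable N" "C = ae_class N f" "AE x in N. norm (f x) \<le> B"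
    by (rule Linf_cases)
  from f(3) have "AE x in N. norm (r *\<^sub>R f x) \<le> \<bar>r\<bar> * B"
    by eventually_elim (auto intro: mult_left_mono)
  then show "r \<odot>\<^bsub>L0 N\<^esub> C \<in> carrier (Linf N)"
    using f by (auto simp: L0_ops ae_class_in_Linf_iff)
qed

lemma Linf_eq: "Linf N = (L0 N)\<lparr>carrier := carrier (Linf N)\<rparr>"
  by (simp add: Linf_def)

lemma Linf_ops [simp]:
  "\<zero>\<^bsub>Linf N\<^esub> = \<zero>\<^bsub>L0 N\<^esub>" "C \<oplus>\<^bsub>Linf N\<^esub> D = C \<oplus>\<^bsub>L0 N\<^esub> D" "r \<odot>\<^bsub>Linf N\<^esub> C = r \<odot>\<^bsub>L0 N\<^esub> C"
  by (simp_all add: Linf_def)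

lemma real_module_Linf: "real_module (Linf N)"
  by (subst Linf_eq) (intro real_module_restrict real_module_L0 real_submodule_Linf)

text \<open>The hypothesis \<open>0 \<le> B\<close> covers the zero measure, where the norm is 0
  although negative constants are a.e. bounds as well.\<close>

lemma Linf_norm_le:
  assumes f: "f \<in> borel_measurable N" and B: "0 \<le> B" "AE x in N. norm (f x) \<le> B"
  shows "Linf_norm N (ae_class N f) \<le> B"
proof -
  let ?g = "SOME g. g \<in> ae_class N f"
  have "?g \<in> ae_class N f"
    using ae_class_self[OF f] by (rule someI[where P = "\<lambda>g. g \<in> ae_class N f"])
  then have "esssup N (\<lambda>x. ereal (norm (?g x))) = esssup N (\<lambda>x. ereal (norm (f x)))"
    using f by (intro esssup_AE_cong) (auto simp: mem_ae_class_iff)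
  also have "\<dots> \<le> ereal B"
    using f B by (intro esssup_I) auto
  finally show ?thesis
    using B(1) by (cases "esssup N (\<lambda>x. ereal (norm (?g x)))") (auto simp: Linf_norm_def)
qed

text \<open>Membership in \<open>Linf\<close> rules out an infinite essential supremum, which
  \<open>real_of_ereal\<close> would also send to 0.\<close>

lemma Linf_norm_leD:
  assumes f: "f \<in> borel_measurable N" and Linf: "ae_class N f \<in> carrier (Linf N)"
    and B: "Linf_norm N (ae_class N f) \<le> B"
  shows "AE x in N. norm (f x) \<le> B"
proof -
  let ?g = "SOME g. g \<in> ae_class N f"
  have "?g \<in> ae_class N f"
    using ae_class_self[OF f] by (rule someI[where P = "\<lambda>g. g \<in> ae_class N f"])
  then have "esssup N (\<lambda>x. ereal (norm (?g x))) = esssup N (\<lambda>x. ereal (norm (f x)))"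
    using f by (intro esssup_AE_cong) (auto simp: mem_ae_class_iff)
  moreover have "esssup N (\<lambda>x. ereal (norm (f x))) < \<infinity>"
    using Linf unfolding esssup_finite_iff[OF f] ae_class_in_Linf_iff[OF f] .
  ultimately have le: "esssup N (\<lambda>x. ereal (norm (f x))) \<le> ereal B"
    using B by (cases "esssup N (\<lambda>x. ereal (norm (f x)))") (auto simp: Linf_norm_def)
  have "AE x in N. ereal (norm (f x)) \<le> esssup N (\<lambda>x. ereal (norm (f x)))"
    by (rule esssup_AE)
  then show ?thesis
    by (rule eventually_mono) (use le in \<open>metis order_trans ereal_less_eq(3)\<close>)
qed


section \<open>Measures parametrised by a countable family of copies of one measure\<close>

text \<open>Tuples with common target and composable strings are both parametrised by a countable
  set times \<open>X\<close>, so the transfer to coordinates is done once for both. The inverse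
  \<open>\<psi>\<close> is measurable so that null sets found in coordinates become measurable sets
  of \<open>R\<close>.\<close>

locale parametrised = sigma_finite_measure M
  for M :: "'x measure" +
  fixes T :: "'t set" and R :: "'p measure" and \<phi> :: "'t \<times> 'x \<Rightarrow> 'p" and \<psi> :: "'p \<Rightarrow> 't \<times> 'x"
  assumes countable: "countable T"
    and \<phi>_meas: "\<phi> \<in> count_space T \<Otimes>\<^sub>M M \<rightarrow>\<^sub>M R"
    and \<psi>_meas: "\<psi> \<in> R \<rightarrow>\<^sub>M count_space T \<Otimes>\<^sub>M M"
    and \<psi>_\<phi>: "\<And>t x. t \<in> T \<Longrightarrow> x \<in> space M \<Longrightarrow> \<psi> (\<phi> (t, x)) = (t, x)"
    and \<phi>_\<psi>: "\<And>p. p \<in> space R \<Longrightarrow> \<phi> (\<psi> p) = p"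
begin

abbreviation param_measure :: "'p measure" where
  "param_measure \<equiv> distr (count_space T \<Otimes>\<^sub>M M) R \<phi>"

text \<open>For the converse, countability of \<open>T\<close> merges the exceptional sets of all
  \<open>t\<close> into one null set \<open>K\<close>. The predicate is arbitrary, so a measurable
  null set containing the exceptions has to be exhibited: the preimage of
  \<open>T \<times> K\<close> under \<open>\<psi>\<close>.\<close>

lemma AE_param_iff:
  "(AE p in param_measure. P p) \<longleftrightarrow> (\<forall>t\<in>T. AE x in M. P (\<phi> (t, x)))"
proof
  assume "AE p in param_measure. P p"
  then have *: "AE z in count_space T \<Otimes>\<^sub>M M. P (\<phi> z)"
    by (rule AE_distrD[OF \<phi>_meas])
  interpret C: sigma_finite_measure "count_space T"
    by (rule sigma_finite_measure_count_space_countable[OF countable])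
  interpret pair_sigma_finite "count_space T" M ..
  have "AE t in count_space T. AE x in M. P (\<phi> (t, x))"
    using * by (rule AE_pair)
  then show "\<forall>t\<in>T. AE x in M. P (\<phi> (t, x))"
    by (simp add: AE_count_space)
next
  assume "\<forall>t\<in>T. AE x in M. P (\<phi> (t, x))"
  then have "AE x in M. \<forall>t\<in>T. P (\<phi> (t, x))"
    using countable by (subst AE_ball_countable) auto
  then obtain K where K: "{x \<in> space M. \<not> (\<forall>t\<in>T. P (\<phi> (t, x)))} \<subseteq> K" "K \<in> null_sets M"
    by (auto elim!: AE_E simp: null_sets_def)
  have T: "T \<in> sets (count_space T)"
    by simp
  \<comment> \<open>The first factor is infinite if \<open>T\<close> is; in the extended nonnegative
    reals its product with 0 is still 0.\<close>
  have "emeasure (count_space T \<Otimes>\<^sub>M M) (T \<times> K) = emeasure (count_space T) T * emeasure M K"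
    using K by (intro emeasure_pair_measure_Times) auto
  also have "\<dots> = 0"
    using K by auto
  finally have TK: "T \<times> K \<in> null_sets (count_space T \<Otimes>\<^sub>M M)"
    using K T by (auto simp: null_sets_def)
  let ?K = "\<psi> -` (T \<times> K) \<inter> space R"
  have K': "?K \<in> sets R"
    using TK \<psi>_meas by (auto intro: measurable_sets)
  have "\<phi> -` ?K \<inter> space (count_space T \<Otimes>\<^sub>M M) = T \<times> K"
    using measurable_space[OF \<phi>_meas] sets.sets_into_space[of K M] null_setsD2[OF K(2)]
    by (auto simp: space_pair_measure \<psi>_\<phi> subset_iff)
  then have "emeasure param_measure ?K = 0"
    unfolding emeasure_distr[OF \<phi>_meas K'] using null_setsD1[OF TK] by simp
  then have "?K \<in> null_sets param_measure"
    using K' by (auto simp: null_sets_def)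
  moreover have "p \<in> ?K" if p: "p \<in> space R" "\<not> P p" for p
    using measurable_space[OF \<psi>_meas p(1)] K(1) p \<phi>_\<psi>[OF p(1)]
    by (cases "\<psi> p") (auto simp: space_pair_measure subset_iff)
  ultimately show "AE p in param_measure. P p"
    by (auto intro!: AE_I'[of ?K])
qed

text \<open>Over a countable discrete factor measurability is checked on each slice, and
  \<open>f = f \<circ> \<phi> \<circ> \<psi>\<close> on \<open>R\<close> carries it over.\<close>

lemma measurable_param_iff:
  "f \<in> param_measure \<rightarrow>\<^sub>M L \<longleftrightarrow> (\<forall>t\<in>T. (\<lambda>x. f (\<phi> (t, x))) \<in> M \<rightarrow>\<^sub>M L)"
proof
  assume "f \<in> param_measure \<rightarrow>\<^sub>M L"
  then have f: "(\<lambda>z. f (\<phi> z)) \<in> count_space T \<Otimes>\<^sub>M M \<rightarrow>\<^sub>M L"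
    using measurable_compose[OF \<phi>_meas] by simp
  show "\<forall>t\<in>T. (\<lambda>x. f (\<phi> (t, x))) \<in> M \<rightarrow>\<^sub>M L"
  proof
    fix t assume "t \<in> T"
    then show "(\<lambda>x. f (\<phi> (t, x))) \<in> M \<rightarrow>\<^sub>M L"
      using measurable_compose[OF _ f, of "\<lambda>x. (t, x)" M] by simp
  qed
next
  assume "\<forall>t\<in>T. (\<lambda>x. f (\<phi> (t, x))) \<in> M \<rightarrow>\<^sub>M L"
  then have "(\<lambda>z. f (\<phi> z)) \<in> count_space T \<Otimes>\<^sub>M M \<rightarrow>\<^sub>M L"
    using countable by (intro measurable_pair_measure_countable1) auto
  then have "(\<lambda>p. f (\<phi> (\<psi> p))) \<in> R \<rightarrow>\<^sub>M L"
    by (rule measurable_compose[OF \<psi>_meas])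
  then show "f \<in> param_measure \<rightarrow>\<^sub>M L"
    by (subst measurable_distr_eq1) (simp cong: measurable_cong add: \<phi>_\<psi>)
qed

text \<open>A measurable family glues to one measurable function without any condition linking
  different \<open>t\<close>. Surjectivity of the exponential map and of Westman's identification
  rests on this.\<close>

lemma param_function:
  assumes "\<And>t. t \<in> T \<Longrightarrow> F t \<in> M \<rightarrow>\<^sub>M L"
  shows "\<exists>f \<in> param_measure \<rightarrow>\<^sub>M L. \<forall>t\<in>T. \<forall>x\<in>space M. f (\<phi> (t, x)) = F t x"
proof (intro bexI ballI)
  let ?f = "\<lambda>p. F (fst (\<psi> p)) (snd (\<psi> p))"
  show "?f (\<phi> (t, x)) = F t x" if "t \<in> T" "x \<in> space M" for t x
    using that by (simp add: \<psi>_\<phi>)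
  then show "?f \<in> param_measure \<rightarrow>\<^sub>M L"
    using assms by (simp add: measurable_param_iff cong: measurable_cong)
qed

text \<open>One constant has to serve all \<open>t\<close>: an essentially bounded function
  corresponds to a uniformly bounded family. Passing to \<open>max 0 B\<close> gives the sign that
  \<open>Linf_norm_le\<close> asks for.\<close>

lemma ex_bound_param_iff:
  "(\<exists>B. AE p in param_measure. norm (f p) \<le> B) \<longleftrightarrow>
    (\<exists>B\<ge>0. \<forall>t\<in>T. AE x in M. norm (f (\<phi> (t, x))) \<le> B)"
proof
  assume "\<exists>B. AE p in param_measure. norm (f p) \<le> B"
  then obtain B where "\<forall>t\<in>T. AE x in M. norm (f (\<phi> (t, x))) \<le> B"
    by (auto simp: AE_param_iff)
  then have "\<forall>t\<in>T. AE x in M. norm (f (\<phi> (t, x))) \<le> max 0 B"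
    by (auto elim!: eventually_mono)
  then show "\<exists>B\<ge>0. \<forall>t\<in>T. AE x in M. norm (f (\<phi> (t, x))) \<le> B"
    by (intro exI[of _ "max 0 B"]) auto
qed (auto simp: AE_param_iff)

end


section \<open>Coordinates on the action groupoid\<close>

locale countable_action = standard_borel_action \<Gamma> M a
  for \<Gamma> :: "('g, 'z) monoid_scheme" (structure) and M :: "'x measure" and a :: "'g \<Rightarrow> 'x \<Rightarrow> 'x" +
  assumes countable_carrier: "countable (carrier \<Gamma>)"
begin

sublocale group \<Gamma>
  using group_hom by (rule group_hom.axioms(1))

lemma act_closed [simp]: "\<gamma> \<in> carrier \<Gamma> \<Longrightarrow> x \<in> space M \<Longrightarrow> a \<gamma> x \<in> space M"
  using element_image by blast

lemma act_one [simp]: "x \<in> space M \<Longrightarrow> a \<one> x = x"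
  using id_eq_one by (metis restrict_apply')

lemma act_mult:
  "\<gamma> \<in> carrier \<Gamma> \<Longrightarrow> \<delta> \<in> carrier \<Gamma> \<Longrightarrow> x \<in> space M \<Longrightarrow> a \<gamma> (a \<delta> x) = a (\<gamma> \<otimes> \<delta>) x"
  by (simp add: composition_rule)

lemma act_meas [measurable]:
  assumes "\<gamma> \<in> carrier \<Gamma>"
  shows "a \<gamma> \<in> M \<rightarrow>\<^sub>M M"
  using measurable_compose[OF _ borel_action, of "\<lambda>x. (\<gamma>, x)" M] assms by simp

text \<open>Preserving the measure class means that the image measure has the same null sets, hence
  the same almost everywhere filter. Quasi-invariance enters the proof through this fact.\<close>

lemma AE_act:
  assumes "AE x in M. P x" and \<gamma>: "\<gamma> \<in> carrier \<Gamma>"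
  shows "AE x in M. P (a \<gamma> x)"
proof -
  have "AE x in distr M M (a \<gamma>). P x"
    using assms measure_class[OF \<gamma>] by (simp add: eventually_ae_filter)
  then show ?thesis
    by (rule AE_distrD[OF act_meas[OF \<gamma>]])
qed

section \<open>Tuples of group elements\<close>

lemma gtuplesI:
  "(\<And>i. i < n \<Longrightarrow> t i \<in> carrier \<Gamma>) \<Longrightarrow> (\<lambda>i\<in>{..<n}. t i) \<in> gtuples \<Gamma> n"
  by (auto simp: gtuples_def)

lemma gtuplesD: "t \<in> gtuples \<Gamma> n \<Longrightarrow> i < n \<Longrightarrow> t i \<in> carrier \<Gamma>"
  by (auto simp: gtuples_def)

lemma gtuples_eqI:
  "t \<in> gtuples \<Gamma> n \<Longrightarrow> u \<in> gtuples \<Gamma> n \<Longrightarrow> (\<And>i. i < n \<Longrightarrow> t i = u i) \<Longrightarrow> t = u"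
  by (auto simp: gtuples_def intro: PiE_ext)

lemma countable_gtuples: "countable (gtuples \<Gamma> n)"
  unfolding gtuples_def using countable_carrier by (intro countable_PiE) auto

lemma gtuples_restrict: "t \<in> gtuples \<Gamma> n \<Longrightarrow> (\<lambda>i\<in>{..<n}. t i) = t"
  by (auto simp: gtuples_def)

lemma omit_closed: "t \<in> gtuples \<Gamma> (Suc n) \<Longrightarrow> omit n i t \<in> gtuples \<Gamma> n"
  using gtuplesD[of t "Suc n"] by (auto simp: omit_def intro!: gtuplesI)

text \<open>The argument in the invariance condition of \<open>grp_cochains\<close>; the inverse
  belongs to the convention \<open>(\<gamma> \<cdot> f)(t) = \<gamma> \<cdot>
  f(\<gamma>\<^sup>-\<^sup>1 t)\<close>.\<close>

definition gshift :: "nat \<Rightarrow> 'g \<Rightarrow> (nat \<Rightarrow> 'g) \<Rightarrow> nat \<Rightarrow> 'g" where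
  "gshift n \<gamma> t = (\<lambda>i\<in>{..<n}. inv \<gamma> \<otimes> t i)"

lemma gshift_closed: "\<gamma> \<in> carrier \<Gamma> \<Longrightarrow> t \<in> gtuples \<Gamma> n \<Longrightarrow> gshift n \<gamma> t \<in> gtuples \<Gamma> n"
  using gtuplesD[of t n] by (auto simp: gshift_def intro!: gtuplesI)

lemma omit_gshift: "i \<le> n \<Longrightarrow> omit n i (gshift (Suc n) \<gamma> t) = gshift n \<gamma> (omit n i t)"
  by (auto simp: omit_def gshift_def fun_eq_iff)

lemma space_arrows: "space (arrows \<Gamma> M) = carrier \<Gamma> \<times> space M"
  by (simp add: arrows_def space_pair_measure)

lemma arrowI:
  assumes "\<gamma> \<in> carrier \<Gamma>" "f \<in> N \<rightarrow>\<^sub>M M"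
  shows "(\<lambda>x. (\<gamma>, f x)) \<in> N \<rightarrow>\<^sub>M arrows \<Gamma> M"
  using assms unfolding arrows_def by (intro measurable_Pair) auto

text \<open>A finite product of countable discrete spaces is again discrete, so measurability can be
  checked entry by entry.\<close>

lemma tuple_entries_measurable:
  "(\<lambda>p. \<lambda>i\<in>{..<n}. fst (p i)) \<in> (\<Pi>\<^sub>M i\<in>{..<n}. arrows \<Gamma> M) \<rightarrow>\<^sub>M count_space (gtuples \<Gamma> n)"
proof -
  have "(\<lambda>p. \<lambda>i\<in>{..<n}. fst (p i)) \<in>
      (\<Pi>\<^sub>M i\<in>{..<n}. arrows \<Gamma> M) \<rightarrow>\<^sub>M (\<Pi>\<^sub>M i\<in>{..<n}. count_space (carrier \<Gamma>))"
    unfolding arrows_def by (intro measurable_restrict) (auto intro!: measurable_fst'' measurable_component_singleton)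
  then show ?thesis
    using countable_carrier by (simp add: count_space_PiM_finite gtuples_def)
qed

subsection \<open>Tuples with common target\<close>

abbreviation fp :: "nat \<Rightarrow> (nat \<Rightarrow> 'g) \<Rightarrow> 'x \<Rightarrow> nat \<Rightarrow> 'g \<times> 'x" where
  "fp n t x \<equiv> fibred_param \<Gamma> a n (t, x)"

lemma fp_in_fibred: "t \<in> gtuples \<Gamma> n \<Longrightarrow> x \<in> space M \<Longrightarrow> fp n t x \<in> fibred \<Gamma> M a n"
  using gtuplesD[of t n]
  by (auto simp: fibred_def fibred_param_def gtgt_def space_arrows act_mult)

text \<open>The inverse reads off the group entries and the target of entry 0, whence
  \<open>0 < n\<close>. The sources are then forced: an arrow with group element
  \<open>\<gamma>\<close> and target \<open>x\<close> has source
  \<open>\<gamma>\<^sup>-\<^sup>1 x\<close>.\<close>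

lemma fibred_parametrised:
  assumes n: "0 < n"
  shows "parametrised M (gtuples \<Gamma> n)
    (restrict_space (\<Pi>\<^sub>M i\<in>{..<n}. arrows \<Gamma> M) (fibred \<Gamma> M a n)) (fibred_param \<Gamma> a n)
    (\<lambda>p. (\<lambda>i\<in>{..<n}. fst (p i), gtgt a (p 0)))"
proof unfold_locales
  let ?R = "restrict_space (\<Pi>\<^sub>M i\<in>{..<n}. arrows \<Gamma> M) (fibred \<Gamma> M a n)"
  have "(\<lambda>x. fp n t x) \<in> M \<rightarrow>\<^sub>M (\<Pi>\<^sub>M i\<in>{..<n}. arrows \<Gamma> M)" if "t \<in> gtuples \<Gamma> n" for t
    using gtuplesD[OF that] unfolding fibred_param_def prod.case
    by (intro measurable_restrict arrowI) auto
  then show "fibred_param \<Gamma> a n \<in> count_space (gtuples \<Gamma> n) \<Otimes>\<^sub>M M \<rightarrow>\<^sub>M ?R"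
    by (intro measurable_restrict_space2 measurable_pair_measure_countable1 countable_gtuples)
      (auto simp: space_pair_measure fp_in_fibred)
  have "(\<lambda>p. p 0) \<in> (\<Pi>\<^sub>M i\<in>{..<n}. arrows \<Gamma> M) \<rightarrow>\<^sub>M arrows \<Gamma> M"
    using n by (intro measurable_component_singleton) auto
  then have "(\<lambda>p. (\<lambda>(\<gamma>, x). a \<gamma> x) (p 0)) \<in> (\<Pi>\<^sub>M i\<in>{..<n}. arrows \<Gamma> M) \<rightarrow>\<^sub>M M"
    unfolding arrows_def by (rule measurable_compose[OF _ borel_action])
  then show "(\<lambda>p. (\<lambda>i\<in>{..<n}. fst (p i), gtgt a (p 0))) \<in> ?R \<rightarrow>\<^sub>M count_space (gtuples \<Gamma> n) \<Otimes>\<^sub>M M"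
    by (intro measurable_Pair measurable_restrict_space1 tuple_entries_measurable)
      (simp_all add: gtgt_def case_prod_beta)
  fix t x assume t: "t \<in> gtuples \<Gamma> n" and x: "x \<in> space M"
  then show "(\<lambda>i\<in>{..<n}. fst (fp n t x i), gtgt a (fp n t x 0)) = (t, x)"
    using n gtuplesD[OF t n]
    by (simp add: fibred_param_def gtgt_def act_mult gtuples_restrict cong: restrict_cong)
next
  fix p assume "p \<in> space (restrict_space (\<Pi>\<^sub>M i\<in>{..<n}. arrows \<Gamma> M) (fibred \<Gamma> M a n))"
  then have "p \<in> fibred \<Gamma> M a n"
    by (simp add: space_restrict_space)
  then have p: "p \<in> (\<Pi>\<^sub>E i\<in>{..<n}. carrier \<Gamma> \<times> space M)"
    and tgt: "\<And>i j. i < n \<Longrightarrow> j < n \<Longrightarrow> a (fst (p i)) (snd (p i)) = a (fst (p j)) (snd (p j))"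
    unfolding fibred_def gtgt_def space_arrows by blast+
  have pi: "fst (p i) \<in> carrier \<Gamma>" "snd (p i) \<in> space M" if "i < n" for i
    using p that by (auto simp: PiE_iff mem_Times_iff)
  show "fp n (\<lambda>i\<in>{..<n}. fst (p i)) (gtgt a (p 0)) = p"
  proof
    fix i
    show "fp n (\<lambda>i\<in>{..<n}. fst (p i)) (gtgt a (p 0)) i = p i"
    proof (cases "i < n")
      case True
      then have "a (inv (fst (p i))) (a (fst (p 0)) (snd (p 0))) = snd (p i)"
        using pi[OF True] unfolding tgt[OF n True] by (simp add: act_mult)
      then show ?thesis
        using True by (simp add: fibred_param_def gtgt_def)
    next
      case False
      then show ?thesis
        using PiE_arb[OF p, of i] by (simp add: fibred_param_def)
    qed
  qed
qed (rule countable_gtuples)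

text \<open>The shape in which \<open>folded\<close> recognises \<open>fibredM\<close> in the facts
  of \<open>parametrised\<close>.\<close>

lemma fibredM_eq:
  "fibredM \<Gamma> M a n = distr (count_space (gtuples \<Gamma> n) \<Otimes>\<^sub>M M)
     (restrict_space (\<Pi>\<^sub>M i\<in>{..<n}. arrows \<Gamma> M) (fibred \<Gamma> M a n)) (fibred_param \<Gamma> a n)"
  by (simp add: fibredM_def)

lemmas fibredM_measurable_iff = parametrised.measurable_param_iff[OF fibred_parametrised[OF zero_less_Suc], folded fibredM_eq]
lemmas fibredM_AE_iff = parametrised.AE_param_iff[OF fibred_parametrised[OF zero_less_Suc], folded fibredM_eq]
lemmas fibredM_function = parametrised.param_function[OF fibred_parametrised[OF zero_less_Suc], folded fibredM_eq]
lemmas fibredM_bound_iff = parametrised.ex_bound_param_iff[OF fibred_parametrised[OF zero_less_Suc], folded fibredM_eq]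

text \<open>Faces change only the group entries and keep the common target \<open>x\<close>. Hence
  the homogeneous coboundary of the groupoid is that of \<Gamma>, slice by slice.\<close>

lemma omit_fp:
  "i \<le> n \<Longrightarrow> omit n i (fp (Suc n) t x) = fp n (omit n i t) x"
  by (auto simp: omit_def fibred_param_def fun_eq_iff)

text \<open>Left multiplication by the inverse of
  \<open>(\<gamma>, \<gamma>\<^sup>-\<^sup>1 x)\<close> moves the common target from
  \<open>x\<close> to \<open>\<gamma>\<^sup>-\<^sup>1 x\<close> and leaves the sources
  \<open>(t i)\<^sup>-\<^sup>1 x\<close> alone.\<close>

lemma fp_translate:
  assumes "\<gamma> \<in> carrier \<Gamma>" "t \<in> gtuples \<Gamma> n" "x \<in> space M"
  shows "fp n (gshift n \<gamma> t) (a (inv \<gamma>) x) = (\<lambda>i\<in>{..<n}. (inv \<gamma> \<otimes> t i, a (inv (t i)) x))"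
proof -
  have "a (inv (inv \<gamma> \<otimes> t i)) (a (inv \<gamma>) x) = a (inv (t i)) x" if "i < n" for i
    using assms gtuplesD[OF assms(2) that] by (simp add: inv_mult_group act_mult m_assoc)
  then show ?thesis
    by (auto simp: fibred_param_def gshift_def fun_eq_iff)
qed

text \<open>An \<open>(n + 2)\<close>-tuple splits into its entry 0, which supplies \<gamma>, and
  its tail, which supplies \<open>t\<close>; every pair arises in this way. The exceptional null set
  may depend on the pair.\<close>

lemma invariant_iff:
  "invariant \<Gamma> M a (Suc n) f \<longleftrightarrow> (\<forall>\<gamma>\<in>carrier \<Gamma>. \<forall>t\<in>gtuples \<Gamma> (Suc n).
     AE x in M. f (fp (Suc n) (gshift (Suc n) \<gamma> t) (a (inv \<gamma>) x)) = f (fp (Suc n) t x))"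
proof -
  define tl :: "(nat \<Rightarrow> 'g) \<Rightarrow> nat \<Rightarrow> 'g" where "tl u = (\<lambda>i\<in>{..<Suc n}. u (Suc i))" for u
  have tl: "tl u \<in> gtuples \<Gamma> (Suc n)" if "u \<in> gtuples \<Gamma> (Suc (Suc n))" for u
    using gtuplesD[OF that] by (auto simp: tl_def intro!: gtuplesI)
  have "invariant \<Gamma> M a (Suc n) f \<longleftrightarrow> (\<forall>u\<in>gtuples \<Gamma> (Suc (Suc n)).
     AE x in M. f (fp (Suc n) (gshift (Suc n) (u 0) (tl u)) (a (inv (u 0)) x)) = f (fp (Suc n) (tl u) x))"
    unfolding invariant_def fibredM_AE_iff
  proof (intro ball_cong refl AE_cong)
    fix u x assume u: "u \<in> gtuples \<Gamma> (Suc (Suc n))" and x: "x \<in> space M"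
    let ?p = "fp (Suc (Suc n)) u x"
    have u0: "u 0 \<in> carrier \<Gamma>"
      using gtuplesD[OF u] by simp
    have "(\<lambda>i\<in>{..<Suc n}. gmul \<Gamma> (ginv \<Gamma> a (?p 0)) (?p (Suc i))) =
        fp (Suc n) (gshift (Suc n) (u 0) (tl u)) (a (inv (u 0)) x)"
      unfolding fp_translate[OF u0 tl[OF u] x]
      by (auto simp: fibred_param_def gmul_def ginv_def tl_def fun_eq_iff)
    moreover have "(\<lambda>i\<in>{..<Suc n}. ?p (Suc i)) = fp (Suc n) (tl u) x"
      by (auto simp: fibred_param_def tl_def fun_eq_iff)
    ultimately show "f (\<lambda>i\<in>{..<Suc n}. gmul \<Gamma> (ginv \<Gamma> a (?p 0)) (?p (Suc i))) = f (\<lambda>i\<in>{..<Suc n}. ?p (Suc i)) \<longleftrightarrow>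
        f (fp (Suc n) (gshift (Suc n) (u 0) (tl u)) (a (inv (u 0)) x)) = f (fp (Suc n) (tl u) x)"
      by simp
  qed
  also have "\<dots> \<longleftrightarrow> (\<forall>\<gamma>\<in>carrier \<Gamma>. \<forall>t\<in>gtuples \<Gamma> (Suc n).
     AE x in M. f (fp (Suc n) (gshift (Suc n) \<gamma> t) (a (inv \<gamma>) x)) = f (fp (Suc n) t x))"
  proof (intro iffI ballI)
    fix \<gamma> t assume *: "\<forall>u\<in>gtuples \<Gamma> (Suc (Suc n)).
       AE x in M. f (fp (Suc n) (gshift (Suc n) (u 0) (tl u)) (a (inv (u 0)) x)) = f (fp (Suc n) (tl u) x)"
      and \<gamma>: "\<gamma> \<in> carrier \<Gamma>" and t: "t \<in> gtuples \<Gamma> (Suc n)"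
    let ?u = "\<lambda>i\<in>{..<Suc (Suc n)}. case i of 0 \<Rightarrow> \<gamma> | Suc j \<Rightarrow> t j"
    have "?u \<in> gtuples \<Gamma> (Suc (Suc n))"
      using \<gamma> gtuplesD[OF t] by (auto intro!: gtuplesI split: nat.split)
    moreover have "tl ?u = t"
      using gtuples_restrict[OF t] by (simp add: tl_def cong: restrict_cong)
    ultimately show "AE x in M. f (fp (Suc n) (gshift (Suc n) \<gamma> t) (a (inv \<gamma>) x)) = f (fp (Suc n) t x)"
      using *[rule_format, of ?u] by simp
  qed (use tl gtuplesD in auto)
  finally show ?thesis .
qed

subsection \<open>Composable strings\<close>

abbreviation sp :: "nat \<Rightarrow> (nat \<Rightarrow> 'g) \<Rightarrow> 'x \<Rightarrow> (nat \<Rightarrow> 'g \<times> 'x) \<times> 'x" where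
  "sp n s x \<equiv> strings_param a n (s, x)"

lemma foldr_act_closed:
  "\<lbrakk>\<And>j. j \<in> set js \<Longrightarrow> s j \<in> carrier \<Gamma>; x \<in> space M\<rbrakk> \<Longrightarrow> foldr (\<lambda>j. a (s j)) js x \<in> space M"
  by (induction js) auto

lemma foldr_act_measurable:
  "(\<And>j. j \<in> set js \<Longrightarrow> s j \<in> carrier \<Gamma>) \<Longrightarrow> (\<lambda>x. foldr (\<lambda>j. a (s j)) js x) \<in> M \<rightarrow>\<^sub>M M"
proof (induction js)
  case (Cons j js)
  then show ?case
    using measurable_compose[OF Cons.IH act_meas[of "s j"]] by simp
qed simp

lemma foldr_upt_step: "i < n \<Longrightarrow> foldr f [i..<n] x = f i (foldr f [Suc i..<n] x)"
  by (simp add: upt_conv_Cons)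

lemma sp_in_strings:
  assumes s: "s \<in> gtuples \<Gamma> n" and x: "x \<in> space M"
  shows "sp n s x \<in> strings \<Gamma> M a n"
proof -
  have "foldr (\<lambda>j. a (s j)) [i..<n] x \<in> space M" for i
    using gtuplesD[OF s] x by (intro foldr_act_closed) auto
  then show ?thesis
    using gtuplesD[OF s] x
    by (auto simp: strings_def strings_param_def space_arrows gsrc_def gtgt_def
        simp del: upt_Suc intro!: foldr_upt_step)
qed

text \<open>The inverse keeps the group entries and the recorded base point, so the empty string is
  covered as well. Composability recovers the sources from the last arrow backwards.\<close>

lemma strings_parametrised:
  "parametrised M (gtuples \<Gamma> n)
    (restrict_space ((\<Pi>\<^sub>M i\<in>{..<n}. arrows \<Gamma> M) \<Otimes>\<^sub>M M) (strings \<Gamma> M a n)) (strings_param a n)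
    (\<lambda>(p, x). (\<lambda>i\<in>{..<n}. fst (p i), x))"
proof unfold_locales
  let ?R = "restrict_space ((\<Pi>\<^sub>M i\<in>{..<n}. arrows \<Gamma> M) \<Otimes>\<^sub>M M) (strings \<Gamma> M a n)"
  have "(\<lambda>x. sp n s x) \<in> M \<rightarrow>\<^sub>M (\<Pi>\<^sub>M i\<in>{..<n}. arrows \<Gamma> M) \<Otimes>\<^sub>M M" if "s \<in> gtuples \<Gamma> n" for s
    using gtuplesD[OF that] unfolding strings_param_def prod.case
    by (intro measurable_Pair measurable_restrict arrowI foldr_act_measurable measurable_ident) auto
  then show "strings_param a n \<in> count_space (gtuples \<Gamma> n) \<Otimes>\<^sub>M M \<rightarrow>\<^sub>M ?R"
    by (intro measurable_restrict_space2 measurable_pair_measure_countable1 countable_gtuples)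
      (auto simp: space_pair_measure sp_in_strings)
  have "(\<lambda>q. (\<lambda>i\<in>{..<n}. fst (fst q i), snd q)) \<in>
      (\<Pi>\<^sub>M i\<in>{..<n}. arrows \<Gamma> M) \<Otimes>\<^sub>M M \<rightarrow>\<^sub>M count_space (gtuples \<Gamma> n) \<Otimes>\<^sub>M M"
    by (intro measurable_Pair measurable_compose[OF measurable_fst tuple_entries_measurable] measurable_snd)
  then show "(\<lambda>(p, x). (\<lambda>i\<in>{..<n}. fst (p i), x)) \<in> ?R \<rightarrow>\<^sub>M count_space (gtuples \<Gamma> n) \<Otimes>\<^sub>M M"
    by (intro measurable_restrict_space1) (simp add: case_prod_beta')
  fix s x assume "s \<in> gtuples \<Gamma> n" "x \<in> space M"
  then show "(case sp n s x of (p, x) \<Rightarrow> (\<lambda>i\<in>{..<n}. fst (p i), x)) = (s, x)"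
    by (simp add: strings_param_def gtuples_restrict cong: restrict_cong)
next
  fix q assume "q \<in> space (restrict_space ((\<Pi>\<^sub>M i\<in>{..<n}. arrows \<Gamma> M) \<Otimes>\<^sub>M M) (strings \<Gamma> M a n))"
  then obtain p x where q: "q = (p, x)" and p: "p \<in> (\<Pi>\<^sub>E i\<in>{..<n}. carrier \<Gamma> \<times> space M)"
    and comp: "\<And>i. Suc i < n \<Longrightarrow> a (fst (p (Suc i))) (snd (p (Suc i))) = snd (p i)"
    and last: "0 < n \<Longrightarrow> snd (p (n - 1)) = x"
    by (auto simp: space_restrict_space strings_def gsrc_def gtgt_def space_arrows)
  define s where "s = (\<lambda>i\<in>{..<n}. fst (p i))"
  have s: "s i = fst (p i)" if "i < n" for i
    using that by (simp add: s_def)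
  \<comment> \<open>Downward induction from \<open>n - 1\<close>: the last arrow starts at
    \<open>x\<close>, and each earlier source is the target of the next arrow.\<close>
  have src: "foldr (\<lambda>j. a (s j)) [Suc i..<n] x = snd (p i)" if "i < n" for i
  proof -
    have "i \<le> n - 1"
      using that by simp
    then show ?thesis
    proof (induction rule: inc_induct)
      case base
      then show ?case
        using last that by simp
    next
      case (step m)
      then have "Suc m < n"
        by simp
      then show ?case
        using step.IH by (simp add: foldr_upt_step comp s del: upt_Suc)
    qed
  qed
  have "fst (sp n s x) = p"
  proof
    fix i
    show "fst (sp n s x) i = p i"
    proof (cases "i < n")
      case True
      then show ?thesis
        by (simp add: strings_param_def src s del: upt_Suc)
    next
      case False
      then show ?thesis
        using PiE_arb[OF p, of i] by (simp add: strings_param_def)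
    qed
  qed
  then show "strings_param a n (case q of (p, x) \<Rightarrow> (\<lambda>i\<in>{..<n}. fst (p i), x)) = q"
    by (simp add: q strings_param_def flip: s_def)
qed (rule countable_gtuples)

lemma stringsM_eq:
  "stringsM \<Gamma> M a n = distr (count_space (gtuples \<Gamma> n) \<Otimes>\<^sub>M M)
     (restrict_space ((\<Pi>\<^sub>M i\<in>{..<n}. arrows \<Gamma> M) \<Otimes>\<^sub>M M) (strings \<Gamma> M a n)) (strings_param a n)"
  by (simp add: stringsM_def)

lemmas stringsM_measurable_iff = parametrised.measurable_param_iff[OF strings_parametrised, folded stringsM_eq]
lemmas stringsM_AE_iff = parametrised.AE_param_iff[OF strings_parametrised, folded stringsM_eq]
lemmas stringsM_function = parametrised.param_function[OF strings_parametrised, folded stringsM_eq]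

subsection \<open>From tuples with common target to composable strings\<close>

text \<open>Pullback along this map is the cochain map behind \<open>westman_to_hom\<close>.\<close>

definition string_of :: "nat \<Rightarrow> (nat \<Rightarrow> 'g \<times> 'x) \<Rightarrow> (nat \<Rightarrow> 'g \<times> 'x) \<times> 'x" where
  "string_of n p = (\<lambda>i\<in>{..<n}. gmul \<Gamma> (ginv \<Gamma> a (p i)) (p (Suc i)), gsrc (p n))"

text \<open>The group entries of \<open>string_of\<close>, that is the passage from homogeneous to
  inhomogeneous coordinates on \<Gamma>.\<close>

definition quotients :: "nat \<Rightarrow> (nat \<Rightarrow> 'g) \<Rightarrow> nat \<Rightarrow> 'g" where
  "quotients n t = (\<lambda>i\<in>{..<n}. inv (t i) \<otimes> t (Suc i))"

text \<open>The tuple with last entry \<open>1\<close> and successive quotients \<open>s\<close>.\<close>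
definition tuple_of :: "nat \<Rightarrow> (nat \<Rightarrow> 'g) \<Rightarrow> nat \<Rightarrow> 'g" where
  "tuple_of n s = (\<lambda>i\<in>{..<Suc n}. inv (foldr (\<lambda>j g. s j \<otimes> g) [i..<n] \<one>))"

lemma foldr_mult_closed:
  "(\<And>j. j \<in> set js \<Longrightarrow> s j \<in> carrier \<Gamma>) \<Longrightarrow> foldr (\<lambda>j g. s j \<otimes> g) js \<one> \<in> carrier \<Gamma>"
  by (induction js) auto

lemma quotients_closed: "t \<in> gtuples \<Gamma> (Suc n) \<Longrightarrow> quotients n t \<in> gtuples \<Gamma> n"
  using gtuplesD[of t "Suc n"] by (auto simp: quotients_def intro!: gtuplesI)

lemma tuple_of_closed: "s \<in> gtuples \<Gamma> n \<Longrightarrow> tuple_of n s \<in> gtuples \<Gamma> (Suc n)"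
  unfolding tuple_of_def by (intro gtuplesI inv_closed foldr_mult_closed) (auto dest: gtuplesD)

lemma tuple_of_last: "tuple_of n s n = \<one>"
  by (simp add: tuple_of_def)

text \<open>The suffix products at \<open>i\<close> and \<open>i + 1\<close> differ by the factor
  \<open>s i\<close>.\<close>

lemma quotients_tuple_of:
  assumes "s \<in> gtuples \<Gamma> n"
  shows "quotients n (tuple_of n s) = s"
proof (rule gtuples_eqI[OF quotients_closed[OF tuple_of_closed[OF assms]] assms])
  fix i assume i: "i < n"
  have "foldr (\<lambda>j g. s j \<otimes> g) [k..<n] \<one> \<in> carrier \<Gamma>" for k
    using gtuplesD[OF assms] by (intro foldr_mult_closed) auto
  then show "quotients n (tuple_of n s) i = s i"
    using i gtuplesD[OF assms i] by (simp add: quotients_def tuple_of_def foldr_upt_step[OF i] m_assoc)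
qed

text \<open>The product of the quotients from index \<open>i\<close> on telescopes to
  \<open>(t i)\<^sup>-\<^sup>1\<close> times \<open>t n\<close>. So \<open>t\<close> and its
  normalised tuple lie in one orbit, and the translation between them is by the last entry of
  \<open>t\<close>.\<close>

lemma tuple_of_quotients:
  assumes t: "t \<in> gtuples \<Gamma> (Suc n)"
  shows "tuple_of n (quotients n t) = gshift (Suc n) (t n) t"
proof (rule gtuples_eqI[OF tuple_of_closed[OF quotients_closed[OF t]] gshift_closed[OF gtuplesD[OF t] t]])
  note tD = gtuplesD[OF t]
  fix i assume i: "i < Suc n"
  then have "i \<le> n"
    by simp
  then have "foldr (\<lambda>j g. quotients n t j \<otimes> g) [i..<n] \<one> = inv (t i) \<otimes> t n"
  proof (induction rule: inc_induct)
    case base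
    then show ?case
      using tD[of n] by simp
  next
    case (step m)
    have "t m \<in> carrier \<Gamma>" "t (Suc m) \<in> carrier \<Gamma>" "t n \<in> carrier \<Gamma>"
      using step by (auto intro!: tD)
    moreover from this have "t (Suc m) \<otimes> (inv t (Suc m) \<otimes> t n) = t n"
      by (simp flip: m_assoc)
    ultimately show ?case
      using step by (simp add: foldr_upt_step quotients_def m_assoc)
  qed
  then show "tuple_of n (quotients n t) i = gshift (Suc n) (t n) t i"
    using i tD[of i] tD[of n] by (simp add: tuple_of_def gshift_def inv_mult_group)
qed simp

lemma quotients_gshift:
  assumes "\<gamma> \<in> carrier \<Gamma>" "t \<in> gtuples \<Gamma> (Suc n)"
  shows "quotients n (gshift (Suc n) \<gamma> t) = quotients n t"
proof (rule gtuples_eqI[OF quotients_closed[OF gshift_closed[OF assms]] quotients_closed[OF assms(2)]])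
  fix i assume "i < n"
  moreover from this have "t i \<in> carrier \<Gamma>" "t (Suc i) \<in> carrier \<Gamma>"
    using gtuplesD[OF assms(2)] by auto
  moreover from this have "\<gamma> \<otimes> (inv \<gamma> \<otimes> t (Suc i)) = t (Suc i)"
    using assms by (simp flip: m_assoc)
  ultimately show "quotients n (gshift (Suc n) \<gamma> t) i = quotients n t i"
    using assms by (simp add: quotients_def gshift_def inv_mult_group m_assoc)
qed

text \<open>The base point of the string is the source \<open>(t n)\<^sup>-\<^sup>1 x\<close> of the
  last arrow of the tuple. Products of quotients telescope, so the source at index \<open>i\<close>
  of the string is that of entry \<open>i + 1\<close> of the tuple.\<close>

lemma string_of_fp:
  assumes t: "t \<in> gtuples \<Gamma> (Suc n)" and x: "x \<in> space M"
  shows "string_of n (fp (Suc n) t x) = sp n (quotients n t) (a (inv (t n)) x)"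
proof -
  note tD = gtuplesD[OF t]
  have "foldr (\<lambda>j. a (quotients n t j)) [i..<n] (a (inv (t n)) x) = a (inv (t i)) x" if "i \<le> n" for i
    using that
  proof (induction rule: inc_induct)
    case base
    then show ?case
      by simp
  next
    case (step m)
    have "t m \<in> carrier \<Gamma>" "t (Suc m) \<in> carrier \<Gamma>"
      using step by (auto intro!: tD)
    then show ?case
      using step x by (simp add: foldr_upt_step quotients_def act_mult m_assoc)
  qed
  then show ?thesis
    by (auto simp: string_of_def fibred_param_def strings_param_def gmul_def ginv_def gsrc_def quotients_def fun_eq_iff
        simp del: upt_Suc)
qed

text \<open>Omitting entry 0 drops the first quotient. Omitting an inner entry multiplies two
  neighbouring quotients, where the middle element cancels. Omitting the last entry moves the base
  point to \<open>(t n)\<^sup>-\<^sup>1 x\<close>, the target of the dropped arrow of the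
  string.\<close>

lemma string_face_string_of:
  assumes t: "t \<in> gtuples \<Gamma> (Suc (Suc n))" and x: "x \<in> space M" and i: "i \<le> Suc n"
  shows "string_face \<Gamma> a n i (string_of (Suc n) (fp (Suc (Suc n)) t x)) =
    string_of n (omit (Suc n) i (fp (Suc (Suc n)) t x))"
proof -
  note tD = gtuplesD[OF t]
  have cancel: "inv (t j) \<otimes> t (Suc j) \<otimes> (inv (t (Suc j)) \<otimes> t (Suc (Suc j))) = inv (t j) \<otimes> t (Suc (Suc j))"
    if "j < n" for j
  proof -
    have c: "t j \<in> carrier \<Gamma>" "t (Suc j) \<in> carrier \<Gamma>" "t (Suc (Suc j)) \<in> carrier \<Gamma>"
      using that by (auto intro!: tD)
    then have "t (Suc j) \<otimes> (inv (t (Suc j)) \<otimes> t (Suc (Suc j))) = t (Suc (Suc j))"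
      by (simp flip: m_assoc)
    then show ?thesis
      using c by (simp add: m_assoc)
  qed
  have last: "a (inv (t n) \<otimes> t (Suc n)) (a (inv (t (Suc n))) x) = a (inv (t n)) x"
  proof -
    have "t n \<in> carrier \<Gamma>" "t (Suc n) \<in> carrier \<Gamma>"
      by (auto intro!: tD)
    then show ?thesis
      using x by (simp add: act_mult m_assoc)
  qed
  consider "i = 0" | "0 < i" "i \<le> n" | "i = Suc n"
    using i by linarith
  then show ?thesis
  proof cases
    case 1
    then show ?thesis
      by (auto simp: string_face_def string_of_def omit_def fibred_param_def fun_eq_iff)
  next
    case 2
    then show ?thesis
      by (auto simp: string_face_def string_of_def omit_def fibred_param_def fun_eq_iff gmul_def ginv_def cancel)
  next
    case 3
    then show ?thesis
      by (auto simp: string_face_def string_of_def omit_def fibred_param_def fun_eq_iff gmul_def ginv_def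
          gtgt_def gsrc_def last)
  qed
qed

text \<open>Every string is \<open>string_of\<close> a tuple with last entry 1, so the coordinates
  of its faces come from the tuple version without a new case distinction.
  \<open>ae_linear_westman_delta\<close> tests measurability and null sets on them.\<close>

lemma string_face_sp:
  assumes s: "s \<in> gtuples \<Gamma> (Suc n)" and x: "x \<in> space M" and i: "i \<le> Suc n"
  defines "u \<equiv> omit (Suc n) i (tuple_of (Suc n) s)"
  shows "string_face \<Gamma> a n i (sp (Suc n) s x) = sp n (quotients n u) (a (inv (u n)) x)"
proof -
  have l: "tuple_of (Suc n) s \<in> gtuples \<Gamma> (Suc (Suc n))"
    by (rule tuple_of_closed[OF s])
  have u: "u \<in> gtuples \<Gamma> (Suc n)"
    unfolding u_def by (rule omit_closed[OF l])
  have "sp (Suc n) s x = string_of (Suc n) (fp (Suc (Suc n)) (tuple_of (Suc n) s) x)"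
    using string_of_fp[OF l x] x by (simp add: quotients_tuple_of[OF s] tuple_of_last)
  then show ?thesis
    using string_face_string_of[OF l x i] i string_of_fp[OF u x] by (simp add: omit_fp u_def)
qed

end


section \<open>Group cochains\<close>

text \<open>The simplicial identity between two faces.\<close>

lemma omit_omit:
  "i \<le> j \<Longrightarrow> omit n j (omit (Suc n) i t) = omit n i (omit (Suc n) (Suc j) t)"
  by (auto simp: omit_def fun_eq_iff)

text \<open>The pairs with \<open>i \<le> j\<close> and those with \<open>j < i\<close> correspond
  under \<open>(i, j) \<mapsto> (j + 1, i)\<close>. This preserves \<open>G\<close> and changes the
  parity of \<open>i + j\<close>, so the two halves cancel.\<close>

lemma alternating_double_sum:
  fixes G :: "nat \<Rightarrow> nat \<Rightarrow> 'e::real_vector"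
  assumes G: "\<And>i j. i \<le> j \<Longrightarrow> j \<le> n \<Longrightarrow> G i j = G (Suc j) i"
  shows "(\<Sum>i\<le>Suc n. (- 1) ^ i *\<^sub>R (\<Sum>j\<le>n. (- 1) ^ j *\<^sub>R G i j)) = 0"
proof -
  let ?g = "\<lambda>(i, j). (- 1) ^ (i + j) *\<^sub>R G i j"
  let ?A = "{(i, j). i \<le> j \<and> j \<le> n}" and ?B = "{(i, j). j < i \<and> i \<le> Suc n}"
  have fin: "finite ?A" "finite ?B"
    by (rule finite_subset[of _ "{..Suc n} \<times> {..Suc n}"]; force)+
  have un: "{..Suc n} \<times> {..n} = ?A \<union> ?B"
    by auto
  have "(\<Sum>i\<le>Suc n. (- 1) ^ i *\<^sub>R (\<Sum>j\<le>n. (- 1) ^ j *\<^sub>R G i j)) = sum ?g ({..Suc n} \<times> {..n})"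
    by (simp add: scaleR_sum_right sum.cartesian_product power_add del: sum.atMost_Suc)
  also have "\<dots> = sum ?g ?A + sum ?g ?B"
    unfolding un using fin by (intro sum.union_disjoint) auto
  also have "sum ?g ?B = sum (\<lambda>z. - ?g z) ?A"
    by (rule sum.reindex_bij_witness[of _ "\<lambda>(i, j). (Suc j, i)" "\<lambda>(i, j). (j, i - 1)"])
      (auto simp: G add.commute split: prod.splits dest!: less_imp_Suc_add)
  finally show ?thesis
    by (simp add: sum_negf)
qed

context countable_action
begin

abbreviation "\<tau> \<equiv> translate \<Gamma> M a"

section \<open>Group cochains as a vector space\<close>

lemma mem_grp_cochains_iff:
  "f \<in> carrier (grp_cochains \<Gamma> V \<pi> n) \<longleftrightarrow> f \<in> gtuples \<Gamma> (Suc n) \<rightarrow>\<^sub>E carrier V \<and>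
    (\<forall>\<gamma>\<in>carrier \<Gamma>. \<forall>t\<in>gtuples \<Gamma> (Suc n). \<pi> \<gamma> (f (gshift (Suc n) \<gamma> t)) = f t)"
  by (simp add: grp_cochains_def gshift_def)

lemma grp_cochains_ops:
  "\<zero>\<^bsub>grp_cochains \<Gamma> V \<pi> n\<^esub> = (\<lambda>t\<in>gtuples \<Gamma> (Suc n). \<zero>\<^bsub>V\<^esub>)"
  "f \<oplus>\<^bsub>grp_cochains \<Gamma> V \<pi> n\<^esub> g = (\<lambda>t\<in>gtuples \<Gamma> (Suc n). f t \<oplus>\<^bsub>V\<^esub> g t)"
  "r \<odot>\<^bsub>grp_cochains \<Gamma> V \<pi> n\<^esub> f = (\<lambda>t\<in>gtuples \<Gamma> (Suc n). r \<odot>\<^bsub>V\<^esub> f t)"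
  by (simp_all add: grp_cochains_def)

text \<open>Stated for a general module so that it serves both \<open>L0\<close> and
  \<open>Linf\<close>. The laws hold value by value; linearity of the action gives closure.\<close>

lemma real_module_grp_cochains:
  assumes V: "real_module V" and \<pi>: "\<And>\<gamma>. \<gamma> \<in> carrier \<Gamma> \<Longrightarrow> linear_hom V V (\<pi> \<gamma>)"
  shows "real_module (grp_cochains \<Gamma> V \<pi> n)"
proof -
  interpret V: Module.module real_field V
    by (rule V)
  note \<pi>' = linear_homD[OF \<pi>]
  have sc: "r \<odot>\<^bsub>V\<^esub> x \<in> carrier V" if "x \<in> carrier V" for r x
    using V.smult_closed[of r x] that by simp
  have s0: "0 \<odot>\<^bsub>V\<^esub> x = \<zero>\<^bsub>V\<^esub>" if "x \<in> carrier V" for x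
    using V.smult_l_null[of x] that by simp
  have s1: "1 \<odot>\<^bsub>V\<^esub> x = x" if "x \<in> carrier V" for x
    using V.smult_one[of x] that by simp
  have sa: "(r * s) \<odot>\<^bsub>V\<^esub> x = r \<odot>\<^bsub>V\<^esub> (s \<odot>\<^bsub>V\<^esub> x)" if "x \<in> carrier V" for r s x
    using V.smult_assoc1[of r s x] that by simp
  have sl: "(r + s) \<odot>\<^bsub>V\<^esub> x = r \<odot>\<^bsub>V\<^esub> x \<oplus>\<^bsub>V\<^esub> s \<odot>\<^bsub>V\<^esub> x" if "x \<in> carrier V" for r s x
    using V.smult_l_distr[of r s x] that by simp
  have sr: "r \<odot>\<^bsub>V\<^esub> (x \<oplus>\<^bsub>V\<^esub> y) = r \<odot>\<^bsub>V\<^esub> x \<oplus>\<^bsub>V\<^esub> r \<odot>\<^bsub>V\<^esub> y" if "x \<in> carrier V" "y \<in> carrier V" for r x y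
    using V.smult_r_distr[of r x y] that by simp
  note mem = mem_grp_cochains_iff grp_cochains_ops
  have val: "f t \<in> carrier V" if "f \<in> carrier (grp_cochains \<Gamma> V \<pi> n)" "t \<in> gtuples \<Gamma> (Suc n)" for f t
    using that by (auto simp: mem)
  have inv: "\<pi> \<gamma> (f (gshift (Suc n) \<gamma> t)) = f t"
    if "f \<in> carrier (grp_cochains \<Gamma> V \<pi> n)" "\<gamma> \<in> carrier \<Gamma>" "t \<in> gtuples \<Gamma> (Suc n)" for f \<gamma> t
    using that by (auto simp: mem)
  have ext: "f = g" if "f \<in> extensional (gtuples \<Gamma> (Suc n))" "g \<in> extensional (gtuples \<Gamma> (Suc n))"
    "\<And>t. t \<in> gtuples \<Gamma> (Suc n) \<Longrightarrow> f t = g t" for f g :: "(nat \<Rightarrow> 'g) \<Rightarrow> 'b"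
    using that by (rule extensionalityI)
  have cext: "f \<in> extensional (gtuples \<Gamma> (Suc n))" if "f \<in> carrier (grp_cochains \<Gamma> V \<pi> n)" for f
    using that by (auto simp: mem PiE_def)
  show ?thesis
  proof (rule real_moduleI)
    show "\<zero>\<^bsub>grp_cochains \<Gamma> V \<pi> n\<^esub> \<in> carrier (grp_cochains \<Gamma> V \<pi> n)"
      using \<pi>'(6) gshift_closed by (auto simp: mem)
    fix f assume f: "f \<in> carrier (grp_cochains \<Gamma> V \<pi> n)"
    show "r \<odot>\<^bsub>grp_cochains \<Gamma> V \<pi> n\<^esub> f \<in> carrier (grp_cochains \<Gamma> V \<pi> n)" for r
      using sc \<pi>'(5) val[OF f] gshift_closed by (auto simp: mem inv[OF f])
    show "\<zero>\<^bsub>grp_cochains \<Gamma> V \<pi> n\<^esub> \<oplus>\<^bsub>grp_cochains \<Gamma> V \<pi> n\<^esub> f = f"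
      using val[OF f] by (intro ext) (auto simp: mem cext[OF f])
    show "0 \<odot>\<^bsub>grp_cochains \<Gamma> V \<pi> n\<^esub> f = \<zero>\<^bsub>grp_cochains \<Gamma> V \<pi> n\<^esub>"
      using val[OF f] by (intro ext) (auto simp: mem s0)
    show "1 \<odot>\<^bsub>grp_cochains \<Gamma> V \<pi> n\<^esub> f = f"
      using val[OF f] by (intro ext) (auto simp: mem s1 cext[OF f])
    show "(r + s) \<odot>\<^bsub>grp_cochains \<Gamma> V \<pi> n\<^esub> f =
        r \<odot>\<^bsub>grp_cochains \<Gamma> V \<pi> n\<^esub> f \<oplus>\<^bsub>grp_cochains \<Gamma> V \<pi> n\<^esub> s \<odot>\<^bsub>grp_cochains \<Gamma> V \<pi> n\<^esub> f" for r s
      using val[OF f] by (intro ext) (auto simp: mem sl)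
    show "(r * s) \<odot>\<^bsub>grp_cochains \<Gamma> V \<pi> n\<^esub> f =
        r \<odot>\<^bsub>grp_cochains \<Gamma> V \<pi> n\<^esub> (s \<odot>\<^bsub>grp_cochains \<Gamma> V \<pi> n\<^esub> f)" for r s
      using val[OF f] by (intro ext) (auto simp: mem sa)
    fix g assume g: "g \<in> carrier (grp_cochains \<Gamma> V \<pi> n)"
    show "f \<oplus>\<^bsub>grp_cochains \<Gamma> V \<pi> n\<^esub> g \<in> carrier (grp_cochains \<Gamma> V \<pi> n)"
      using \<pi>'(4) val[OF f] val[OF g] gshift_closed by (auto simp: mem inv[OF f] inv[OF g])
    show "f \<oplus>\<^bsub>grp_cochains \<Gamma> V \<pi> n\<^esub> g = g \<oplus>\<^bsub>grp_cochains \<Gamma> V \<pi> n\<^esub> f"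
      using val[OF f] val[OF g] by (intro ext) (auto simp: mem V.a_comm)
    show "r \<odot>\<^bsub>grp_cochains \<Gamma> V \<pi> n\<^esub> (f \<oplus>\<^bsub>grp_cochains \<Gamma> V \<pi> n\<^esub> g) =
        r \<odot>\<^bsub>grp_cochains \<Gamma> V \<pi> n\<^esub> f \<oplus>\<^bsub>grp_cochains \<Gamma> V \<pi> n\<^esub> r \<odot>\<^bsub>grp_cochains \<Gamma> V \<pi> n\<^esub> g" for r
      using val[OF f] val[OF g] by (intro ext) (auto simp: mem sr)
    fix h assume h: "h \<in> carrier (grp_cochains \<Gamma> V \<pi> n)"
    show "f \<oplus>\<^bsub>grp_cochains \<Gamma> V \<pi> n\<^esub> g \<oplus>\<^bsub>grp_cochains \<Gamma> V \<pi> n\<^esub> h =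
        f \<oplus>\<^bsub>grp_cochains \<Gamma> V \<pi> n\<^esub> (g \<oplus>\<^bsub>grp_cochains \<Gamma> V \<pi> n\<^esub> h)"
      using val[OF f] val[OF g] val[OF h] by (intro ext) (auto simp: mem V.a_assoc)
  qed
qed

section \<open>Translation of classes on X\<close>

lemma ae_linear_translate:
  assumes "\<gamma> \<in> carrier \<Gamma>"
  shows "ae_linear M M (\<lambda>(f :: 'x \<Rightarrow> 'e::{banach, second_countable_topology}) x. f (a \<gamma> x))"
  by (intro ae_linear_pullback1 AE_act[OF _ assms] measurable_compose[OF act_meas[OF assms]])

lemma translate_ae_class:
  assumes "\<gamma> \<in> carrier \<Gamma>" "f \<in> borel_measurable M"
  shows "\<tau> \<gamma> (ae_class M f) = ae_class M (\<lambda>x. f (a (inv \<gamma>) x))"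
  unfolding translate_def using assms by (intro L0_map_ae_class ae_linear_translate) auto

lemma linear_hom_translate_L0:
  "\<gamma> \<in> carrier \<Gamma> \<Longrightarrow> linear_hom (L0 M) (L0 M) (\<tau> \<gamma>)"
  unfolding translate_def by (intro linear_hom_L0_map ae_linear_translate) auto

text \<open>An a.e. bound survives translation because null sets do; the algebraic laws are
  inherited from \<open>L0\<close>.\<close>

lemma linear_hom_translate_Linf:
  assumes \<gamma>: "\<gamma> \<in> carrier \<Gamma>"
  shows "linear_hom (Linf M) (Linf M) (\<tau> \<gamma> :: ('x \<Rightarrow> 'e::{banach, second_countable_topology}) set \<Rightarrow> _)"
proof (intro linear_homI real_module_Linf)
  note \<tau> = linear_homD[OF linear_hom_translate_L0[OF \<gamma>]]
  fix C :: "('x \<Rightarrow> 'e) set" assume C: "C \<in> carrier (Linf M)"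
  then show "\<tau> \<gamma> (r \<odot>\<^bsub>Linf M\<^esub> C) = r \<odot>\<^bsub>Linf M\<^esub> \<tau> \<gamma> C" for r
    using \<tau>(5) Linf_subset_L0 by fastforce
  from C obtain f B where f: "f \<in> borel_measurable M" "C = ae_class M f" "AE x in M. norm (f x) \<le> B"
    by (rule Linf_cases)
  have "(\<lambda>x. f (a (inv \<gamma>) x)) \<in> borel_measurable M"
    using f(1) \<gamma> measurable_compose[OF act_meas[of "inv \<gamma>"]] by simp
  then show "\<tau> \<gamma> C \<in> carrier (Linf M)"
    using AE_act[OF f(3), of "inv \<gamma>"] f \<gamma> by (auto simp: translate_ae_class ae_class_in_Linf_iff)
  fix D :: "('x \<Rightarrow> 'e) set" assume "D \<in> carrier (Linf M)"
  then show "\<tau> \<gamma> (C \<oplus>\<^bsub>Linf M\<^esub> D) = \<tau> \<gamma> C \<oplus>\<^bsub>Linf M\<^esub> \<tau> \<gamma> D"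
    using C \<tau>(4) Linf_subset_L0 by fastforce
qed

section \<open>Representatives of cochains with values in classes\<close>

definition meas_family :: "nat \<Rightarrow> ((nat \<Rightarrow> 'g) \<Rightarrow> 'x \<Rightarrow> 'e::{banach, second_countable_topology}) \<Rightarrow> bool" where
  "meas_family n F \<longleftrightarrow> (\<forall>t\<in>gtuples \<Gamma> n. F t \<in> borel_measurable M)"

lemma meas_familyD: "meas_family n F \<Longrightarrow> t \<in> gtuples \<Gamma> n \<Longrightarrow> F t \<in> borel_measurable M"
  by (simp add: meas_family_def)

text \<open>Calculations with cochains are done on representatives, one function for each tuple,
  chosen independently of each other; identities have to hold almost everywhere for each tuple
  separately.\<close>

definition family_class :: "nat \<Rightarrow> ((nat \<Rightarrow> 'g) \<Rightarrow> 'x \<Rightarrow> 'e::{banach, second_countable_topology}) \<Rightarrow> (nat \<Rightarrow> 'g) \<Rightarrow> ('x \<Rightarrow> 'e) set" where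
  "family_class n F = (\<lambda>t\<in>gtuples \<Gamma> n. ae_class M (F t))"

lemma family_class_cases:
  assumes "f \<in> gtuples \<Gamma> n \<rightarrow>\<^sub>E carrier (L0 M)"
  obtains F where "meas_family n F" "f = family_class n F"
proof -
  have "\<forall>t\<in>gtuples \<Gamma> n. \<exists>F. F \<in> borel_measurable M \<and> f t = ae_class M F"
    using assms by (auto simp: carrier_L0 PiE_iff)
  then obtain F where F: "\<forall>t\<in>gtuples \<Gamma> n. F t \<in> borel_measurable M \<and> f t = ae_class M (F t)"
    by (rule bchoice[THEN exE])
  then have "f = family_class n F"
    using assms by (auto simp: family_class_def fun_eq_iff PiE_iff extensional_def)
  then show ?thesis
    using F that by (auto simp: meas_family_def)
qed

lemma family_class_eq_iff:
  assumes "meas_family n F" "meas_family n G"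
  shows "family_class n F = family_class n G \<longleftrightarrow> (\<forall>t\<in>gtuples \<Gamma> n. AE x in M. F t x = G t x)"
  using meas_familyD[OF assms(1)] meas_familyD[OF assms(2)] by (auto simp: family_class_def fun_eq_iff restrict_def ae_class_eq_iff)

text \<open>Rewriting in coordinates is valid on \<open>space M\<close> only, so measurability of
  the rewritten family is part of the conclusion.\<close>

lemma family_class_cong:
  assumes F: "meas_family n F" and eq: "\<And>t x. t \<in> gtuples \<Gamma> n \<Longrightarrow> x \<in> space M \<Longrightarrow> F t x = G t x"
  shows "meas_family n G" "family_class n F = family_class n G"
proof -
  show G: "meas_family n G"
    unfolding meas_family_def
  proof
    fix t assume t: "t \<in> gtuples \<Gamma> n"
    show "G t \<in> borel_measurable M"
      using meas_familyD[OF F t] measurable_cong[of M "F t" "G t" borel] eq[OF t] by auto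
  qed
  show "family_class n F = family_class n G"
    using eq by (auto simp: family_class_eq_iff[OF F G])
qed

lemma family_class_mem_PiE: "meas_family n F \<Longrightarrow> family_class n F \<in> gtuples \<Gamma> n \<rightarrow>\<^sub>E carrier (L0 M)"
  by (auto simp: family_class_def meas_family_def)

text \<open>The translate of a class is the class of the translated function, so equivariance
  becomes an a.e. identity for each \<gamma> and \<open>t\<close>. The right-hand side has the shape
  of \<open>invariant_iff\<close>, with \<open>F\<close> for the function read in
  coordinates.\<close>

lemma family_class_mem_iff:
  assumes F: "meas_family (Suc n) F"
  shows "family_class (Suc n) F \<in> carrier (grp_cochains \<Gamma> (L0 M) \<tau> n) \<longleftrightarrow>
    (\<forall>\<gamma>\<in>carrier \<Gamma>. \<forall>t\<in>gtuples \<Gamma> (Suc n). AE x in M. F (gshift (Suc n) \<gamma> t) (a (inv \<gamma>) x) = F t x)"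
proof -
  have "\<tau> \<gamma> (family_class (Suc n) F (gshift (Suc n) \<gamma> t)) = family_class (Suc n) F t \<longleftrightarrow>
      (AE x in M. F (gshift (Suc n) \<gamma> t) (a (inv \<gamma>) x) = F t x)"
    if \<gamma>: "\<gamma> \<in> carrier \<Gamma>" and t: "t \<in> gtuples \<Gamma> (Suc n)" for \<gamma> t
  proof -
    have m: "F (gshift (Suc n) \<gamma> t) \<in> borel_measurable M"
      by (intro meas_familyD[OF F] gshift_closed \<gamma> t)
    then have "(\<lambda>x. F (gshift (Suc n) \<gamma> t) (a (inv \<gamma>) x)) \<in> borel_measurable M"
      using \<gamma> measurable_compose[OF act_meas[of "inv \<gamma>"]] by simp
    then show ?thesis
      using \<gamma> t m meas_familyD[OF F t] by (simp add: family_class_def gshift_closed translate_ae_class ae_class_eq_iff)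
  qed
  then show ?thesis
    using family_class_mem_PiE[OF F] by (simp add: mem_grp_cochains_iff)
qed

lemma family_class_add:
  assumes "meas_family (Suc n) F" "meas_family (Suc n) G"
  shows "family_class (Suc n) F \<oplus>\<^bsub>grp_cochains \<Gamma> (L0 M) \<pi> n\<^esub> family_class (Suc n) G = family_class (Suc n) (\<lambda>t x. F t x + G t x)"
  using meas_familyD[OF assms(1)] meas_familyD[OF assms(2)]
  by (auto simp: grp_cochains_ops family_class_def fun_eq_iff restrict_def L0_ops)

lemma family_class_smult:
  assumes "meas_family (Suc n) F"
  shows "r \<odot>\<^bsub>grp_cochains \<Gamma> (L0 M) \<pi> n\<^esub> family_class (Suc n) F = family_class (Suc n) (\<lambda>t x. r *\<^sub>R F t x)"
  using meas_familyD[OF assms] by (auto simp: grp_cochains_ops family_class_def fun_eq_iff restrict_def L0_ops)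

definition family_delta :: "nat \<Rightarrow> ((nat \<Rightarrow> 'g) \<Rightarrow> 'x \<Rightarrow> 'e::real_vector) \<Rightarrow> (nat \<Rightarrow> 'g) \<Rightarrow> 'x \<Rightarrow> 'e" where
  "family_delta n F t x = (\<Sum>i\<le>Suc n. (- 1) ^ i *\<^sub>R F (omit (Suc n) i t) x)"

text \<open>Successive faces obey \<open>omit_omit\<close>, so the double sum cancels at every point
  and not merely almost everywhere.\<close>

lemma family_delta_family_delta: "family_delta (Suc n) (family_delta n F) t x = 0"
  unfolding family_delta_def
  by (rule alternating_double_sum[of "Suc n" "\<lambda>i j. F (omit (Suc n) j (omit (Suc (Suc n)) i t)) x"])
    (simp add: omit_omit)

lemma meas_family_family_delta:
  fixes F :: "(nat \<Rightarrow> 'g) \<Rightarrow> 'x \<Rightarrow> 'e::{banach, second_countable_topology}"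
  assumes "meas_family (Suc n) F"
  shows "meas_family (Suc (Suc n)) (family_delta n F)"
  unfolding meas_family_def
proof
  fix t assume t: "t \<in> gtuples \<Gamma> (Suc (Suc n))"
  have [measurable]: "F (omit (Suc n) i t) \<in> borel_measurable M" for i
    by (intro meas_familyD[OF assms] omit_closed t)
  show "family_delta n F t \<in> borel_measurable M"
    unfolding family_delta_def[abs_def] by measurable
qed

lemma meas_family_lincomb:
  assumes "meas_family n F" "meas_family n G"
  shows "meas_family n (\<lambda>t x. F t x + G t x)" "meas_family n (\<lambda>t x. r *\<^sub>R F t x)"
  using meas_familyD[OF assms(1)] meas_familyD[OF assms(2)]
  by (auto simp: meas_family_def intro!: borel_measurable_add borel_measurable_scaleR)

lemma grp_delta_family_class:
  assumes "meas_family (Suc n) F"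
  shows "grp_delta \<Gamma> (L0 M) n (family_class (Suc n) F) = family_class (Suc (Suc n)) (family_delta n F)"
proof
  fix t
  show "grp_delta \<Gamma> (L0 M) n (family_class (Suc n) F) t = family_class (Suc (Suc n)) (family_delta n F) t"
  proof (cases "t \<in> gtuples \<Gamma> (Suc (Suc n))")
    case True
    then have "grp_delta \<Gamma> (L0 M) n (family_class (Suc n) F) t =
        (\<Oplus>\<^bsub>L0 M\<^esub>i\<in>{..Suc n}. (- 1) ^ i \<odot>\<^bsub>L0 M\<^esub> ae_class M (F (omit (Suc n) i t)))"
      by (simp add: grp_delta_def family_class_def omit_closed)
    also have "\<dots> = ae_class M (\<lambda>x. \<Sum>i\<in>{..Suc n}. (- 1) ^ i *\<^sub>R F (omit (Suc n) i t) x)"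
      using True assms by (intro finsum_L0) (auto intro: omit_closed meas_familyD)
    also have "\<dots> = family_class (Suc (Suc n)) (family_delta n F) t"
      using True by (simp add: family_class_def family_delta_def[abs_def] del: sum.atMost_Suc)
    finally show ?thesis .
  qed (simp add: grp_delta_def family_class_def)
qed

lemma real_module_grp_L0: "real_module (grp_cochains \<Gamma> (L0 M) \<tau> n)"
  by (intro real_module_grp_cochains real_module_L0 linear_hom_translate_L0)

lemma grp_L0_cases:
  assumes "f \<in> carrier (grp_cochains \<Gamma> (L0 M) \<tau> n)"
  obtains F where "meas_family (Suc n) F" "f = family_class (Suc n) F"
  using assms family_class_cases[of f "Suc n"] by (auto simp: mem_grp_cochains_iff)

lemma cochain_complex_grp_L0:
  "cochain_complex (grp_cochains \<Gamma> (L0 M :: (real, ('x \<Rightarrow> 'e::{banach, second_countable_topology}) set) module) \<tau>)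
    (grp_delta \<Gamma> (L0 M))"
  unfolding cochain_complex_def
proof (intro conjI allI ballI linear_homI real_module_grp_L0)
  fix n and f :: "(nat \<Rightarrow> 'g) \<Rightarrow> ('x \<Rightarrow> 'e) set"
  assume f: "f \<in> carrier (grp_cochains \<Gamma> (L0 M) \<tau> n)"
  then obtain F where F: "meas_family (Suc n) F" "f = family_class (Suc n) F"
    by (rule grp_L0_cases) blast
  note meas = F(1) meas_family_family_delta[OF F(1)] meas_family_lincomb(2)[OF F(1) F(1)]
  have inv: "AE x in M. F (gshift (Suc n) \<gamma> t) (a (inv \<gamma>) x) = F t x"
    if "\<gamma> \<in> carrier \<Gamma>" "t \<in> gtuples \<Gamma> (Suc n)" for \<gamma> t
    using f that by (simp add: F family_class_mem_iff)
  show "grp_delta \<Gamma> (L0 M) n f \<in> carrier (grp_cochains \<Gamma> (L0 M) \<tau> (Suc n))"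
    unfolding F(2) grp_delta_family_class[OF F(1)] family_class_mem_iff[OF meas(2)]
  proof (intro ballI)
    fix \<gamma> t assume \<gamma>: "\<gamma> \<in> carrier \<Gamma>" and t: "t \<in> gtuples \<Gamma> (Suc (Suc n))"
    \<comment> \<open>Each of the \<open>n + 2\<close> faces has its own exceptional null set; their
      finite union serves the whole sum. Faces commute with the shift by
      \<open>omit_gshift\<close>.\<close>
    have "AE x in M. \<forall>i\<in>{..Suc n}. F (gshift (Suc n) \<gamma> (omit (Suc n) i t)) (a (inv \<gamma>) x) = F (omit (Suc n) i t) x"
      using inv[OF \<gamma> omit_closed[OF t]] by (intro AE_finite_allI) auto
    then show "AE x in M. family_delta n F (gshift (Suc (Suc n)) \<gamma> t) (a (inv \<gamma>) x) = family_delta n F t x"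
      by (rule eventually_mono) (auto simp: family_delta_def omit_gshift simp del: sum.atMost_Suc intro!: sum.cong)
  qed
  show "grp_delta \<Gamma> (L0 M) n (r \<odot>\<^bsub>grp_cochains \<Gamma> (L0 M) \<tau> n\<^esub> f) =
      r \<odot>\<^bsub>grp_cochains \<Gamma> (L0 M) \<tau> (Suc n)\<^esub> grp_delta \<Gamma> (L0 M) n f" for r
    by (simp add: F(2) meas family_class_smult grp_delta_family_class)
      (simp add: family_delta_def[abs_def] scaleR_sum_right mult.commute del: sum.atMost_Suc)
  show "grp_delta \<Gamma> (L0 M) (Suc n) (grp_delta \<Gamma> (L0 M) n f) = \<zero>\<^bsub>grp_cochains \<Gamma> (L0 M) \<tau> (Suc (Suc n))\<^esub>"
    unfolding F(2) by (simp add: meas grp_delta_family_class) (simp add: family_delta_family_delta[abs_def] family_class_def grp_cochains_ops zero_L0)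
  fix g :: "(nat \<Rightarrow> 'g) \<Rightarrow> ('x \<Rightarrow> 'e) set"
  assume "g \<in> carrier (grp_cochains \<Gamma> (L0 M) \<tau> n)"
  then obtain G where G: "meas_family (Suc n) G" "g = family_class (Suc n) G"
    by (rule grp_L0_cases) blast
  show "grp_delta \<Gamma> (L0 M) n (f \<oplus>\<^bsub>grp_cochains \<Gamma> (L0 M) \<tau> n\<^esub> g) =
      grp_delta \<Gamma> (L0 M) n f \<oplus>\<^bsub>grp_cochains \<Gamma> (L0 M) \<tau> (Suc n)\<^esub> grp_delta \<Gamma> (L0 M) n g"
    by (simp add: F(2) G meas meas_family_family_delta[OF G(1)] meas_family_lincomb(1)[OF F(1) G(1)] family_class_add grp_delta_family_class)
      (simp add: family_delta_def[abs_def] scaleR_add_right sum.distrib del: sum.atMost_Suc)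
qed

section \<open>Coefficients in essentially bounded functions\<close>

lemma mem_grp_Linf_iff:
  "f \<in> carrier (grp_cochains \<Gamma> (Linf M) \<tau> n) \<longleftrightarrow>
    f \<in> carrier (grp_cochains \<Gamma> (L0 M) \<tau> n) \<and> (\<forall>t\<in>gtuples \<Gamma> (Suc n). f t \<in> carrier (Linf M))"
  using Linf_subset_L0 by (fastforce simp: mem_grp_cochains_iff PiE_iff)

text \<open>The sum in \<open>grp_delta\<close> depends on the coefficient record;
  \<open>finsum_submodule\<close> identifies the two versions, and the sum stays in the
  subspace.\<close>

lemma grp_delta_Linf:
  assumes "\<And>t. t \<in> gtuples \<Gamma> (Suc n) \<Longrightarrow> f t \<in> carrier (Linf M)"
  shows "grp_delta \<Gamma> (Linf M) n f = grp_delta \<Gamma> (L0 M) n f"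
    and "t \<in> gtuples \<Gamma> (Suc (Suc n)) \<Longrightarrow> grp_delta \<Gamma> (Linf M) n f t \<in> carrier (Linf M)"
proof -
  interpret Linf: Module.module real_field "Linf M"
    by (rule real_module_Linf)
  have mem: "(- 1) ^ i \<odot>\<^bsub>Linf M\<^esub> f (omit (Suc n) i t) \<in> carrier (Linf M)" if "t \<in> gtuples \<Gamma> (Suc (Suc n))" for i t
    using Linf.smult_closed[of "(- 1) ^ i" "f (omit (Suc n) i t)"] assms[OF omit_closed[OF that]] by simp
  have "(\<Oplus>\<^bsub>Linf M\<^esub>i\<in>{..Suc n}. (- 1) ^ i \<odot>\<^bsub>Linf M\<^esub> f (omit (Suc n) i t)) =
      (\<Oplus>\<^bsub>L0 M\<^esub>i\<in>{..Suc n}. (- 1) ^ i \<odot>\<^bsub>L0 M\<^esub> f (omit (Suc n) i t))" if "t \<in> gtuples \<Gamma> (Suc (Suc n))" for t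
    using mem[OF that]
    by (subst Linf_eq, subst finsum_submodule[OF real_module_L0 real_submodule_Linf]) auto
  then show "grp_delta \<Gamma> (Linf M) n f = grp_delta \<Gamma> (L0 M) n f"
    unfolding grp_delta_def by (intro restrict_ext)
  show "grp_delta \<Gamma> (Linf M) n f t \<in> carrier (Linf M)" if "t \<in> gtuples \<Gamma> (Suc (Suc n))"
  proof -
    have "grp_delta \<Gamma> (Linf M) n f t = (\<Oplus>\<^bsub>Linf M\<^esub>i\<in>{..Suc n}. (- 1) ^ i \<odot>\<^bsub>Linf M\<^esub> f (omit (Suc n) i t))"
      using that by (simp only: grp_delta_def restrict_apply if_True)
    also have "\<dots> \<in> carrier (Linf M)"
      by (rule Linf.finsum_closed) (use mem[OF that] in blast)
    finally show ?thesis .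
  qed
qed

lemma real_module_grp_Linf: "real_module (grp_cochains \<Gamma> (Linf M) \<tau> n)"
  by (intro real_module_grp_cochains real_module_Linf linear_hom_translate_Linf)

text \<open>The cochain map is a restriction to \<open>gtuples\<close> because
  \<open>coeff_map\<close> has this form. Cochains are extensional, so it fixes them
  (\<open>res\<close>); injectivity is then immediate and \<open>cochain_complex_embed\<close>
  applies.\<close>

lemma grp_Linf_embed:
  "cochain_complex (grp_cochains \<Gamma> (Linf M :: (real, ('x \<Rightarrow> 'e::{banach, second_countable_topology}) set) module) \<tau>)
    (grp_delta \<Gamma> (Linf M))"
  "cochain_map (grp_cochains \<Gamma> (Linf M :: (real, ('x \<Rightarrow> 'e) set) module) \<tau>) (grp_delta \<Gamma> (Linf M))
    (grp_cochains \<Gamma> (L0 M) \<tau>) (grp_delta \<Gamma> (L0 M)) (\<lambda>n f. \<lambda>t\<in>gtuples \<Gamma> (Suc n). f t)"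
proof -
  have res: "(\<lambda>t\<in>gtuples \<Gamma> (Suc n). f t) = f" if "f \<in> carrier (grp_cochains \<Gamma> V \<pi> n)"
    for f n and V :: "(real, ('x \<Rightarrow> 'e) set) module" and \<pi>
    using that by (auto simp: mem_grp_cochains_iff PiE_iff extensional_restrict)
  note C = cochain_complex_grp_L0[where ?'e = 'e]
  have d: "grp_delta \<Gamma> (Linf M) n f \<in> carrier (grp_cochains \<Gamma> (Linf M) \<tau> (Suc n))"
    if f: "f \<in> carrier (grp_cochains \<Gamma> (Linf M) \<tau> n)" for f :: "(nat \<Rightarrow> 'g) \<Rightarrow> ('x \<Rightarrow> 'e) set" and n
  proof -
    have "linear_hom (grp_cochains \<Gamma> (L0 M) \<tau> n) (grp_cochains \<Gamma> (L0 M) \<tau> (Suc n))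
        (grp_delta \<Gamma> (L0 M :: (real, ('x \<Rightarrow> 'e) set) module) n)"
      using C by (simp add: cochain_complex_def)
    from linear_homD(3)[OF this] show ?thesis
      using f grp_delta_Linf[of n f] by (auto simp: mem_grp_Linf_iff)
  qed
  have lin: "linear_hom (grp_cochains \<Gamma> (Linf M :: (real, ('x \<Rightarrow> 'e) set) module) \<tau> n)
      (grp_cochains \<Gamma> (L0 M) \<tau> n) (\<lambda>f. \<lambda>t\<in>gtuples \<Gamma> (Suc n). f t)" for n
  proof (intro linear_homI real_module_grp_Linf real_module_grp_L0)
    fix f :: "(nat \<Rightarrow> 'g) \<Rightarrow> ('x \<Rightarrow> 'e) set"
    assume "f \<in> carrier (grp_cochains \<Gamma> (Linf M) \<tau> n)"
    then show "(\<lambda>t\<in>gtuples \<Gamma> (Suc n). f t) \<in> carrier (grp_cochains \<Gamma> (L0 M) \<tau> n)"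
      using res[of f] by (auto simp: mem_grp_Linf_iff)
  qed (auto simp: grp_cochains_ops fun_eq_iff restrict_def)
  have inj: "inj_on (\<lambda>f. \<lambda>t\<in>gtuples \<Gamma> (Suc n). f t)
      (carrier (grp_cochains \<Gamma> (Linf M :: (real, ('x \<Rightarrow> 'e) set) module) \<tau> n))" for n
    by (intro inj_onI) (simp add: res)
  have comm: "(\<lambda>t\<in>gtuples \<Gamma> (Suc (Suc n)). grp_delta \<Gamma> (Linf M) n f t) =
      grp_delta \<Gamma> (L0 M) n (\<lambda>t\<in>gtuples \<Gamma> (Suc n). f t)"
    if f: "f \<in> carrier (grp_cochains \<Gamma> (Linf M) \<tau> n)" for f :: "(nat \<Rightarrow> 'g) \<Rightarrow> ('x \<Rightarrow> 'e) set" and n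
    using res[OF d[OF f]] res[OF f] grp_delta_Linf(1)[of n f] f by (simp add: mem_grp_Linf_iff)
  show "cochain_complex (grp_cochains \<Gamma> (Linf M :: (real, ('x \<Rightarrow> 'e) set) module) \<tau>) (grp_delta \<Gamma> (Linf M))"
    "cochain_map (grp_cochains \<Gamma> (Linf M :: (real, ('x \<Rightarrow> 'e) set) module) \<tau>) (grp_delta \<Gamma> (Linf M))
    (grp_cochains \<Gamma> (L0 M) \<tau>) (grp_delta \<Gamma> (L0 M)) (\<lambda>n f. \<lambda>t\<in>gtuples \<Gamma> (Suc n). f t)"
    using cochain_complex_embed[where B = "grp_cochains \<Gamma> (Linf M :: (real, ('x \<Rightarrow> 'e) set) module) \<tau>"
        and \<phi> = "\<lambda>n f. \<lambda>t\<in>gtuples \<Gamma> (Suc n). f t" and d = "grp_delta \<Gamma> (Linf M)", OF C lin inj] d comm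
    by auto
qed

section \<open>Bounded group cochains\<close>

abbreviation "bcochains \<equiv> grp_bounded_cochains \<Gamma> (Linf M) (Linf_norm M) \<tau>"

lemma grp_bounded_ops [simp]:
  "\<zero>\<^bsub>grp_bounded_cochains \<Gamma> V nrm \<pi> n\<^esub> = \<zero>\<^bsub>grp_cochains \<Gamma> V \<pi> n\<^esub>"
  "f \<oplus>\<^bsub>grp_bounded_cochains \<Gamma> V nrm \<pi> n\<^esub> g = f \<oplus>\<^bsub>grp_cochains \<Gamma> V \<pi> n\<^esub> g"
  "r \<odot>\<^bsub>grp_bounded_cochains \<Gamma> V nrm \<pi> n\<^esub> f = r \<odot>\<^bsub>grp_cochains \<Gamma> V \<pi> n\<^esub> f"
  by (simp_all add: grp_bounded_cochains_def)

text \<open>A uniform bound on norms amounts to one constant bounding all representatives almost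
  everywhere. The sign of the constant matters when \<mu> is zero: norms are 0 there, whereas every
  constant is an a.e. bound.\<close>

lemma family_class_bounded_iff:
  assumes F: "meas_family (Suc n) F"
  shows "family_class (Suc n) F \<in> carrier (bcochains n) \<longleftrightarrow> family_class (Suc n) F \<in> carrier (grp_cochains \<Gamma> (L0 M) \<tau> n) \<and>
    (\<exists>B\<ge>0. \<forall>t\<in>gtuples \<Gamma> (Suc n). AE x in M. norm (F t x) \<le> B)"
proof -
  have "family_class (Suc n) F \<in> carrier (bcochains n) \<longleftrightarrow> family_class (Suc n) F \<in> carrier (grp_cochains \<Gamma> (L0 M) \<tau> n) \<and>
      (\<forall>t\<in>gtuples \<Gamma> (Suc n). ae_class M (F t) \<in> carrier (Linf M)) \<and>
      (\<exists>B. \<forall>t\<in>gtuples \<Gamma> (Suc n). Linf_norm M (ae_class M (F t)) \<le> B)"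
    by (auto simp: grp_bounded_cochains_def mem_grp_Linf_iff family_class_def)
  moreover have "(\<forall>t\<in>gtuples \<Gamma> (Suc n). ae_class M (F t) \<in> carrier (Linf M)) \<and>
      (\<exists>B. \<forall>t\<in>gtuples \<Gamma> (Suc n). Linf_norm M (ae_class M (F t)) \<le> B) \<longleftrightarrow>
      (\<exists>B\<ge>0. \<forall>t\<in>gtuples \<Gamma> (Suc n). AE x in M. norm (F t x) \<le> B)" (is "?L \<longleftrightarrow> ?R")
  proof
    assume L: ?L
    then obtain B where B: "\<forall>t\<in>gtuples \<Gamma> (Suc n). Linf_norm M (ae_class M (F t)) \<le> B"
      by blast
    have "AE x in M. norm (F t x) \<le> max 0 B" if "t \<in> gtuples \<Gamma> (Suc n)" for t
      using L B that meas_familyD[OF F that] by (intro Linf_norm_leD) (auto simp: le_max_iff_disj)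
    then show ?R
      by (intro exI[of _ "max 0 B"]) auto
  next
    assume ?R
    then obtain B where "0 \<le> B" "\<forall>t\<in>gtuples \<Gamma> (Suc n). AE x in M. norm (F t x) \<le> B"
      by blast
    then show ?L
      using meas_familyD[OF F] by (auto simp: ae_class_in_Linf_iff intro!: exI[of _ B] Linf_norm_le)
  qed
  ultimately show ?thesis
    by simp
qed

lemma bcochains_cases:
  assumes "f \<in> carrier (bcochains n)"
  obtains F B where "meas_family (Suc n) F" "f = family_class (Suc n) F"
    "0 \<le> B" "\<And>t. t \<in> gtuples \<Gamma> (Suc n) \<Longrightarrow> AE x in M. norm (F t x) \<le> B"
proof -
  have "f \<in> carrier (grp_cochains \<Gamma> (L0 M) \<tau> n)"
    using assms by (auto simp: grp_bounded_cochains_def mem_grp_Linf_iff)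
  then obtain F where F: "meas_family (Suc n) F" "f = family_class (Suc n) F"
    by (rule grp_L0_cases) blast
  then show ?thesis
    using assms that by (auto simp: family_class_bounded_iff)
qed

lemma bcochains_subset:
  "carrier (bcochains n) \<subseteq> carrier (grp_cochains \<Gamma> (Linf M) \<tau> n)"
  by (auto simp: grp_bounded_cochains_def)

text \<open>Equivariance of sums and multiples is inherited from the cochains with values in
  \<open>L0\<close>, so bounds remain: \<open>\<bar>r\<bar> * A\<close> for a multiple and
  \<open>A + B\<close> for a sum.\<close>

lemma real_submodule_bcochains:
  "real_submodule (carrier (bcochains n)) (grp_cochains \<Gamma> (Linf M :: (real, ('x \<Rightarrow> 'e::{banach, second_countable_topology}) set) module) \<tau> n)"
proof (rule real_submoduleI[OF real_module_grp_Linf bcochains_subset])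
  interpret Module.module real_field "grp_cochains \<Gamma> (L0 M :: (real, ('x \<Rightarrow> 'e) set) module) \<tau> n"
    by (rule real_module_grp_L0)
  have ops: "f \<oplus>\<^bsub>grp_cochains \<Gamma> (Linf M) \<tau> n\<^esub> g = f \<oplus>\<^bsub>grp_cochains \<Gamma> (L0 M) \<tau> n\<^esub> g"
    "r \<odot>\<^bsub>grp_cochains \<Gamma> (Linf M) \<tau> n\<^esub> f = r \<odot>\<^bsub>grp_cochains \<Gamma> (L0 M) \<tau> n\<^esub> f"
    for r and f g :: "(nat \<Rightarrow> 'g) \<Rightarrow> ('x \<Rightarrow> 'e) set"
    by (simp_all add: grp_cochains_ops)
  have L0: "f \<in> carrier (grp_cochains \<Gamma> (L0 M) \<tau> n)" if "f \<in> carrier (bcochains n)"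
    for f :: "(nat \<Rightarrow> 'g) \<Rightarrow> ('x \<Rightarrow> 'e) set"
    using subsetD[OF bcochains_subset that] by (simp add: mem_grp_Linf_iff)
  have zero: "\<zero>\<^bsub>grp_cochains \<Gamma> (Linf M :: (real, ('x \<Rightarrow> 'e) set) module) \<tau> n\<^esub> = family_class (Suc n) (\<lambda>_ _. 0)"
    by (simp add: grp_cochains_ops family_class_def zero_L0)
  have "family_class (Suc n) (\<lambda>_ _. 0 :: 'e) \<in> carrier (bcochains n)"
    by (subst family_class_bounded_iff) (auto simp: family_class_mem_iff meas_family_def)
  then show "\<zero>\<^bsub>grp_cochains \<Gamma> (Linf M :: (real, ('x \<Rightarrow> 'e) set) module) \<tau> n\<^esub> \<in> carrier (bcochains n)"
    by (simp only: zero)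
  fix f g :: "(nat \<Rightarrow> 'g) \<Rightarrow> ('x \<Rightarrow> 'e) set" and r
  assume f: "f \<in> carrier (bcochains n)"
  then obtain F A where F: "meas_family (Suc n) F" "f = family_class (Suc n) F"
      "0 \<le> A" "\<And>t. t \<in> gtuples \<Gamma> (Suc n) \<Longrightarrow> AE x in M. norm (F t x) \<le> A"
    by (rule bcochains_cases) blast
  have "AE x in M. norm (r *\<^sub>R F t x) \<le> \<bar>r\<bar> * A" if "t \<in> gtuples \<Gamma> (Suc n)" for t
    using F(4)[OF that] by eventually_elim (auto intro: mult_left_mono)
  then show "r \<odot>\<^bsub>grp_cochains \<Gamma> (Linf M) \<tau> n\<^esub> f \<in> carrier (bcochains n)"
    using F smult_closed[of r f] L0[OF f]
    by (auto simp: ops family_class_smult family_class_bounded_iff meas_family_lincomb intro!: exI[of _ "\<bar>r\<bar> * A"])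
  assume g: "g \<in> carrier (bcochains n)"
  then obtain G B where G: "meas_family (Suc n) G" "g = family_class (Suc n) G"
      "0 \<le> B" "\<And>t. t \<in> gtuples \<Gamma> (Suc n) \<Longrightarrow> AE x in M. norm (G t x) \<le> B"
    by (rule bcochains_cases) blast
  have "AE x in M. norm (F t x + G t x) \<le> A + B" if "t \<in> gtuples \<Gamma> (Suc n)" for t
    using F(4)[OF that] G(4)[OF that] by eventually_elim (rule norm_triangle_mono)
  then show "f \<oplus>\<^bsub>grp_cochains \<Gamma> (Linf M) \<tau> n\<^esub> g \<in> carrier (bcochains n)"
    using F G a_closed[of f g] L0[OF f] L0[OF g]
    by (auto simp: ops family_class_add family_class_bounded_iff meas_family_lincomb intro!: exI[of _ "A + B"])
qed

lemma bcochains_eq: "bcochains n = (grp_cochains \<Gamma> (Linf M) \<tau> n)\<lparr>carrier := carrier (bcochains n)\<rparr>"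
  by (simp add: grp_bounded_cochains_def)

text \<open>A cochain bounded by \<open>B\<close> has a coboundary bounded by
  \<open>(n + 2) * B\<close>, one summand for each face, so the bounded cochains are stable under
  the coboundary.\<close>

lemma bcochains_embed:
  "cochain_complex (bcochains :: nat \<Rightarrow> (real, (nat \<Rightarrow> 'g) \<Rightarrow> ('x \<Rightarrow> 'e::{banach, second_countable_topology}) set) module)
    (grp_delta \<Gamma> (Linf M))"
  "cochain_map (bcochains :: nat \<Rightarrow> (real, (nat \<Rightarrow> 'g) \<Rightarrow> ('x \<Rightarrow> 'e) set) module) (grp_delta \<Gamma> (Linf M))
    (grp_cochains \<Gamma> (Linf M) \<tau>) (grp_delta \<Gamma> (Linf M)) (\<lambda>n f. f)"
proof -
  have lin: "linear_hom (bcochains n :: (real, (nat \<Rightarrow> 'g) \<Rightarrow> ('x \<Rightarrow> 'e) set) module) (grp_cochains \<Gamma> (Linf M) \<tau> n) (\<lambda>f. f)" for n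
    by (subst bcochains_eq) (intro linear_hom_inclusion real_module_grp_Linf real_submodule_bcochains)
  have d: "grp_delta \<Gamma> (Linf M) n f \<in> carrier (bcochains (Suc n))" if f: "f \<in> carrier (bcochains n)"
    for n and f :: "(nat \<Rightarrow> 'g) \<Rightarrow> ('x \<Rightarrow> 'e) set"
  proof -
    have fL: "f \<in> carrier (grp_cochains \<Gamma> (Linf M) \<tau> n)"
      using f bcochains_subset by auto
    obtain F B where F: "meas_family (Suc n) F" "f = family_class (Suc n) F"
        "0 \<le> B" "\<And>t. t \<in> gtuples \<Gamma> (Suc n) \<Longrightarrow> AE x in M. norm (F t x) \<le> B"
      using f by (rule bcochains_cases) blast
    have eq: "grp_delta \<Gamma> (Linf M) n f = family_class (Suc (Suc n)) (family_delta n F)"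
      using fL by (simp add: grp_delta_Linf(1) mem_grp_Linf_iff F(2) grp_delta_family_class[OF F(1)])
    have "linear_hom (grp_cochains \<Gamma> (Linf M :: (real, ('x \<Rightarrow> 'e) set) module) \<tau> n)
        (grp_cochains \<Gamma> (Linf M) \<tau> (Suc n)) (grp_delta \<Gamma> (Linf M) n)"
      using grp_Linf_embed(1)[where ?'e = 'e] by (simp add: cochain_complex_def)
    from linear_homD(3)[OF this fL]
    have "family_class (Suc (Suc n)) (family_delta n F) \<in> carrier (grp_cochains \<Gamma> (L0 M) \<tau> (Suc n))"
      by (simp add: eq mem_grp_Linf_iff)
    moreover have "AE x in M. norm (family_delta n F t x) \<le> (\<Sum>i\<le>Suc n. B)" if "t \<in> gtuples \<Gamma> (Suc (Suc n))" for t
    proof -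
      have "AE x in M. \<forall>i\<in>{..Suc n}. norm (F (omit (Suc n) i t) x) \<le> B"
        using F(4)[OF omit_closed[OF that]] by (intro AE_finite_allI) auto
      then show ?thesis
        by (rule eventually_mono) (unfold family_delta_def, intro sum_norm_le, simp)
    qed
    moreover have "0 \<le> (\<Sum>i\<le>Suc n. B)"
      using F(3) by (intro sum_nonneg)
    ultimately show ?thesis
      unfolding eq by (subst family_class_bounded_iff) (auto intro: meas_family_family_delta F(1) simp del: sum.atMost_Suc sum_constant)
  qed
  show "cochain_complex (bcochains :: nat \<Rightarrow> (real, (nat \<Rightarrow> 'g) \<Rightarrow> ('x \<Rightarrow> 'e) set) module) (grp_delta \<Gamma> (Linf M))"
    "cochain_map (bcochains :: nat \<Rightarrow> (real, (nat \<Rightarrow> 'g) \<Rightarrow> ('x \<Rightarrow> 'e) set) module) (grp_delta \<Gamma> (Linf M))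
    (grp_cochains \<Gamma> (Linf M) \<tau>) (grp_delta \<Gamma> (Linf M)) (\<lambda>n f. f)"
    using cochain_complex_embed[where B = "bcochains :: nat \<Rightarrow> (real, (nat \<Rightarrow> 'g) \<Rightarrow> ('x \<Rightarrow> 'e) set) module"
        and \<phi> = "\<lambda>n f. f" and d = "grp_delta \<Gamma> (Linf M)", OF grp_Linf_embed(1) lin inj_on_id2] d
    by auto
qed

section \<open>Homogeneous cochains of the groupoid and the exponential law\<close>

abbreviation "FM n \<equiv> fibredM \<Gamma> M a (Suc n)"
abbreviation "SM n \<equiv> stringsM \<Gamma> M a n"
abbreviation "expc n \<equiv> exp_cochain \<Gamma> M a n"

lemma meas_family_fp:
  "f \<in> borel_measurable (FM n) \<longleftrightarrow> meas_family (Suc n) (\<lambda>t x. f (fp (Suc n) t x))"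
  by (simp add: fibredM_measurable_iff meas_family_def)

text \<open>A null set of \<open>\<Gamma>\<^sup>n\<^sup>+\<^sup>1 \<times> X\<close> meets each
  slice in a null set, since a single tuple has positive counting measure. So a class of functions
  has a well-defined class as its value at a tuple.\<close>

lemma ae_linear_fp:
  "t \<in> gtuples \<Gamma> (Suc n) \<Longrightarrow>
    ae_linear (FM n) M (\<lambda>(f :: (nat \<Rightarrow> 'g \<times> 'x) \<Rightarrow> 'e::{banach, second_countable_topology}) x. f (fp (Suc n) t x))"
  by (rule ae_linear_pullback1) (auto simp: fibredM_measurable_iff fibredM_AE_iff)

lemma exp_cochain_ae_class:
  assumes "f \<in> borel_measurable (FM n)"
  shows "expc n (ae_class (FM n) f) = family_class (Suc n) (\<lambda>t x. f (fp (Suc n) t x))"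
  unfolding exp_cochain_def family_class_def
  by (intro restrict_ext L0_map_ae_class ae_linear_fp assms)

text \<open>Before invariance is imposed, classes on tuples of arrows are arbitrary families of
  classes on \<open>X\<close>. Injectivity is the slicewise description of null sets; surjectivity
  chooses representatives and glues them.\<close>

lemma exp_cochain_bij:
  "bij_betw (expc n) (carrier (L0 (FM n) :: (real, ((nat \<Rightarrow> 'g \<times> 'x) \<Rightarrow> 'e::{banach, second_countable_topology}) set) module))
    (gtuples \<Gamma> (Suc n) \<rightarrow>\<^sub>E carrier (L0 M))"
proof (rule bij_betw_imageI)
  show "inj_on (expc n) (carrier (L0 (FM n) :: (real, ((nat \<Rightarrow> 'g \<times> 'x) \<Rightarrow> 'e) set) module))"
  proof (rule inj_onI)
    fix C D :: "((nat \<Rightarrow> 'g \<times> 'x) \<Rightarrow> 'e) set"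
    assume CD: "C \<in> carrier (L0 (FM n))" "D \<in> carrier (L0 (FM n))" "expc n C = expc n D"
    then obtain f g where f: "f \<in> borel_measurable (FM n)" "C = ae_class (FM n) f"
      and g: "g \<in> borel_measurable (FM n)" "D = ae_class (FM n) g"
      by (auto simp: carrier_L0)
    have "family_class (Suc n) (\<lambda>t x. f (fp (Suc n) t x)) = family_class (Suc n) (\<lambda>t x. g (fp (Suc n) t x))"
      using CD(3) f g by (simp add: exp_cochain_ae_class)
    then show "C = D"
      using f g by (simp add: ae_class_eq_iff fibredM_AE_iff meas_family_fp family_class_eq_iff)
  qed
  show "expc n ` (carrier (L0 (FM n) :: (real, ((nat \<Rightarrow> 'g \<times> 'x) \<Rightarrow> 'e) set) module)) = gtuples \<Gamma> (Suc n) \<rightarrow>\<^sub>E carrier (L0 M)"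
  proof (intro equalityI subsetI)
    fix h :: "(nat \<Rightarrow> 'g) \<Rightarrow> ('x \<Rightarrow> 'e) set"
    assume "h \<in> expc n ` carrier (L0 (FM n))"
    then obtain f where f: "f \<in> borel_measurable (FM n)" "h = expc n (ae_class (FM n) f)"
      by (auto simp: carrier_L0)
    show "h \<in> gtuples \<Gamma> (Suc n) \<rightarrow>\<^sub>E carrier (L0 M)"
      using f(1) unfolding f(2) exp_cochain_ae_class[OF f(1)] meas_family_fp by (rule family_class_mem_PiE)
  next
    fix h :: "(nat \<Rightarrow> 'g) \<Rightarrow> ('x \<Rightarrow> 'e) set"
    assume "h \<in> gtuples \<Gamma> (Suc n) \<rightarrow>\<^sub>E carrier (L0 M)"
    then obtain F where F: "meas_family (Suc n) F" "h = family_class (Suc n) F"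
      by (rule family_class_cases)
    obtain f where f: "f \<in> borel_measurable (FM n)"
      "\<And>t x. t \<in> gtuples \<Gamma> (Suc n) \<Longrightarrow> x \<in> space M \<Longrightarrow> f (fp (Suc n) t x) = F t x"
      using fibredM_function[of n F borel] meas_familyD[OF F(1)] by blast
    have "h = expc n (ae_class (FM n) f)"
      unfolding F(2) exp_cochain_ae_class[OF f(1)] using F(1) f(2)[symmetric] by (rule family_class_cong(2))
    then show "h \<in> expc n ` carrier (L0 (FM n))"
      using f by auto
  qed
qed

text \<open>The vector space operations of \<open>grp_cochains\<close> do not involve the action,
  hence the free \<open>\<pi>\<close>.\<close>

lemma exp_cochain_linear:
  assumes "C \<in> carrier (L0 (FM n))"
  shows "D \<in> carrier (L0 (FM n)) \<Longrightarrow>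
      expc n (C \<oplus>\<^bsub>L0 (FM n)\<^esub> D) = expc n C \<oplus>\<^bsub>grp_cochains \<Gamma> (L0 M) \<pi> n\<^esub> expc n D"
    and "expc n (r \<odot>\<^bsub>L0 (FM n)\<^esub> C) = r \<odot>\<^bsub>grp_cochains \<Gamma> (L0 M) \<pi> n\<^esub> expc n C"
    and "expc n \<zero>\<^bsub>L0 (FM n)\<^esub> = \<zero>\<^bsub>grp_cochains \<Gamma> (L0 M) \<pi> n\<^esub>"
proof -
  obtain f where f: "f \<in> borel_measurable (FM n)" "C = ae_class (FM n) f"
    using assms by (auto simp: carrier_L0)
  note F = f(1)[unfolded meas_family_fp]
  show "expc n (r \<odot>\<^bsub>L0 (FM n)\<^esub> C) = r \<odot>\<^bsub>grp_cochains \<Gamma> (L0 M) \<pi> n\<^esub> expc n C"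
    using f F by (simp add: L0_ops exp_cochain_ae_class family_class_smult)
  show "expc n \<zero>\<^bsub>L0 (FM n)\<^esub> = \<zero>\<^bsub>grp_cochains \<Gamma> (L0 M) \<pi> n\<^esub>"
    by (simp add: zero_L0 exp_cochain_ae_class grp_cochains_ops family_class_def)
  assume "D \<in> carrier (L0 (FM n))"
  then obtain g where g: "g \<in> borel_measurable (FM n)" "D = ae_class (FM n) g"
    by (auto simp: carrier_L0)
  note G = g(1)[unfolded meas_family_fp]
  show "expc n (C \<oplus>\<^bsub>L0 (FM n)\<^esub> D) = expc n C \<oplus>\<^bsub>grp_cochains \<Gamma> (L0 M) \<pi> n\<^esub> expc n D"
    using f g F G by (simp add: L0_ops exp_cochain_ae_class family_class_add)
qed

text \<open>The condition ranges over all representatives of the class; they share one image under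
  \<open>expc\<close>, so it can be tested on a single one.\<close>

lemma ae_class_in_hom_cochains_iff:
  assumes f: "f \<in> borel_measurable (FM n)"
  shows "(\<forall>g\<in>ae_class (FM n) f. invariant \<Gamma> M a (Suc n) g) \<longleftrightarrow>
    expc n (ae_class (FM n) f) \<in> carrier (grp_cochains \<Gamma> (L0 M) \<tau> n)"
proof -
  have inv: "invariant \<Gamma> M a (Suc n) g \<longleftrightarrow> expc n (ae_class (FM n) f) \<in> carrier (grp_cochains \<Gamma> (L0 M) \<tau> n)"
    if "g \<in> ae_class (FM n) f" for g
  proof -
    have g: "g \<in> borel_measurable (FM n)" "ae_class (FM n) f = ae_class (FM n) g"
      using that f by (auto simp: mem_ae_class_iff ae_class_eq_iff)
    then show ?thesis
      by (simp add: exp_cochain_ae_class family_class_mem_iff invariant_iff meas_family_fp)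
  qed
  then show ?thesis
    using ae_class_self[OF f] by blast
qed

lemma mem_hom_cochains_iff:
  "C \<in> carrier (hom_cochains \<Gamma> M a n) \<longleftrightarrow>
    C \<in> carrier (L0 (FM n)) \<and> expc n C \<in> carrier (grp_cochains \<Gamma> (L0 M) \<tau> n)"
  using ae_class_in_hom_cochains_iff by (auto simp: hom_cochains_def carrier_L0)

text \<open>The essential bound on tuples of arrows and the uniform bound on families are matched by
  \<open>fibredM_bound_iff\<close>.\<close>

lemma mem_hom_bounded_cochains_iff:
  "C \<in> carrier (hom_bounded_cochains \<Gamma> M a n) \<longleftrightarrow>
    C \<in> carrier (L0 (FM n)) \<and> expc n C \<in> carrier (bcochains n)"
proof (cases "C \<in> carrier (L0 (FM n))")
  case True
  then obtain f where f: "f \<in> borel_measurable (FM n)" "C = ae_class (FM n) f"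
    by (auto simp: carrier_L0)
  have "C \<in> carrier (hom_bounded_cochains \<Gamma> M a n) \<longleftrightarrow>
      C \<in> carrier (Linf (FM n)) \<and> expc n C \<in> carrier (grp_cochains \<Gamma> (L0 M) \<tau> n)"
    using ae_class_in_hom_cochains_iff[OF f(1)] f(2) by (simp add: hom_bounded_cochains_def)
  also have "\<dots> \<longleftrightarrow> expc n C \<in> carrier (bcochains n)"
    using f by (auto simp: ae_class_in_Linf_iff fibredM_bound_iff exp_cochain_ae_class family_class_bounded_iff meas_family_fp)
  finally show ?thesis
    using True by simp
next
  case False
  then show ?thesis
    using Linf_subset_L0 by (auto simp: hom_bounded_cochains_def)
qed

lemma hom_cochains_ops [simp]:
  "\<zero>\<^bsub>hom_cochains \<Gamma> M a n\<^esub> = \<zero>\<^bsub>L0 (FM n)\<^esub>"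
  "C \<oplus>\<^bsub>hom_cochains \<Gamma> M a n\<^esub> D = C \<oplus>\<^bsub>L0 (FM n)\<^esub> D"
  "r \<odot>\<^bsub>hom_cochains \<Gamma> M a n\<^esub> C = r \<odot>\<^bsub>L0 (FM n)\<^esub> C"
  "\<zero>\<^bsub>hom_bounded_cochains \<Gamma> M a n\<^esub> = \<zero>\<^bsub>L0 (FM n)\<^esub>"
  "C \<oplus>\<^bsub>hom_bounded_cochains \<Gamma> M a n\<^esub> D = C \<oplus>\<^bsub>L0 (FM n)\<^esub> D"
  "r \<odot>\<^bsub>hom_bounded_cochains \<Gamma> M a n\<^esub> C = r \<odot>\<^bsub>L0 (FM n)\<^esub> C"
  by (simp_all add: hom_cochains_def hom_bounded_cochains_def)

text \<open>The hypotheses are closure properties in the operations of \<open>L0\<close>, since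
  \<open>S\<close> is either the space of all \<open>L0\<close>-valued cochains or that of the
  bounded ones, which was treated inside the cochains with values in \<open>Linf\<close>.\<close>

lemma real_submodule_exp_preimage:
  fixes S :: "((nat \<Rightarrow> 'g) \<Rightarrow> ('x \<Rightarrow> 'e::{banach, second_countable_topology}) set) set"
  assumes "\<zero>\<^bsub>grp_cochains \<Gamma> (L0 M) \<tau> n\<^esub> \<in> S"
    and "\<And>f g. f \<in> S \<Longrightarrow> g \<in> S \<Longrightarrow> f \<oplus>\<^bsub>grp_cochains \<Gamma> (L0 M) \<tau> n\<^esub> g \<in> S"
    and "\<And>r f. f \<in> S \<Longrightarrow> r \<odot>\<^bsub>grp_cochains \<Gamma> (L0 M) \<tau> n\<^esub> f \<in> S"
  shows "real_submodule {C \<in> carrier (L0 (FM n)). expc n C \<in> S} (L0 (FM n))"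
proof (rule real_submoduleI[OF real_module_L0])
  interpret Module.module real_field "L0 (FM n) :: (real, ((nat \<Rightarrow> 'g \<times> 'x) \<Rightarrow> 'e) set) module"
    by (rule real_module_L0)
  show "\<zero>\<^bsub>L0 (FM n)\<^esub> \<in> {C \<in> carrier (L0 (FM n)). expc n C \<in> S}"
    using assms(1) exp_cochain_linear(3)[OF zero_closed, of \<tau>] by simp
  show "C \<oplus>\<^bsub>L0 (FM n)\<^esub> D \<in> {C \<in> carrier (L0 (FM n)). expc n C \<in> S}"
    if "C \<in> {C \<in> carrier (L0 (FM n)). expc n C \<in> S}" "D \<in> {C \<in> carrier (L0 (FM n)). expc n C \<in> S}" for C D
    using that assms(2) exp_cochain_linear(1)[of C n D \<tau>] by simp
  show "r \<odot>\<^bsub>L0 (FM n)\<^esub> C \<in> {C \<in> carrier (L0 (FM n)). expc n C \<in> S}"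
    if "C \<in> {C \<in> carrier (L0 (FM n)). expc n C \<in> S}" for r C
    using that assms(3) exp_cochain_linear(2)[of C n r \<tau>] smult_closed[of r C] by simp
qed auto

lemma real_submodule_hom_cochains:
  "real_submodule (carrier (hom_cochains \<Gamma> M a n :: (real, ((nat \<Rightarrow> 'g \<times> 'x) \<Rightarrow> 'e::{banach, second_countable_topology}) set) module)) (L0 (FM n))"
proof -
  interpret Module.module real_field "grp_cochains \<Gamma> (L0 M :: (real, ('x \<Rightarrow> 'e) set) module) \<tau> n"
    by (rule real_module_grp_L0)
  have "real_submodule {C :: ((nat \<Rightarrow> 'g \<times> 'x) \<Rightarrow> 'e) set. C \<in> carrier (L0 (FM n)) \<and>
      expc n C \<in> carrier (grp_cochains \<Gamma> (L0 M) \<tau> n)} (L0 (FM n))"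
    using smult_closed by (intro real_submodule_exp_preimage) auto
  moreover have "carrier (hom_cochains \<Gamma> M a n) = {C :: ((nat \<Rightarrow> 'g \<times> 'x) \<Rightarrow> 'e) set. C \<in> carrier (L0 (FM n)) \<and>
      expc n C \<in> carrier (grp_cochains \<Gamma> (L0 M) \<tau> n)}"
    using mem_hom_cochains_iff by blast
  ultimately show ?thesis
    by simp
qed

lemma hom_bounded_subset:
  "carrier (hom_bounded_cochains \<Gamma> M a n) \<subseteq> carrier (hom_cochains \<Gamma> M a n)"
  using Linf_subset_L0 by (auto simp: hom_bounded_cochains_def hom_cochains_def)

lemma real_submodule_hom_bounded_cochains:
  "real_submodule (carrier (hom_bounded_cochains \<Gamma> M a n :: (real, ((nat \<Rightarrow> 'g \<times> 'x) \<Rightarrow> 'e::{banach, second_countable_topology}) set) module)) (L0 (FM n))"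
proof -
  have add: "f \<oplus>\<^bsub>grp_cochains \<Gamma> (Linf M) \<tau> n\<^esub> g \<in> carrier (bcochains n)"
    if "f \<in> carrier (bcochains n)" "g \<in> carrier (bcochains n)" for f g :: "(nat \<Rightarrow> 'g) \<Rightarrow> ('x \<Rightarrow> 'e) set"
    using that by (rule module.submoduleE(5)[OF real_module_grp_Linf real_submodule_bcochains])
  have smult: "r \<odot>\<^bsub>grp_cochains \<Gamma> (Linf M) \<tau> n\<^esub> f \<in> carrier (bcochains n)"
    if "f \<in> carrier (bcochains n)" for r and f :: "(nat \<Rightarrow> 'g) \<Rightarrow> ('x \<Rightarrow> 'e) set"
    using that by (intro module.submoduleE(4)[OF real_module_grp_Linf real_submodule_bcochains]) auto
  have zero: "\<zero>\<^bsub>grp_cochains \<Gamma> (L0 M :: (real, ('x \<Rightarrow> 'e) set) module) \<tau> n\<^esub> \<in> carrier (bcochains n)"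
  proof -
    interpret Module.module real_field "bcochains n :: (real, (nat \<Rightarrow> 'g) \<Rightarrow> ('x \<Rightarrow> 'e) set) module"
      by (subst bcochains_eq) (intro real_module_restrict real_module_grp_Linf real_submodule_bcochains)
    show ?thesis
      using zero_closed by (simp add: grp_cochains_ops)
  qed
  have "real_submodule {C :: ((nat \<Rightarrow> 'g \<times> 'x) \<Rightarrow> 'e) set. C \<in> carrier (L0 (FM n)) \<and> expc n C \<in> carrier (bcochains n)} (L0 (FM n))"
    using zero add smult by (intro real_submodule_exp_preimage) (auto simp: grp_cochains_ops)
  moreover have "carrier (hom_bounded_cochains \<Gamma> M a n) =
      {C :: ((nat \<Rightarrow> 'g \<times> 'x) \<Rightarrow> 'e) set. C \<in> carrier (L0 (FM n)) \<and> expc n C \<in> carrier (bcochains n)}"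
    using mem_hom_bounded_cochains_iff by blast
  ultimately show ?thesis
    by simp
qed

lemma real_module_hom_cochains: "real_module (hom_cochains \<Gamma> M a n)"
proof -
  have "hom_cochains \<Gamma> M a n = (L0 (FM n))\<lparr>carrier := carrier (hom_cochains \<Gamma> M a n)\<rparr>"
    by (simp add: hom_cochains_def)
  then show ?thesis
    using real_module_restrict[OF real_module_L0 real_submodule_hom_cochains] by metis
qed

lemma real_module_hom_bounded_cochains: "real_module (hom_bounded_cochains \<Gamma> M a n)"
proof -
  have "hom_bounded_cochains \<Gamma> M a n = (L0 (FM n))\<lparr>carrier := carrier (hom_bounded_cochains \<Gamma> M a n)\<rparr>"
    by (simp add: hom_bounded_cochains_def Linf_def)
  then show ?thesis
    using real_module_restrict[OF real_module_L0 real_submodule_hom_bounded_cochains] by metis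
qed

text \<open>Both kinds of groupoid cochains are full preimages under the bijection
  \<open>exp_cochain_bij\<close>, which therefore restricts to each of them.\<close>

lemma exp_cochain_hom_bij:
  "bij_betw (expc n) (carrier (hom_cochains \<Gamma> M a n)) (carrier (grp_cochains \<Gamma> (L0 M) \<tau> n))"
  "bij_betw (expc n) (carrier (hom_bounded_cochains \<Gamma> M a n)) (carrier (bcochains n))"
proof -
  have sub: "carrier (grp_cochains \<Gamma> (L0 M) \<tau> n) \<subseteq> gtuples \<Gamma> (Suc n) \<rightarrow>\<^sub>E carrier (L0 M)"
    by (intro subsetI) (simp add: mem_grp_cochains_iff)
  have subb: "carrier (bcochains n) \<subseteq> gtuples \<Gamma> (Suc n) \<rightarrow>\<^sub>E carrier (L0 M)"
    using sub bcochains_subset by (force simp: mem_grp_Linf_iff)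
  have *: "bij_betw (expc n) A S" if "S \<subseteq> gtuples \<Gamma> (Suc n) \<rightarrow>\<^sub>E carrier (L0 M)"
    "\<And>C. C \<in> A \<longleftrightarrow> C \<in> carrier (L0 (FM n)) \<and> expc n C \<in> S"
    for A :: "((nat \<Rightarrow> 'g \<times> 'x) \<Rightarrow> 'e::{banach, second_countable_topology}) set set" and S
  proof (rule bij_betw_subset[OF exp_cochain_bij])
    show "A \<subseteq> carrier (L0 (FM n))"
      using that by blast
    have im: "expc n ` carrier (L0 (FM n)) =
        gtuples \<Gamma> (Suc n) \<rightarrow>\<^sub>E carrier (L0 M :: (real, ('x \<Rightarrow> 'e) set) module)"
      using exp_cochain_bij by (rule bij_betw_imp_surj_on)
    show "expc n ` A = S"
    proof
      show "expc n ` A \<subseteq> S"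
        using that(2) by blast
      show "S \<subseteq> expc n ` A"
      proof
        fix f assume f: "f \<in> S"
        then have "f \<in> expc n ` carrier (L0 (FM n))"
          using subsetD[OF that(1)] unfolding im by blast
        then obtain C where "C \<in> carrier (L0 (FM n))" "f = expc n C"
          by (rule imageE)
        then show "f \<in> expc n ` A"
          using f that(2)[of C] by simp
      qed
    qed
  qed
  show "bij_betw (expc n) (carrier (hom_cochains \<Gamma> M a n)) (carrier (grp_cochains \<Gamma> (L0 M) \<tau> n))"
    by (rule *[OF sub mem_hom_cochains_iff])
  show "bij_betw (expc n) (carrier (hom_bounded_cochains \<Gamma> M a n)) (carrier (bcochains n))"
    by (rule *[OF subb mem_hom_bounded_cochains_iff])
qed

section \<open>The homogeneous coboundary in group coordinates\<close>

lemma ae_linear_hom_delta: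
  "ae_linear (FM n) (FM (Suc n))
    (\<lambda>(f :: (nat \<Rightarrow> 'g \<times> 'x) \<Rightarrow> 'e::{banach, second_countable_topology}) p. \<Sum>i\<le>Suc n. (- 1) ^ i *\<^sub>R f (omit (Suc n) i p))"
proof (rule ae_linear_pullback)
  fix i and f :: "(nat \<Rightarrow> 'g \<times> 'x) \<Rightarrow> 'e" assume i: "i \<in> {..Suc n}" and f: "f \<in> borel_measurable (FM n)"
  show "(\<lambda>p. f (omit (Suc n) i p)) \<in> borel_measurable (FM (Suc n))"
    using f i omit_closed[of _ "Suc n" i] by (auto simp: fibredM_measurable_iff omit_fp)
  assume "AE p in FM n. f p = 0"
  then show "AE p in FM (Suc n). f (omit (Suc n) i p) = 0"
    using i omit_closed[of _ "Suc n" i] by (auto simp: fibredM_AE_iff omit_fp)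
qed simp

lemma hom_delta_ae_class:
  assumes "f \<in> borel_measurable (FM n)"
  shows "hom_delta \<Gamma> M a n (ae_class (FM n) f) =
      ae_class (FM (Suc n)) (\<lambda>p. \<Sum>i\<le>Suc n. (- 1) ^ i *\<^sub>R f (omit (Suc n) i p))"
    and "(\<lambda>p. \<Sum>i\<le>Suc n. (- 1) ^ i *\<^sub>R f (omit (Suc n) i p)) \<in> borel_measurable (FM (Suc n))"
  using ae_linear_hom_delta[of n] assms linear_homD(3)[of "meas_fun (FM n)" "meas_fun (FM (Suc n))"]
  unfolding hom_delta_def by (auto simp: ae_linear_def simp del: sum.atMost_Suc intro!: L0_map_ae_class)

lemma exp_hom_delta:
  assumes "C \<in> carrier (L0 (FM n))"
  shows "hom_delta \<Gamma> M a n C \<in> carrier (L0 (FM (Suc n)))"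
    and "expc (Suc n) (hom_delta \<Gamma> M a n C) = grp_delta \<Gamma> (L0 M) n (expc n C)"
proof -
  obtain f where f: "f \<in> borel_measurable (FM n)" "C = ae_class (FM n) f"
    using assms by (auto simp: carrier_L0)
  let ?F = "\<lambda>t x. f (fp (Suc n) t x)"
  have F: "meas_family (Suc n) ?F"
    using f(1) by (simp add: meas_family_fp)
  show "hom_delta \<Gamma> M a n C \<in> carrier (L0 (FM (Suc n)))"
    using hom_delta_ae_class[OF f(1)] by (simp add: f(2) del: sum.atMost_Suc)
  have "expc (Suc n) (hom_delta \<Gamma> M a n C) =
      family_class (Suc (Suc n)) (\<lambda>t x. \<Sum>i\<le>Suc n. (- 1) ^ i *\<^sub>R f (omit (Suc n) i (fp (Suc (Suc n)) t x)))"
    unfolding f(2) hom_delta_ae_class(1)[OF f(1)] by (rule exp_cochain_ae_class[OF hom_delta_ae_class(2)[OF f(1)]])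
  also have "\<dots> = family_class (Suc (Suc n)) (family_delta n ?F)"
    unfolding family_delta_def[abs_def] by (intro arg_cong[where f = "family_class _"] ext sum.cong) (auto simp: omit_fp)
  also have "\<dots> = grp_delta \<Gamma> (L0 M) n (expc n C)"
    unfolding f(2) exp_cochain_ae_class[OF f(1)] by (rule grp_delta_family_class[OF F, symmetric])
  finally show "expc (Suc n) (hom_delta \<Gamma> M a n C) = grp_delta \<Gamma> (L0 M) n (expc n C)" .
qed

lemma hom_embed:
  "cochain_complex (hom_cochains \<Gamma> M a :: nat \<Rightarrow> (real, ((nat \<Rightarrow> 'g \<times> 'x) \<Rightarrow> 'e::{banach, second_countable_topology}) set) module)
    (hom_delta \<Gamma> M a)"
  "cochain_map (hom_cochains \<Gamma> M a :: nat \<Rightarrow> (real, ((nat \<Rightarrow> 'g \<times> 'x) \<Rightarrow> 'e) set) module) (hom_delta \<Gamma> M a)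
    (grp_cochains \<Gamma> (L0 M) \<tau>) (grp_delta \<Gamma> (L0 M)) (exp_cochain \<Gamma> M a)"
proof -
  note C = cochain_complex_grp_L0[where ?'e = 'e]
  have lin: "linear_hom (hom_cochains \<Gamma> M a n :: (real, ((nat \<Rightarrow> 'g \<times> 'x) \<Rightarrow> 'e) set) module)
      (grp_cochains \<Gamma> (L0 M) \<tau> n) (expc n)" for n
    by (intro linear_homI real_module_hom_cochains real_module_grp_L0)
      (simp_all add: mem_hom_cochains_iff exp_cochain_linear[where \<pi> = \<tau>])
  have inj: "inj_on (expc n) (carrier (hom_cochains \<Gamma> M a n :: (real, ((nat \<Rightarrow> 'g \<times> 'x) \<Rightarrow> 'e) set) module))" for n
    using exp_cochain_hom_bij(1) by (rule bij_betw_imp_inj_on)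
  have lind: "linear_hom (grp_cochains \<Gamma> (L0 M) \<tau> n) (grp_cochains \<Gamma> (L0 M) \<tau> (Suc n))
        (grp_delta \<Gamma> (L0 M :: (real, ('x \<Rightarrow> 'e) set) module) n)" for n
    using C by (simp add: cochain_complex_def)
  have d: "hom_delta \<Gamma> M a n C \<in> carrier (hom_cochains \<Gamma> M a (Suc n))"
    and comm: "expc (Suc n) (hom_delta \<Gamma> M a n C) = grp_delta \<Gamma> (L0 M) n (expc n C)"
    if "C \<in> carrier (hom_cochains \<Gamma> M a n)" for n and C :: "((nat \<Rightarrow> 'g \<times> 'x) \<Rightarrow> 'e) set"
    using that linear_homD(3)[OF lind] exp_hom_delta[of C n] by (simp_all add: mem_hom_cochains_iff)
  show "cochain_complex (hom_cochains \<Gamma> M a :: nat \<Rightarrow> (real, ((nat \<Rightarrow> 'g \<times> 'x) \<Rightarrow> 'e) set) module) (hom_delta \<Gamma> M a)"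
    "cochain_map (hom_cochains \<Gamma> M a :: nat \<Rightarrow> (real, ((nat \<Rightarrow> 'g \<times> 'x) \<Rightarrow> 'e) set) module) (hom_delta \<Gamma> M a)
    (grp_cochains \<Gamma> (L0 M) \<tau>) (grp_delta \<Gamma> (L0 M)) (exp_cochain \<Gamma> M a)"
    using cochain_complex_embed[where B = "hom_cochains \<Gamma> M a :: nat \<Rightarrow> (real, ((nat \<Rightarrow> 'g \<times> 'x) \<Rightarrow> 'e) set) module"
        and \<phi> = "exp_cochain \<Gamma> M a" and d = "hom_delta \<Gamma> M a", OF C lin inj] d comm
    by auto
qed

text \<open>The target is \<open>bcochains\<close> with the coboundary of \<open>Linf\<close>, as
  \<open>exp_mb\<close> takes its values in that complex. The local fact \<open>Linf\<close>
  replaces this coboundary by the one for \<open>L0\<close>, already known to match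
  \<open>hom_delta\<close>.\<close>

lemma hom_bounded_embed:
  "cochain_complex (hom_bounded_cochains \<Gamma> M a :: nat \<Rightarrow> (real, ((nat \<Rightarrow> 'g \<times> 'x) \<Rightarrow> 'e::{banach, second_countable_topology}) set) module)
    (hom_delta \<Gamma> M a)"
  "cochain_map (hom_bounded_cochains \<Gamma> M a :: nat \<Rightarrow> (real, ((nat \<Rightarrow> 'g \<times> 'x) \<Rightarrow> 'e) set) module) (hom_delta \<Gamma> M a)
    bcochains (grp_delta \<Gamma> (Linf M)) (exp_cochain \<Gamma> M a)"
proof -
  note C = bcochains_embed(1)[where ?'e = 'e]
  have real_module_b: "real_module (bcochains n :: (real, (nat \<Rightarrow> 'g) \<Rightarrow> ('x \<Rightarrow> 'e) set) module)" for n
    by (subst bcochains_eq) (intro real_module_restrict real_module_grp_Linf real_submodule_bcochains)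
  have lin: "linear_hom (hom_bounded_cochains \<Gamma> M a n :: (real, ((nat \<Rightarrow> 'g \<times> 'x) \<Rightarrow> 'e) set) module)
      (bcochains n) (expc n)" for n
    by (intro linear_homI real_module_hom_bounded_cochains real_module_b)
      (simp_all add: mem_hom_bounded_cochains_iff exp_cochain_linear[where \<pi> = \<tau>], simp_all add: grp_cochains_ops)
  have inj: "inj_on (expc n) (carrier (hom_bounded_cochains \<Gamma> M a n :: (real, ((nat \<Rightarrow> 'g \<times> 'x) \<Rightarrow> 'e) set) module))" for n
    using exp_cochain_hom_bij(2) by (rule bij_betw_imp_inj_on)
  have lind: "linear_hom (bcochains n) (bcochains (Suc n))
        (grp_delta \<Gamma> (Linf M :: (real, ('x \<Rightarrow> 'e) set) module) n)" for n
    using C by (simp add: cochain_complex_def)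
  have Linf: "grp_delta \<Gamma> (Linf M) n f = grp_delta \<Gamma> (L0 M) n f" if "f \<in> carrier (bcochains n)"
    for n and f :: "(nat \<Rightarrow> 'g) \<Rightarrow> ('x \<Rightarrow> 'e) set"
    using subsetD[OF bcochains_subset that] by (intro grp_delta_Linf(1)) (simp add: mem_grp_Linf_iff)
  have d: "hom_delta \<Gamma> M a n C \<in> carrier (hom_bounded_cochains \<Gamma> M a (Suc n))"
    and comm: "expc (Suc n) (hom_delta \<Gamma> M a n C) = grp_delta \<Gamma> (Linf M) n (expc n C)"
    if "C \<in> carrier (hom_bounded_cochains \<Gamma> M a n)" for n and C :: "((nat \<Rightarrow> 'g \<times> 'x) \<Rightarrow> 'e) set"
    using that linear_homD(3)[OF lind, of "expc n C" n] exp_hom_delta[of C n] Linf[of "expc n C" n]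
    by (simp_all add: mem_hom_bounded_cochains_iff)
  show "cochain_complex (hom_bounded_cochains \<Gamma> M a :: nat \<Rightarrow> (real, ((nat \<Rightarrow> 'g \<times> 'x) \<Rightarrow> 'e) set) module) (hom_delta \<Gamma> M a)"
    "cochain_map (hom_bounded_cochains \<Gamma> M a :: nat \<Rightarrow> (real, ((nat \<Rightarrow> 'g \<times> 'x) \<Rightarrow> 'e) set) module) (hom_delta \<Gamma> M a)
    bcochains (grp_delta \<Gamma> (Linf M)) (exp_cochain \<Gamma> M a)"
    using cochain_complex_embed[where B = "hom_bounded_cochains \<Gamma> M a :: nat \<Rightarrow> (real, ((nat \<Rightarrow> 'g \<times> 'x) \<Rightarrow> 'e) set) module"
        and \<phi> = "exp_cochain \<Gamma> M a" and d = "hom_delta \<Gamma> M a", OF C lin inj] d comm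
    by auto
qed

lemma hom_inclusion:
  "cochain_map (hom_bounded_cochains \<Gamma> M a :: nat \<Rightarrow> (real, ((nat \<Rightarrow> 'g \<times> 'x) \<Rightarrow> 'e::{banach, second_countable_topology}) set) module)
    (hom_delta \<Gamma> M a) (hom_cochains \<Gamma> M a) (hom_delta \<Gamma> M a) (\<lambda>n f. f)"
  unfolding cochain_map_def
  by (intro conjI allI ballI refl linear_homI real_module_hom_cochains real_module_hom_bounded_cochains)
    (use hom_bounded_subset in auto)


section \<open>Westman's complex\<close>

definition string_pullback :: "nat \<Rightarrow> ((nat \<Rightarrow> 'g \<times> 'x) \<times> 'x \<Rightarrow> 'e::{banach, second_countable_topology}) set \<Rightarrow> ((nat \<Rightarrow> 'g \<times> 'x) \<Rightarrow> 'e) set" where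
  "string_pullback n = L0_map (FM n) (\<lambda>f p. f (string_of n p))"

lemma meas_family_string_of:
  fixes f :: "(nat \<Rightarrow> 'g \<times> 'x) \<times> 'x \<Rightarrow> 'e::{banach, second_countable_topology}"
  assumes f: "f \<in> borel_measurable (SM n)"
  shows "(\<lambda>p. f (string_of n p)) \<in> borel_measurable (FM n)"
  unfolding meas_family_fp meas_family_def
proof
  fix t assume t: "t \<in> gtuples \<Gamma> (Suc n)"
  have "(\<lambda>x. f (sp n (quotients n t) x)) \<in> borel_measurable M"
    using f t by (simp add: stringsM_measurable_iff quotients_closed)
  then have "(\<lambda>x. f (sp n (quotients n t) (a (inv (t n)) x))) \<in> borel_measurable M"
    using gtuplesD[OF t] by (intro measurable_compose[OF act_meas]) auto
  then show "(\<lambda>x. f (string_of n (fp (Suc n) t x))) \<in> borel_measurable M"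
    by (simp add: string_of_fp[OF t] cong: measurable_cong)
qed

text \<open>The string of a tuple has base point \<open>(t n)\<^sup>-\<^sup>1 x\<close> instead of
  \<open>x\<close>, so a null set of strings is pulled back by a translation, which quasi-invariance
  permits.\<close>

lemma ae_linear_string_of:
  "ae_linear (SM n) (FM n) (\<lambda>(f :: (nat \<Rightarrow> 'g \<times> 'x) \<times> 'x \<Rightarrow> 'e::{banach, second_countable_topology}) p. f (string_of n p))"
proof (rule ae_linear_pullback1[OF meas_family_string_of])
  fix f :: "(nat \<Rightarrow> 'g \<times> 'x) \<times> 'x \<Rightarrow> 'e"
  assume f: "AE q in SM n. f q = 0"
  show "AE p in FM n. f (string_of n p) = 0"
    unfolding fibredM_AE_iff
  proof
    fix t assume t: "t \<in> gtuples \<Gamma> (Suc n)"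
    have "AE x in M. f (sp n (quotients n t) x) = 0"
      using f t by (simp add: stringsM_AE_iff quotients_closed)
    then have "AE x in M. f (sp n (quotients n t) (a (inv (t n)) x)) = 0"
      using gtuplesD[OF t] by (intro AE_act[where P = "\<lambda>x. f (sp n (quotients n t) x) = 0"]) auto
    then show "AE x in M. f (string_of n (fp (Suc n) t x)) = 0"
      by (rule AE_mp) (auto intro!: AE_I2 simp: string_of_fp[OF t])
  qed
qed

lemma string_pullback_ae_class:
  "f \<in> borel_measurable (SM n) \<Longrightarrow> string_pullback n (ae_class (SM n) f) = ae_class (FM n) (\<lambda>p. f (string_of n p))"
  unfolding string_pullback_def by (rule L0_map_ae_class[OF ae_linear_string_of])

lemma exp_string_pullback:
  assumes f: "f \<in> borel_measurable (SM n)"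
  shows "meas_family (Suc n) (\<lambda>t x. f (sp n (quotients n t) (a (inv (t n)) x)))"
    and "expc n (string_pullback n (ae_class (SM n) f)) = family_class (Suc n) (\<lambda>t x. f (sp n (quotients n t) (a (inv (t n)) x)))"
proof -
  have m: "meas_family (Suc n) (\<lambda>t x. f (string_of n (fp (Suc n) t x)))"
    using meas_family_string_of[OF f] by (simp add: meas_family_fp)
  have eq: "f (string_of n (fp (Suc n) t x)) = f (sp n (quotients n t) (a (inv (t n)) x))"
    if "t \<in> gtuples \<Gamma> (Suc n)" "x \<in> space M" for t x
    using that by (simp add: string_of_fp)
  show "meas_family (Suc n) (\<lambda>t x. f (sp n (quotients n t) (a (inv (t n)) x)))"
    using m eq by (rule family_class_cong(1))
  have "expc n (string_pullback n (ae_class (SM n) f)) = family_class (Suc n) (\<lambda>t x. f (string_of n (fp (Suc n) t x)))"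
    unfolding string_pullback_ae_class[OF f] by (rule exp_cochain_ae_class[OF meas_family_string_of[OF f]])
  also have "\<dots> = family_class (Suc n) (\<lambda>t x. f (sp n (quotients n t) (a (inv (t n)) x)))"
    using m eq by (rule family_class_cong(2))
  finally show "expc n (string_pullback n (ae_class (SM n) f)) = family_class (Suc n) (\<lambda>t x. f (sp n (quotients n t) (a (inv (t n)) x)))" .
qed

text \<open>In coordinates invariance holds at every point: quotients do not see the shift, and the
  base point \<open>(t n)\<^sup>-\<^sup>1 x\<close> is unchanged when \<open>t n\<close> and
  \<open>x\<close> are both multiplied by \<open>\<gamma>\<^sup>-\<^sup>1\<close>. In degree 0 there
  are no quotients, and the base point carries the whole argument.\<close>

lemma string_pullback_closed:
  assumes "C \<in> carrier (L0 (SM n))"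
  shows "string_pullback n C \<in> carrier (hom_cochains \<Gamma> M a n)"
proof -
  obtain f where f: "f \<in> borel_measurable (SM n)" "C = ae_class (SM n) f"
    using assms by (auto simp: carrier_L0)
  have "AE x in M. f (sp n (quotients n (gshift (Suc n) \<gamma> t)) (a (inv (gshift (Suc n) \<gamma> t n)) (a (inv \<gamma>) x))) =
      f (sp n (quotients n t) (a (inv (t n)) x))" if \<gamma>: "\<gamma> \<in> carrier \<Gamma>" and t: "t \<in> gtuples \<Gamma> (Suc n)" for \<gamma> t
    using \<gamma> gtuplesD[OF t, of n] unfolding quotients_gshift[OF \<gamma> t]
    by (intro AE_I2) (simp add: gshift_def inv_mult_group act_mult m_assoc)
  then show ?thesis
    using exp_string_pullback[OF f(1)] meas_family_string_of[OF f(1)] by (simp add: mem_hom_cochains_iff f(2) family_class_mem_iff) (simp add: string_pullback_ae_class f(1))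
qed

text \<open>At tuples with last entry 1 the base point is \<open>x\<close> itself, so the pullback
  shows the original function there; this gives injectivity. For surjectivity the preimage is built
  by \<open>stringsM_function\<close> from the values at these tuples.\<close>

lemma string_pullback_bij:
  "bij_betw (string_pullback n) (carrier (L0 (SM n) :: (real, ((nat \<Rightarrow> 'g \<times> 'x) \<times> 'x \<Rightarrow> 'e::{banach, second_countable_topology}) set) module))
    (carrier (hom_cochains \<Gamma> M a n))"
proof (rule bij_betw_imageI)
  show "inj_on (string_pullback n) (carrier (L0 (SM n) :: (real, ((nat \<Rightarrow> 'g \<times> 'x) \<times> 'x \<Rightarrow> 'e) set) module))"
  proof (rule inj_onI)
    fix C D :: "((nat \<Rightarrow> 'g \<times> 'x) \<times> 'x \<Rightarrow> 'e) set"
    assume CD: "C \<in> carrier (L0 (SM n))" "D \<in> carrier (L0 (SM n))" "string_pullback n C = string_pullback n D"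
    then obtain f g where f: "f \<in> borel_measurable (SM n)" "C = ae_class (SM n) f"
      and g: "g \<in> borel_measurable (SM n)" "D = ae_class (SM n) g"
      by (auto simp: carrier_L0)
    have "family_class (Suc n) (\<lambda>t x. f (sp n (quotients n t) (a (inv (t n)) x))) =
        family_class (Suc n) (\<lambda>t x. g (sp n (quotients n t) (a (inv (t n)) x)))"
      using CD(3) f(2) g(2) exp_string_pullback(2)[OF f(1)] exp_string_pullback(2)[OF g(1)] by simp
    then have *: "\<forall>t\<in>gtuples \<Gamma> (Suc n). AE x in M. f (sp n (quotients n t) (a (inv (t n)) x)) =
        g (sp n (quotients n t) (a (inv (t n)) x))"
      by (simp add: family_class_eq_iff exp_string_pullback(1) f g)
    have "AE x in M. f (sp n s x) = g (sp n s x)" if s: "s \<in> gtuples \<Gamma> n" for s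
      using *[rule_format, OF tuple_of_closed[OF s]]
      by (rule AE_mp) (auto intro!: AE_I2 simp: tuple_of_last quotients_tuple_of[OF s])
    then show "C = D"
      using f g by (simp add: ae_class_eq_iff stringsM_AE_iff)
  qed
  show "string_pullback n ` (carrier (L0 (SM n) :: (real, ((nat \<Rightarrow> 'g \<times> 'x) \<times> 'x \<Rightarrow> 'e) set) module)) = carrier (hom_cochains \<Gamma> M a n)"
  proof (intro equalityI subsetI)
    fix D :: "((nat \<Rightarrow> 'g \<times> 'x) \<Rightarrow> 'e) set"
    assume D: "D \<in> carrier (hom_cochains \<Gamma> M a n)"
    then obtain f where f: "f \<in> borel_measurable (FM n)" "D = ae_class (FM n) f"
      by (auto simp: mem_hom_cochains_iff carrier_L0)
    note F = f(1)[unfolded meas_family_fp]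
    have inv: "AE x in M. f (fp (Suc n) (gshift (Suc n) \<gamma> t) (a (inv \<gamma>) x)) = f (fp (Suc n) t x)"
      if "\<gamma> \<in> carrier \<Gamma>" "t \<in> gtuples \<Gamma> (Suc n)" for \<gamma> t
      using D that f F by (simp add: mem_hom_cochains_iff exp_cochain_ae_class family_class_mem_iff)
    obtain h where h: "h \<in> borel_measurable (SM n)"
      "\<And>s x. s \<in> gtuples \<Gamma> n \<Longrightarrow> x \<in> space M \<Longrightarrow> h (sp n s x) = f (fp (Suc n) (tuple_of n s) x)"
      using stringsM_function[of n "\<lambda>s x. f (fp (Suc n) (tuple_of n s) x)" borel] meas_familyD[OF F] tuple_of_closed by blast
    have "expc n (string_pullback n (ae_class (SM n) h)) = expc n D"
      unfolding exp_string_pullback(2)[OF h(1)] f(2) exp_cochain_ae_class[OF f(1)] family_class_eq_iff[OF exp_string_pullback(1)[OF h(1)] F]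
    proof
      fix t assume t: "t \<in> gtuples \<Gamma> (Suc n)"
      have tn: "t n \<in> carrier \<Gamma>"
        using gtuplesD[OF t] by simp
      \<comment> \<open>With \<open>t n\<close> for \<gamma>, the shifted tuple in
        \<open>inv\<close> is the normalised one, \<open>tuple_of n (quotients n t)\<close>, from
        which \<open>h\<close> takes its values.\<close>
      show "AE x in M. h (sp n (quotients n t) (a (inv (t n)) x)) = f (fp (Suc n) t x)"
        using inv[OF tn t] by (rule AE_mp) (auto intro!: AE_I2 simp: h(2) quotients_closed[OF t] tn tuple_of_quotients[OF t])
    qed
    moreover have "string_pullback n (ae_class (SM n) h) \<in> carrier (hom_cochains \<Gamma> M a n)"
      using h(1) by (intro string_pullback_closed) simp
    ultimately have "string_pullback n (ae_class (SM n) h) = D"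
      using D by (rule inj_onD[OF bij_betw_imp_inj_on[OF exp_cochain_hom_bij(1)]])
    then show "D \<in> string_pullback n ` carrier (L0 (SM n))"
      using h(1) by auto
  qed (use string_pullback_closed in auto)
qed

section \<open>Westman's coboundary under the pullback\<close>

lemma ae_linear_westman_delta:
  "ae_linear (SM n) (SM (Suc n))
    (\<lambda>(f :: (nat \<Rightarrow> 'g \<times> 'x) \<times> 'x \<Rightarrow> 'e::{banach, second_countable_topology}) q.
      \<Sum>i\<le>Suc n. (- 1) ^ i *\<^sub>R f (string_face \<Gamma> a n i q))"
proof (rule ae_linear_pullback)
  fix i and f :: "(nat \<Rightarrow> 'g \<times> 'x) \<times> 'x \<Rightarrow> 'e" assume i: "i \<in> {..Suc n}" and f: "f \<in> borel_measurable (SM n)"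
  \<comment> \<open>\<open>u s n\<close> is 1 for \<open>i \<le> n\<close>, where the base point
    stays, and the inverse of \<open>s n\<close> for \<open>i = Suc n\<close>, where the base point
    moves by \<open>s n\<close>; quasi-invariance is called for in the second case.\<close>
  define u where "u s = omit (Suc n) i (tuple_of (Suc n) s)" for s
  have u: "u s \<in> gtuples \<Gamma> (Suc n)" if "s \<in> gtuples \<Gamma> (Suc n)" for s
    unfolding u_def by (intro omit_closed tuple_of_closed that)
  have un: "inv (u s n) \<in> carrier \<Gamma>" if "s \<in> gtuples \<Gamma> (Suc n)" for s
    using gtuplesD[OF u[OF that]] by simp
  have face: "string_face \<Gamma> a n i (sp (Suc n) s x) = sp n (quotients n (u s)) (a (inv (u s n)) x)"
    if "s \<in> gtuples \<Gamma> (Suc n)" "x \<in> space M" for s x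
    using string_face_sp[OF that] i by (simp add: u_def)
  show "(\<lambda>q. f (string_face \<Gamma> a n i q)) \<in> borel_measurable (SM (Suc n))"
    unfolding stringsM_measurable_iff
  proof
    fix s assume s: "s \<in> gtuples \<Gamma> (Suc n)"
    have "(\<lambda>x. f (sp n (quotients n (u s)) x)) \<in> borel_measurable M"
      using f quotients_closed[OF u[OF s]] by (simp add: stringsM_measurable_iff)
    from measurable_compose[OF act_meas[OF un[OF s]] this]
    show "(\<lambda>x. f (string_face \<Gamma> a n i (sp (Suc n) s x))) \<in> borel_measurable M"
      by (simp add: face[OF s] cong: measurable_cong)
  qed
  assume f0: "AE q in SM n. f q = 0"
  show "AE q in SM (Suc n). f (string_face \<Gamma> a n i q) = 0"
    unfolding stringsM_AE_iff
  proof
    fix s assume s: "s \<in> gtuples \<Gamma> (Suc n)"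
    have "AE x in M. f (sp n (quotients n (u s)) x) = 0"
      using f0 quotients_closed[OF u[OF s]] by (simp add: stringsM_AE_iff)
    from AE_act[OF this un[OF s]]
    show "AE x in M. f (string_face \<Gamma> a n i (sp (Suc n) s x)) = 0"
      by (rule AE_mp) (auto intro!: AE_I2 simp: face[OF s])
  qed
qed simp

lemma westman_delta_ae_class:
  assumes "f \<in> borel_measurable (SM n)"
  shows "westman_delta \<Gamma> M a n (ae_class (SM n) f) =
      ae_class (SM (Suc n)) (\<lambda>q. \<Sum>i\<le>Suc n. (- 1) ^ i *\<^sub>R f (string_face \<Gamma> a n i q))"
    and "(\<lambda>q. \<Sum>i\<le>Suc n. (- 1) ^ i *\<^sub>R f (string_face \<Gamma> a n i q)) \<in> borel_measurable (SM (Suc n))"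
  using ae_linear_westman_delta[of n] assms linear_homD(3)[of "meas_fun (SM n)" "meas_fun (SM (Suc n))"]
  unfolding westman_delta_def by (auto simp: ae_linear_def simp del: sum.atMost_Suc intro!: L0_map_ae_class)

text \<open>\<open>string_face_string_of\<close> matches the faces one by one at every point of a
  slice, so the alternating sums agree term by term.\<close>

lemma string_pullback_westman_delta:
  assumes "C \<in> carrier (L0 (SM n))"
  shows "westman_delta \<Gamma> M a n C \<in> carrier (L0 (SM (Suc n)))"
    and "string_pullback (Suc n) (westman_delta \<Gamma> M a n C) = hom_delta \<Gamma> M a n (string_pullback n C)"
proof -
  obtain f where f: "f \<in> borel_measurable (SM n)" "C = ae_class (SM n) f"
    using assms by (auto simp: carrier_L0)
  note d = westman_delta_ae_class[OF f(1)]
  show "westman_delta \<Gamma> M a n C \<in> carrier (L0 (SM (Suc n)))"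
    using d by (simp add: f(2) del: sum.atMost_Suc)
  note h = hom_delta_ae_class[OF meas_family_string_of[OF f(1)]]
  have "AE p in FM (Suc n). (\<Sum>i\<le>Suc n. (- 1) ^ i *\<^sub>R f (string_face \<Gamma> a n i (string_of (Suc n) p))) =
      (\<Sum>i\<le>Suc n. (- 1) ^ i *\<^sub>R f (string_of n (omit (Suc n) i p)))"
    unfolding fibredM_AE_iff by (intro ballI AE_I2 sum.cong refl) (simp add: string_face_string_of)
  then show "string_pullback (Suc n) (westman_delta \<Gamma> M a n C) = hom_delta \<Gamma> M a n (string_pullback n C)"
    unfolding f(2) d(1) string_pullback_ae_class[OF d(2)] string_pullback_ae_class[OF f(1)] h(1)
    using meas_family_string_of[OF d(2)] h(2) by (simp add: ae_class_eq_iff del: sum.atMost_Suc)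
qed

lemma westman_embed:
  "cochain_complex (westman_cochains \<Gamma> M a :: nat \<Rightarrow> (real, ((nat \<Rightarrow> 'g \<times> 'x) \<times> 'x \<Rightarrow> 'e::{banach, second_countable_topology}) set) module)
    (westman_delta \<Gamma> M a)"
  "cochain_map (westman_cochains \<Gamma> M a :: nat \<Rightarrow> (real, ((nat \<Rightarrow> 'g \<times> 'x) \<times> 'x \<Rightarrow> 'e) set) module) (westman_delta \<Gamma> M a)
    (hom_cochains \<Gamma> M a) (hom_delta \<Gamma> M a) string_pullback"
proof -
  note C = hom_embed(1)[where ?'e = 'e]
  have lin: "linear_hom (westman_cochains \<Gamma> M a n :: (real, ((nat \<Rightarrow> 'g \<times> 'x) \<times> 'x \<Rightarrow> 'e) set) module)
      (hom_cochains \<Gamma> M a n) (string_pullback n)" for n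
  proof -
    have "linear_hom (L0 (SM n)) (L0 (FM n)) (string_pullback n :: ((nat \<Rightarrow> 'g \<times> 'x) \<times> 'x \<Rightarrow> 'e) set \<Rightarrow> _)"
      unfolding string_pullback_def by (rule linear_hom_L0_map[OF ae_linear_string_of])
    from linear_homD[OF this] show ?thesis
      unfolding westman_cochains_def
      by (intro linear_homI real_module_hom_cochains real_module_L0) (auto intro: string_pullback_closed)
  qed
  have inj: "inj_on (string_pullback n) (carrier (westman_cochains \<Gamma> M a n :: (real, ((nat \<Rightarrow> 'g \<times> 'x) \<times> 'x \<Rightarrow> 'e) set) module))" for n
    unfolding westman_cochains_def using string_pullback_bij by (rule bij_betw_imp_inj_on)
  have d: "westman_delta \<Gamma> M a n C \<in> carrier (westman_cochains \<Gamma> M a (Suc n))"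
    and comm: "string_pullback (Suc n) (westman_delta \<Gamma> M a n C) = hom_delta \<Gamma> M a n (string_pullback n C)"
    if "C \<in> carrier (westman_cochains \<Gamma> M a n)" for n and C :: "((nat \<Rightarrow> 'g \<times> 'x) \<times> 'x \<Rightarrow> 'e) set"
    using that string_pullback_westman_delta[of C n] by (simp_all add: westman_cochains_def)
  show "cochain_complex (westman_cochains \<Gamma> M a :: nat \<Rightarrow> (real, ((nat \<Rightarrow> 'g \<times> 'x) \<times> 'x \<Rightarrow> 'e) set) module) (westman_delta \<Gamma> M a)"
    "cochain_map (westman_cochains \<Gamma> M a :: nat \<Rightarrow> (real, ((nat \<Rightarrow> 'g \<times> 'x) \<times> 'x \<Rightarrow> 'e) set) module) (westman_delta \<Gamma> M a)
    (hom_cochains \<Gamma> M a) (hom_delta \<Gamma> M a) string_pullback"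
    using cochain_complex_embed[where B = "westman_cochains \<Gamma> M a :: nat \<Rightarrow> (real, ((nat \<Rightarrow> 'g \<times> 'x) \<times> 'x \<Rightarrow> 'e) set) module"
        and \<phi> = string_pullback and d = "westman_delta \<Gamma> M a", OF C lin inj] d comm
    by auto
qed

lemma westman_to_hom_eq:
  "westman_to_hom \<Gamma> M a n = cohomology_map (hom_cochains \<Gamma> M a) (hom_delta \<Gamma> M a) string_pullback n"
  by (simp add: westman_to_hom_def string_pullback_def[abs_def] string_of_def)


section \<open>The comparison square\<close>

text \<open>This makes the \<open>inv_into\<close> in \<open>comp_gpd\<close> a true
  inverse.\<close>

lemma linear_iso_westman_to_hom:
  "linear_iso (H_m \<Gamma> M a TYPE('e::{banach, second_countable_topology}) n) (H_hom \<Gamma> M a TYPE('e) n) (westman_to_hom \<Gamma> M a n)"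
  unfolding H_m_def H_hom_def westman_to_hom_eq
  by (intro linear_iso_cohomology_map westman_embed hom_embed) (simp add: westman_cochains_def string_pullback_bij)

lemma linear_iso_exp_mb:
  "linear_iso (H_mb \<Gamma> M a TYPE('e::{banach, second_countable_topology}) n) (Hb_Linf \<Gamma> M a TYPE('e) n) (exp_mb \<Gamma> M a n)"
  unfolding H_mb_def Hb_Linf_def Hb_grp_def exp_mb_def
  by (intro linear_iso_cohomology_map hom_bounded_embed bcochains_embed exp_cochain_hom_bij)

lemma linear_iso_exp_hom:
  "linear_iso (H_hom \<Gamma> M a TYPE('e::{banach, second_countable_topology}) n) (H_L0 \<Gamma> M a TYPE('e) n)
    (cohomology_map (grp_cochains \<Gamma> (L0 M) \<tau>) (grp_delta \<Gamma> (L0 M)) (exp_cochain \<Gamma> M a) n)"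
  unfolding H_hom_def H_L0_def H_grp_def
  by (intro linear_iso_cohomology_map hom_embed cochain_complex_grp_L0 exp_cochain_hom_bij)

lemma linear_iso_exp_m:
  "linear_iso (H_m \<Gamma> M a TYPE('e::{banach, second_countable_topology}) n) (H_L0 \<Gamma> M a TYPE('e) n) (exp_m \<Gamma> M a n)"
  using linear_iso_comp[OF linear_iso_westman_to_hom linear_iso_exp_hom] unfolding exp_m_def[abs_def] .

lemma linear_hom_inclusion_hom:
  "linear_hom (H_mb \<Gamma> M a TYPE('e::{banach, second_countable_topology}) n) (H_hom \<Gamma> M a TYPE('e) n)
    (cohomology_map (hom_cochains \<Gamma> M a) (hom_delta \<Gamma> M a) (\<lambda>n f. f) n)"
  unfolding H_mb_def H_hom_def
  by (intro linear_hom_cohomology_map hom_bounded_embed hom_embed hom_inclusion)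

lemma linear_hom_comp_gpd:
  "linear_hom (H_mb \<Gamma> M a TYPE('e::{banach, second_countable_topology}) n) (H_m \<Gamma> M a TYPE('e) n) (comp_gpd \<Gamma> M a TYPE('e) n)"
  using linear_hom_comp[OF linear_hom_inclusion_hom linear_iso_inv[OF linear_iso_westman_to_hom]]
  unfolding comp_gpd_def[abs_def] .

lemma linear_hom_comp_Linf:
  "linear_hom (Hb_Linf \<Gamma> M a TYPE('e::{banach, second_countable_topology}) n) (H_Linf \<Gamma> M a TYPE('e) n) (comp_Linf \<Gamma> M a n)"
  unfolding Hb_Linf_def Hb_grp_def H_Linf_def H_grp_def comp_Linf_def comp_grp_def
  by (intro linear_hom_cohomology_map bcochains_embed grp_Linf_embed)

lemma linear_hom_Linf_to_L0:
  "linear_hom (H_Linf \<Gamma> M a TYPE('e::{banach, second_countable_topology}) n) (H_L0 \<Gamma> M a TYPE('e) n) (Linf_to_L0 \<Gamma> M a n)"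
  unfolding H_L0_def H_Linf_def H_grp_def Linf_to_L0_def coeff_map_def
  by (intro linear_hom_cohomology_map cochain_complex_grp_L0 grp_Linf_embed)

text \<open>Both paths send the class of a cocycle \<open>z\<close> to the class of
  \<open>expc n z\<close> in \<open>H_L0\<close>; the two maps on the group side only enlarge the
  complex in which this cochain is read.\<close>

lemma comparison_square:
  assumes c: "c \<in> carrier (H_mb \<Gamma> M a TYPE('e::{banach, second_countable_topology}) n)"
  shows "exp_m \<Gamma> M a n (comp_gpd \<Gamma> M a TYPE('e) n c) =
    Linf_to_L0 \<Gamma> M a n (comp_Linf \<Gamma> M a n (exp_mb \<Gamma> M a n c))"
proof -
  let ?B = "hom_bounded_cochains \<Gamma> M a :: nat \<Rightarrow> (real, ((nat \<Rightarrow> 'g \<times> 'x) \<Rightarrow> 'e) set) module"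
  let ?d = "hom_delta \<Gamma> M a :: nat \<Rightarrow> ((nat \<Rightarrow> 'g \<times> 'x) \<Rightarrow> 'e) set \<Rightarrow> _"
  let ?H = "hom_cochains \<Gamma> M a :: nat \<Rightarrow> (real, ((nat \<Rightarrow> 'g \<times> 'x) \<Rightarrow> 'e) set) module"
  let ?G = "grp_cochains \<Gamma> (L0 M :: (real, ('x \<Rightarrow> 'e) set) module) \<tau>"
  let ?dG = "grp_delta \<Gamma> (L0 M :: (real, ('x \<Rightarrow> 'e) set) module)"
  let ?res = "\<lambda>n f. \<lambda>t\<in>gtuples \<Gamma> (Suc n). f t :: ('x \<Rightarrow> 'e) set"
  note inc = hom_bounded_embed(1) hom_embed(1) hom_inclusion
  note eH = hom_embed(1) cochain_complex_grp_L0 hom_embed(2)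
  note eB = hom_bounded_embed(1) bcochains_embed(1) hom_bounded_embed(2)
  note cB = bcochains_embed(1) grp_Linf_embed(1) bcochains_embed(2)
  note jL = grp_Linf_embed(1) cochain_complex_grp_L0 grp_Linf_embed(2)
  obtain z where z: "z \<in> carrier (cocycles ?B ?d n)" "c = coboundaries ?B ?d n +>\<^bsub>cocycles ?B ?d n\<^esub> z"
    using c by (auto simp: H_mb_def cohomology_def carrier_quot_module)
  have zH: "z \<in> carrier (cocycles ?H ?d n)"
    using linear_homD(3)[OF linear_hom_cocycles(1)[OF inc] z(1)] .
  have zb: "expc n z \<in> carrier (cocycles bcochains (grp_delta \<Gamma> (Linf M)) n)"
    using linear_homD(3)[OF linear_hom_cocycles(1)[OF eB] z(1)] .
  have zl: "expc n z \<in> carrier (cocycles (grp_cochains \<Gamma> (Linf M) \<tau>) (grp_delta \<Gamma> (Linf M)) n)"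
    using linear_homD(3)[OF linear_hom_cocycles(1)[OF cB] zb] .
  let ?i = "cohomology_map ?H ?d (\<lambda>n f. f) n c"
  have "?i \<in> carrier (H_hom \<Gamma> M a TYPE('e) n)"
    using linear_homD(3)[OF linear_hom_inclusion_hom c] .
  \<comment> \<open>The inverse in \<open>comp_gpd\<close> is cancelled by
    \<open>westman_to_hom\<close>, with which \<open>exp_m\<close> begins; \<open>?i\<close> lies in
    its range by surjectivity.\<close>
  then have "westman_to_hom \<Gamma> M a n (comp_gpd \<Gamma> M a TYPE('e) n c) = ?i"
    using linear_iso_westman_to_hom[where ?'e = 'e and n = n]
    unfolding comp_gpd_def by (intro f_inv_into_f) (auto simp: linear_iso_def bij_betw_def)
  then have "exp_m \<Gamma> M a n (comp_gpd \<Gamma> M a TYPE('e) n c) = cohomology_map ?G ?dG (exp_cochain \<Gamma> M a) n ?i"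
    by (simp add: exp_m_def)
  also have "?i = coboundaries ?H ?d n +>\<^bsub>cocycles ?H ?d n\<^esub> z"
    unfolding z(2) by (rule cohomology_map_coset[OF inc z(1)])
  also have "cohomology_map ?G ?dG (exp_cochain \<Gamma> M a) n (coboundaries ?H ?d n +>\<^bsub>cocycles ?H ?d n\<^esub> z) =
      coboundaries ?G ?dG n +>\<^bsub>cocycles ?G ?dG n\<^esub> expc n z"
    by (rule cohomology_map_coset[OF eH zH])
  \<comment> \<open>\<open>exp_cochain\<close> is restricted to \<open>gtuples\<close> by
    definition, so the restriction made by \<open>coeff_map\<close> leaves it fixed.\<close>
  also have "expc n z = ?res n (expc n z)"
    unfolding exp_cochain_def by (rule restrict_ext) simp
  also have "coboundaries ?G ?dG n +>\<^bsub>cocycles ?G ?dG n\<^esub> ?res n (expc n z) =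
      Linf_to_L0 \<Gamma> M a n (comp_Linf \<Gamma> M a n (exp_mb \<Gamma> M a n c))"
    unfolding Linf_to_L0_def coeff_map_def comp_Linf_def comp_grp_def exp_mb_def z(2)
      cohomology_map_coset[OF eB z(1)] cohomology_map_coset[OF cB zb] cohomology_map_coset[OF jL zl] ..
  finally show ?thesis .
qed

end

theorem proposition5p3:
  fixes \<Gamma> :: "('g, 'z) monoid_scheme"
    and M :: "'x measure"
    and a :: "'g \<Rightarrow> 'x \<Rightarrow> 'x"
    and J :: "'e::{banach, second_countable_topology} \<Rightarrow>
              ('f::{banach, second_countable_topology} \<Rightarrow>\<^sub>L real)"
    and n :: nat
  assumes countable_group: "group \<Gamma>" "countable (carrier \<Gamma>)"
    and space: "standard_borel_action \<Gamma> M a"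
    and dual: "linear J" "\<And>v. norm (J v) = norm v" "surj J"
  shows "linear_iso (H_m \<Gamma> M a TYPE('e) n) (H_hom \<Gamma> M a TYPE('e) n) (westman_to_hom \<Gamma> M a n) \<and>
    linear_iso (H_mb \<Gamma> M a TYPE('e) n) (Hb_Linf \<Gamma> M a TYPE('e) n) (exp_mb \<Gamma> M a n) \<and>
    linear_iso (H_m \<Gamma> M a TYPE('e) n) (H_L0 \<Gamma> M a TYPE('e) n) (exp_m \<Gamma> M a n) \<and>
    linear_hom (H_mb \<Gamma> M a TYPE('e) n) (H_m \<Gamma> M a TYPE('e) n) (comp_gpd \<Gamma> M a TYPE('e) n) \<and>
    linear_hom (Hb_Linf \<Gamma> M a TYPE('e) n) (H_Linf \<Gamma> M a TYPE('e) n) (comp_Linf \<Gamma> M a n) \<and>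
    linear_hom (H_Linf \<Gamma> M a TYPE('e) n) (H_L0 \<Gamma> M a TYPE('e) n) (Linf_to_L0 \<Gamma> M a n) \<and>
    (\<forall>c\<in>carrier (H_mb \<Gamma> M a TYPE('e) n).
       exp_m \<Gamma> M a n (comp_gpd \<Gamma> M a TYPE('e) n c) =
       Linf_to_L0 \<Gamma> M a n (comp_Linf \<Gamma> M a n (exp_mb \<Gamma> M a n c)))"
proof -
  interpret countable_action \<Gamma> M a
    using countable_group(2) space by (simp add: countable_action_def countable_action_axioms_def)
  show ?thesis
    using linear_iso_westman_to_hom linear_iso_exp_mb linear_iso_exp_m linear_hom_comp_gpd
      linear_hom_comp_Linf linear_hom_Linf_to_L0 comparison_square
    by blast
qed

end
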